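(* Let $\varphi$ be a logarithmic weight satisfying conditions (i), (ii), (iii), (iv-a) and (iv-b) (listed in the context), and let $W$, $\lambda_W$ and $Q$ be associated with $\varphi$ as in the context. Then, as $s\to0$ ($s>0$), $$\log\lambda_W(s)=(1+o(1))\,Q(s).$$ If additionally $\liminf_{t\to\infty}\frac{\log\varphi(t)}{\log t}>0$, then, as $s\to0$ ($s>0$), $$\log\lambda_W(s)=Q(s)+O(\log Q(s)).$$
   Context: Conditions on the logarithmic weight $\varphi:\mathbb R\to\mathbb R$: (i) $\varphi$ is non-negative and even on $\mathbb R$; (ii) $\varphi$ increases on $(0,\infty)$ and $\lim_{t\to\infty}\varphi(t)/\log t=\infty$; (iii) $\int_{\mathbb R}\frac{\varphi(t)}{t^2+1}\,dt<\infty$; (iv-a) the function $\tau\mapsto\varphi(e^\tau)$ is convex; (iv-b) $\varphi$ is concave on $(0,\infty)$ and $\lim_{t\to\infty}t\varphi'(t+0)=\infty$. Standing assumptions: $\varphi$ is continuous on $\mathbb R$, $C^2$ on $(0,\infty)$, and $\varphi(0)=0$. $\mathbb C_+$ is the open upper half-plane and $H^\infty$ is the space of bounded analytic functions in $\mathbb C_+$. The outer weight function $W$ in $\mathbb C_+$ is $$W(z)=\exp\left\{\frac1{\pi i}\int_{\mathbb R}\left[\frac1{t-z}-\frac t{t^2+1}\right]\varphi(t)\,dt\right\},$$ so that $|W(t)|=e^{\varphi(t)}$ for boundary values on $\mathbb R$. Set $$B(W)=\{f: f\text{ entire},\ f/W\in H^\infty,\ f^*/W\in H^\infty\},\quad f^*(z)=\overline{f(\bar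 z)},\qquad \|f\|_{B(W)}=\sup_{t\in\mathbb R}\frac{|f(t)|}{|W(t)|}.$$ Functions in $B(W)$ have zero exponential type, and the Laplace transform $$(\mathcal Lf)(\zeta)=\int_0^\infty f(x)e^{-\zeta x}\,dx,\qquad \mathrm{Re}\,\zeta>0,$$ of $f\in B(W)$ extends (by rotating the ray of integration) to an analytic function in $\overline{\mathbb C}\setminus\{0\}$ vanishing at infinity, also denoted $\mathcal Lf$. Set $$\lambda_W(s)=\sup_{\|f\|_{B(W)}\le1}\ \max_{|\zeta|=s}|(\mathcal Lf)(\zeta)| .$$ The upper Legendre transform is, for $s>0$, $$Q(s)=\sup_{y>0}\left[\log|W(iy)|-ys\right]=\sup_{y>0}\left[\frac{2y}{\pi}\int_0^\infty\frac{\varphi(t)\,dt}{t^2+y^2}-ys\right].$$ *)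

theory Defs
  imports "HOL-Complex_Analysis.Complex_Analysis" "HOL-Library.Landau_Symbols"
begin

(* The right derivative f'(t+0). *)
definition right_deriv :: "(real \<Rightarrow> real) \<Rightarrow> real \<Rightarrow> real" where
  "right_deriv f t = vector_derivative f (at_right t)"

definition C2_on_pos :: "(real \<Rightarrow> real) \<Rightarrow> bool" where
  "C2_on_pos f \<longleftrightarrow>
     f differentiable_on {0<..} \<and> deriv f differentiable_on {0<..} \<and>
     continuous_on {0<..} (deriv (deriv f))"

(* As phi is non-negative, integrability says that the integral of
   phi(t) / (t^2 + 1) over the real line is finite. *)
definition logarithmic_weight :: "(real \<Rightarrow> real) \<Rightarrow> bool" where
  "logarithmic_weight \<phi> \<longleftrightarrow>
     continuous_on UNIV \<phi> \<and> C2_on_pos \<phi> \<and> \<phi> 0 = 0 \<and>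
     (\<forall>t. 0 \<le> \<phi> t) \<and> (\<forall>t. \<phi> (- t) = \<phi> t) \<and>
     mono_on {0<..} \<phi> \<and> filterlim (\<lambda>t. \<phi> t / ln t) at_top at_top \<and>
     integrable lborel (\<lambda>t. \<phi> t / (t\<^sup>2 + 1)) \<and>
     convex_on UNIV (\<lambda>\<tau>. \<phi> (exp \<tau>)) \<and>
     concave_on {0<..} \<phi> \<and> filterlim (\<lambda>t. t * right_deriv \<phi> t) at_top at_top"

definition upper_half_plane :: "complex set" where
  "upper_half_plane = {z. Im z > 0}"

definition H_infinity :: "(complex \<Rightarrow> complex) set" where
  "H_infinity = {g. g holomorphic_on upper_half_plane \<and> bounded (g ` upper_half_plane)}"

(* Only meaningful for z in the upper half-plane. *)
definition outer_weight :: "(real \<Rightarrow> real) \<Rightarrow> complex \<Rightarrow> complex" where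
  "outer_weight \<phi> z =
     exp (1 / (of_real pi * \<i>) *
       (LINT t|lborel. (1 / (of_real t - z) - of_real (t / (t\<^sup>2 + 1))) * of_real (\<phi> t)))"

(* The modulus |W(t)| of the boundary value of W at the real point t; for a
   logarithmic weight it equals exp (phi t). *)
definition boundary_modulus :: "(real \<Rightarrow> real) \<Rightarrow> real \<Rightarrow> real" where
  "boundary_modulus \<phi> t = Lim (at_right 0) (\<lambda>y. cmod (outer_weight \<phi> (Complex t y)))"

definition B_space :: "(real \<Rightarrow> real) \<Rightarrow> (complex \<Rightarrow> complex) set" where
  "B_space \<phi> = {f. f holomorphic_on UNIV \<and>
     (\<lambda>z. f z / outer_weight \<phi> z) \<in> H_infinity \<and>
     (\<lambda>z. cnj (f (cnj z)) / outer_weight \<phi> z) \<in> H_infinity}"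

definition B_norm :: "(real \<Rightarrow> real) \<Rightarrow> (complex \<Rightarrow> complex) \<Rightarrow> real" where
  "B_norm \<phi> f = (SUP t. cmod (f (of_real t)) / boundary_modulus \<phi> t)"

definition laplace :: "(complex \<Rightarrow> complex) \<Rightarrow> complex \<Rightarrow> complex" where
  "laplace f \<zeta> = (LBINT x:{0..}. f (of_real x) * exp (- \<zeta> * of_real x))"

(* The analytic continuation of the Laplace transform to the Riemann sphere minus the
   origin, vanishing at infinity. By the identity theorem it is unique apart from its
   value at 0, which is never used. *)
definition laplace_ext :: "(complex \<Rightarrow> complex) \<Rightarrow> complex \<Rightarrow> complex" where
  "laplace_ext f = (SOME g. g holomorphic_on - {0} \<and>
     (\<forall>\<zeta>. Re \<zeta> > 0 \<longrightarrow> g \<zeta> = laplace f \<zeta>) \<and> (g \<longlongrightarrow> 0) at_infinity)"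

(* The maximum over the circle is written as a supremum (it is attained, by compactness). *)
definition lambda_W :: "(real \<Rightarrow> real) \<Rightarrow> real \<Rightarrow> real" where
  "lambda_W \<phi> s =
     (SUP f\<in>{f \<in> B_space \<phi>. B_norm \<phi> f \<le> 1}. SUP \<zeta>\<in>sphere 0 s. cmod (laplace_ext f \<zeta>))"

definition legendre_Q :: "(real \<Rightarrow> real) \<Rightarrow> real \<Rightarrow> real" where
  "legendre_Q \<phi> s = (SUP y\<in>{0<..}. ln (cmod (outer_weight \<phi> (\<i> * of_real y))) - y * s)"

end

theory Submission
  imports Defs "HOL-Probability.Sinc_Integral" "HOL-Computational_Algebra.Fundamental_Theorem_Algebra"
begin

text \<open>
  Let \<open>H\<close> be the Poisson extension of \<open>\<phi>\<close> and \<open>P y = H (i y) = ln \<bar>W (i y)\<bar>\<close>.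

  Upper bound: a function of norm at most 1 satisfies \<open>\<bar>f z\<bar> \<le> exp (H z)\<close>, and the convexity of
  \<open>\<phi> (exp \<tau>)\<close> gives \<open>H z \<le> P \<bar>z\<bar>\<close>. Rotating the ray of integration bounds the Laplace transform on
  \<open>\<bar>\<zeta>\<bar> = s\<close> by the integral of \<open>exp (P r - s r)\<close>. If \<open>R\<close> is the scale at which \<open>P R / R\<close> drops below \<open>s\<close>,
  this integral is at most \<open>exp Q\<close> times a power of \<open>R\<close>, while \<open>Q \<ge> c \<phi> R\<close> dominates \<open>ln R\<close>.

  Lower bound: inverting the Laplace transform, \<open>\<bar>f (i y)\<bar> \<le> s exp (s y) \<lambda> s\<close>. By the convexity of
  \<open>\<phi> (exp \<tau>)\<close>, \<open>exp \<phi>\<close> agrees up to polynomial factors with a power series in \<open>x\<^sup>2\<close> with positive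
  coefficients; reflecting the zeros of a partial sum into the lower half-plane produces a polynomial
  \<open>f\<close> with the same modulus on the real line for which \<open>ln \<bar>f\<bar>\<close> is the Poisson integral of its
  boundary values, so that \<open>ln \<bar>f (i y)\<bar> \<ge> P y - O(ln y)\<close>.
\<close>

section \<open>The Cauchy distribution\<close>

text \<open>All Poisson integrals are taken as means of \<open>\<phi> (x + y * u)\<close> over one
  fixed probability law, the Cauchy distribution of \<open>u\<close>. Its invariance under
  \<open>u \<mapsto> - u\<close> and \<open>u \<mapsto> 1 / u\<close> drives the comparison of
  \<open>H z\<close> with \<open>P (cmod z)\<close>, and its distribution function carries it to the
  circle, where means of harmonic functions are Cauchy integrals. The bridge between
  \<open>s\<close> and \<open>R\<close> is the slope \<open>P r / r\<close>: each doubling of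
  \<open>r\<close> lowers it by at least a multiple of \<open>\<phi> (2 * r) / r\<close>. This one
  gap both bounds the Legendre transform from below and makes the tail of the Laplace integral
  decay. All errors are then O(ln R), and the two claims differ only in how \<open>ln R\<close>
  compares with Q. A polynomial has a finite root product and needs no convergence argument; the
  price is that it follows \<open>\<phi>\<close> only on a bounded interval, so the degree has to
  depend on \<open>y\<close>. Concavity controls that degree, through a linear bound on
  \<open>\<phi>\<close>.\<close>

definition cauchy_measure :: "real measure" where
  "cauchy_measure = density lborel (\<lambda>u. ennreal (1 / (pi * (1 + u\<^sup>2))))"

lemma space_cauchy_measure [simp]: "space cauchy_measure = UNIV"
  and sets_cauchy_measure [simp, measurable_cong]: "sets cauchy_measure = sets borel"
  by (simp_all add: cauchy_measure_def)

lemma one_plus_square_pos: "0 < 1 + (u::real)\<^sup>2"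
  using zero_le_power2[of u] by linarith

lemma integrable_cauchy_measure_iff:
  fixes f :: "real \<Rightarrow> real"
  assumes [measurable]: "f \<in> borel_measurable borel"
  shows "integrable cauchy_measure f \<longleftrightarrow> integrable lborel (\<lambda>u. f u / (1 + u\<^sup>2))"
proof -
  have "integrable cauchy_measure f \<longleftrightarrow> integrable lborel (\<lambda>u. (1 / (pi * (1 + u\<^sup>2))) *\<^sub>R f u)"
    unfolding cauchy_measure_def
    by (intro integrable_density) (auto intro!: AE_I2 simp: one_plus_square_pos less_imp_le)
  also have "(\<lambda>u. (1 / (pi * (1 + u\<^sup>2))) *\<^sub>R f u) = (\<lambda>u. (1 / pi) * (f u / (1 + u\<^sup>2)))"
    by (auto simp: fun_eq_iff)
  also have "integrable lborel \<dots> \<longleftrightarrow> integrable lborel (\<lambda>u. f u / (1 + u\<^sup>2))"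
    using integrable_mult_right[of "1 / pi" lborel "\<lambda>u. f u / (1 + u\<^sup>2)"]
      integrable_mult_right[of pi lborel "\<lambda>u. (1 / pi) * (f u / (1 + u\<^sup>2))"] by auto
  finally show ?thesis .
qed

lemma integral_cauchy_measure:
  fixes f :: "real \<Rightarrow> real"
  assumes [measurable]: "f \<in> borel_measurable borel"
  shows "integral\<^sup>L cauchy_measure f = (LINT u|lborel. f u / (1 + u\<^sup>2)) / pi"
proof -
  have "integral\<^sup>L cauchy_measure f = integral\<^sup>L lborel (\<lambda>u. (1 / (pi * (1 + u\<^sup>2))) *\<^sub>R f u)"
    unfolding cauchy_measure_def
    by (intro integral_density) (auto intro!: AE_I2 simp: one_plus_square_pos less_imp_le)
  also have "(\<lambda>u. (1 / (pi * (1 + u\<^sup>2))) *\<^sub>R f u) = (\<lambda>u. (1 / pi) * (f u / (1 + u\<^sup>2)))"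
    by (auto simp: fun_eq_iff)
  finally show ?thesis by (subst (asm) integral_mult_right_zero) simp
qed

lemma prob_space_cauchy_measure: "prob_space cauchy_measure"
proof
  have 1: "integrable lborel (\<lambda>x::real. 1 / (1 + x\<^sup>2))"
    using integrable_inverse_1_plus_square by (simp add: set_integrable_def field_simps)
  have 2: "(LINT x|lborel. 1 / (1 + (x::real)\<^sup>2)) = pi"
    using LBINT_inverse_1_plus_square
    by (simp add: interval_lebesgue_integral_def set_lebesgue_integral_def field_simps)
  have "emeasure cauchy_measure (space cauchy_measure) = (\<integral>\<^sup>+ u. ennreal (1 / (pi * (1 + u\<^sup>2))) \<partial>lborel)"
    by (simp add: cauchy_measure_def emeasure_density)
  also have "\<dots> = ennreal (LINT u|lborel. 1 / (pi * (1 + u\<^sup>2)))"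
  proof (rule nn_integral_eq_integral)
    show "integrable lborel (\<lambda>u::real. 1 / (pi * (1 + u\<^sup>2)))"
      using integrable_mult_right[OF 1, of "1 / pi"] by simp
  qed (auto simp: one_plus_square_pos less_imp_le)
  also have "(LINT u|lborel. 1 / (pi * (1 + u\<^sup>2))) = (LINT u|lborel. (1 / pi) * (1 / (1 + u\<^sup>2)))"
    by (simp)
  also have "\<dots> = 1" by (subst integral_mult_right_zero) (simp add: 2)
  finally show "emeasure cauchy_measure (space cauchy_measure) = 1" by simp
qed

interpretation cauchy: prob_space cauchy_measure by (rule prob_space_cauchy_measure)

lemma integral_cauchy_const [simp]: "integral\<^sup>L cauchy_measure (\<lambda>_. c::real) = c"
  using cauchy.prob_space by simp

lemma prob_cauchy_UNIV [simp]: "measure cauchy_measure UNIV = 1"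
  using cauchy.prob_space by simp

lemma integral_cauchy_uminus:
  fixes f :: "real \<Rightarrow> real"
  assumes [measurable]: "f \<in> borel_measurable borel"
  shows "integral\<^sup>L cauchy_measure (\<lambda>u. f (- u)) = integral\<^sup>L cauchy_measure f"
  using lborel_integral_real_affine[of "-1" "\<lambda>u. f u / (1 + u\<^sup>2)" 0]
  by (simp add: integral_cauchy_measure)

lemma integrable_cauchy_uminus:
  fixes f :: "real \<Rightarrow> real"
  assumes [measurable]: "f \<in> borel_measurable borel" and "integrable cauchy_measure f"
  shows "integrable cauchy_measure (\<lambda>u. f (- u))"
  using lborel_integrable_real_affine[of "\<lambda>u. f u / (1 + u\<^sup>2)" "-1" 0] assms(2)
  by (simp add: integrable_cauchy_measure_iff)

lemma AE_cauchy_not_single: "AE u in cauchy_measure. u \<noteq> (c::real)"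
proof -
  have "AE u in lborel. u \<noteq> c" by (rule AE_lborel_singleton)
  then show ?thesis
    unfolding cauchy_measure_def by (subst AE_density) auto
qed

text \<open>The integrand over \<open>S\<close> is Borel, but the image of \<open>S\<close> is not
  visibly a Borel set, so that side is stated for the completed measure. Keeping the value
  \<open>b\<close> free transfers integrability and integral in one equivalence.\<close>

lemma lborel_change_of_variables:
  fixes f g g' :: "real \<Rightarrow> real"
  assumes [measurable]: "f \<in> borel_measurable borel" "g \<in> borel_measurable borel"
      "g' \<in> borel_measurable borel"
    and S: "S \<in> sets borel"
    and der: "\<And>x. x \<in> S \<Longrightarrow> (g has_field_derivative g' x) (at x)"
    and inj: "inj_on g S"
  shows "(set_integrable lborel S (\<lambda>x. \<bar>g' x\<bar> * f (g x)) \<and>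
           (LINT x:S|lborel. \<bar>g' x\<bar> * f (g x)) = b)
     \<longleftrightarrow> (set_integrable lebesgue (g ` S) f \<and> (LINT x:g ` S|lebesgue. f x) = b)"
proof -
  have [measurable]: "S \<in> sets borel" by fact
  have "(\<lambda>x. \<bar>g' x\<bar> * f (g x)) absolutely_integrable_on S \<and>
           integral S (\<lambda>x. \<bar>g' x\<bar> * f (g x)) = b
     \<longleftrightarrow> f absolutely_integrable_on (g ` S) \<and> integral (g ` S) f = b"
    using S der inj
    by (intro has_absolute_integral_change_of_variables_1')
      (auto intro: DERIV_subset)
  moreover have "(\<lambda>x. \<bar>g' x\<bar> * f (g x)) absolutely_integrable_on S \<longleftrightarrow>
      set_integrable lborel S (\<lambda>x. \<bar>g' x\<bar> * f (g x))"
    unfolding set_integrable_def by (rule integrable_completion) measurable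
  moreover have "(LINT x:S|lborel. \<bar>g' x\<bar> * f (g x)) = integral S (\<lambda>x. \<bar>g' x\<bar> * f (g x))"
    if "set_integrable lborel S (\<lambda>x. \<bar>g' x\<bar> * f (g x))"
    using set_borel_integral_eq_integral[OF that] by simp
  moreover have "(LINT x:g ` S|lebesgue. f x) = integral (g ` S) f" if "f absolutely_integrable_on (g ` S)"
    using set_lebesgue_integral_eq_integral[OF that] by simp
  ultimately show ?thesis by argo
qed

text \<open>The density \<open>1 / (1 + u\<^sup>2)\<close> absorbs the Jacobian
  \<open>1 / u\<^sup>2\<close> of the inversion. The origin, where \<open>1 / u\<close> has its
  default value 0, is removed as a null set.\<close>

lemma integral_cauchy_inverse:
  fixes f :: "real \<Rightarrow> real"
  assumes [measurable]: "f \<in> borel_measurable borel" and int: "integrable cauchy_measure f"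
  shows "integrable cauchy_measure (\<lambda>u. f (1 / u))"
    and "integral\<^sup>L cauchy_measure (\<lambda>u. f (1 / u)) = integral\<^sup>L cauchy_measure f"
proof -
  let ?F = "\<lambda>u. f u / (1 + u\<^sup>2)"
  let ?S = "- {0::real}"
  have img: "(\<lambda>u. 1 / u) ` ?S = ?S"
  proof -
    have "x \<in> (\<lambda>u. 1 / u) ` ?S" if "x \<noteq> 0" for x :: real
      using that by (intro image_eqI[of _ _ "1 / x"]) auto
    then show ?thesis by auto
  qed
  have F: "integrable lborel ?F" using int by (simp add: integrable_cauchy_measure_iff)
  have AE0: "AE u in lborel. u \<noteq> (0::real)" by (rule AE_lborel_singleton)
  have ae: "AE u in lborel. indicator ?S u *\<^sub>R h u = h u" for h :: "real \<Rightarrow> real"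
    using AE0 by eventually_elim auto
  have B: "set_integrable lborel ?S ?F" "(LINT u:?S|lborel. ?F u) = (LINT u|lborel. ?F u)"
    using F integrable_cong_AE[OF _ _ ae[of ?F]] integral_cong_AE[OF _ _ ae[of ?F]]
    by (simp_all add: set_integrable_def set_lebesgue_integral_def)
  have B': "set_integrable lebesgue ?S ?F" "(LINT u:?S|lebesgue. ?F u) = (LINT u|lborel. ?F u)"
    using B by (simp_all add: set_integrable_def set_lebesgue_integral_def integrable_completion integral_completion)
  have "(set_integrable lborel ?S (\<lambda>x. \<bar>- 1 / x\<^sup>2\<bar> * ?F (1 / x)) \<and>
           (LINT x:?S|lborel. \<bar>- 1 / x\<^sup>2\<bar> * ?F (1 / x)) = (LINT u|lborel. ?F u))"
    by (rule lborel_change_of_variables[where f="?F" and g="\<lambda>x. 1 / x", THEN iffD2])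
       (use B' in \<open>auto simp: img inj_on_def power2_eq_square intro!: derivative_eq_intros\<close>)
  moreover have "indicator ?S x *\<^sub>R (\<bar>- 1 / x\<^sup>2\<bar> * ?F (1 / x)) = indicator ?S x *\<^sub>R (f (1 / x) / (1 + x\<^sup>2))" for x
  proof (cases "x = 0")
    case False
    then have "\<bar>- 1 / x\<^sup>2\<bar> * ?F (1 / x) = f (1 / x) / (1 + x\<^sup>2)"
      using one_plus_square_pos[of x] one_plus_square_pos[of "1/x"]
      by (simp add: field_simps power2_eq_square)
    then show ?thesis by simp
  qed auto
  ultimately have *: "integrable lborel (\<lambda>x. indicator ?S x *\<^sub>R (f (1 / x) / (1 + x\<^sup>2)))"
      "(LINT x|lborel. indicator ?S x *\<^sub>R (f (1 / x) / (1 + x\<^sup>2))) = (LINT u|lborel. ?F u)"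
    unfolding set_integrable_def set_lebesgue_integral_def by (simp_all only: conj_absorb)
  then show "integrable cauchy_measure (\<lambda>u. f (1 / u))"
    using integrable_cong_AE[OF _ _ ae[of "\<lambda>x. f (1 / x) / (1 + x\<^sup>2)"]]
    by (simp add: integrable_cauchy_measure_iff)
  show "integral\<^sup>L cauchy_measure (\<lambda>u. f (1 / u)) = integral\<^sup>L cauchy_measure f"
    using *(2) integral_cong_AE[OF _ _ ae[of "\<lambda>x. f (1 / x) / (1 + x\<^sup>2)"]]
    by (simp add: integral_cauchy_measure)
qed

section \<open>The Poisson formula for logarithmic potentials\<close>

text \<open>A mean value property: \<open>1 - \<beta> * u\<close> has positive real part on the
  closed disc, so its principal logarithm is holomorphic there and the Cauchy formula returns the
  value \<open>Ln 1 = 0\<close> at the centre.\<close>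

lemma circle_mean_ln_norm:
  fixes \<beta> :: complex
  assumes "cmod \<beta> < 1"
  shows "((\<lambda>x. ln (cmod (1 - \<beta> * exp (2 * of_real pi * \<i> * of_real x)))) has_integral 0) {0..1}"
proof -
  have Re_pos: "Re (1 - \<beta> * u) > 0" if "u \<in> cball 0 1" for u
  proof -
    have "cmod (\<beta> * u) < 1"
      using that assms mult_left_le[of "cmod u" "cmod \<beta>"] by (simp add: norm_mult)
    then show ?thesis using complex_Re_le_cmod[of "\<beta> * u"] by simp
  qed
  have "(\<lambda>u. Ln (1 - \<beta> * u)) holomorphic_on cball 0 1"
    by (intro holomorphic_intros) (use Re_pos in \<open>auto simp: complex_nonpos_Reals_iff dest: less_imp_not_eq\<close>, fastforce)
  from Cauchy_integral_circlepath_simple[OF this, of 0]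
  have "((\<lambda>u. Ln (1 - \<beta> * u) / u) has_contour_integral 0) (circlepath 0 1)" by simp
  then have "((\<lambda>x. Ln (1 - \<beta> * circlepath 0 1 x) / circlepath 0 1 x *
      vector_derivative (circlepath 0 1) (at x within {0..1})) has_integral 0) {0..1}"
    by (simp add: has_contour_integral_def)
  then have "((\<lambda>x. 2 * of_real pi * \<i> * Ln (1 - \<beta> * exp (2 * of_real pi * \<i> * of_real x))) has_integral 0) {0..1}"
    by (rule has_integral_eq[rotated]) (simp only: vector_derivative_circlepath01 atLeastAtMost_iff, simp add: circlepath)
  from has_integral_linear[OF this bounded_linear_Im]
  have "((\<lambda>x. Im (2 * of_real pi * \<i> * Ln (1 - \<beta> * exp (2 * of_real pi * \<i> * of_real x)))) has_integral 0) {0..1}"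
    by (simp add: o_def)
  then have "((\<lambda>x. 2 * pi * ln (cmod (1 - \<beta> * exp (2 * of_real pi * \<i> * of_real x)))) has_integral 0) {0..1}"
  proof (rule has_integral_eq[rotated])
    fix x :: real
    have "Re (1 - \<beta> * exp (2 * of_real pi * \<i> * of_real x)) > 0"
      by (rule Re_pos) simp
    then have "1 - \<beta> * exp (2 * of_real pi * \<i> * of_real x) \<noteq> 0" by (metis less_irrefl zero_complex.simps(1))
    then show "Im (2 * of_real pi * \<i> * Ln (1 - \<beta> * exp (2 * of_real pi * \<i> * of_real x))) =
        2 * pi * ln (cmod (1 - \<beta> * exp (2 * of_real pi * \<i> * of_real x)))"
      by (simp add: Re_Ln)
  qed
  from has_integral_mult_right[OF this, of "1 / (2 * pi)"] show ?thesis by simp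
qed

text \<open>\<open>1 / 2 + arctan u / pi\<close> is the distribution function of the Cauchy law, so
  it carries that law to the uniform one on the unit interval.\<close>

lemma integral_cauchy_arctan:
  fixes F :: "real \<Rightarrow> real"
  assumes [measurable]: "F \<in> borel_measurable borel" and F: "set_integrable lborel {0<..<1} F"
  shows "integrable cauchy_measure (\<lambda>u. F (1 / 2 + arctan u / pi))"
    and "integral\<^sup>L cauchy_measure (\<lambda>u. F (1 / 2 + arctan u / pi)) = (LINT x:{0<..<1}|lborel. F x)"
proof -
  let ?g = "\<lambda>u. 1 / 2 + arctan u / pi"
  have img: "range ?g = {0<..<1}"
  proof safe
    fix u show "?g u \<in> {0<..<1}"
      using arctan_bounded[of u] pi_gt_zero by (auto simp: field_simps)
  next
    fix x :: real assume x: "x \<in> {0<..<1}"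
    then have "arctan (tan (pi * (x - 1 / 2))) = pi * (x - 1 / 2)"
      by (intro arctan_unique) (auto simp: field_simps)
    then show "x \<in> range ?g"
      by (intro image_eqI[of _ _ "tan (pi * (x - 1 / 2))"]) auto
  qed
  have B': "set_integrable lebesgue {0<..<1} F" "(LINT u:{0<..<1}|lebesgue. F u) = (LINT u:{0<..<1}|lborel. F u)"
    using F by (simp_all add: set_integrable_def set_lebesgue_integral_def integrable_completion integral_completion)
  have "set_integrable lborel UNIV (\<lambda>u. \<bar>1 / (pi * (1 + u\<^sup>2))\<bar> * F (?g u)) \<and>
     (LINT u:UNIV|lborel. \<bar>1 / (pi * (1 + u\<^sup>2))\<bar> * F (?g u)) = (LINT x:{0<..<1}|lborel. F x)"
  proof (rule lborel_change_of_variables[where f=F, THEN iffD2])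
    show "(?g has_real_derivative 1 / (pi * (1 + x\<^sup>2))) (at x)" for x
      using one_plus_square_pos[of x]
      by (auto intro!: derivative_eq_intros simp: divide_simps)
    show "inj ?g" by (auto simp: inj_def arctan_eq_iff)
    show "set_integrable lebesgue (range ?g) F \<and> (LINT x:range ?g|lebesgue. F x) = (LINT x:{0<..<1}|lborel. F x)"
      unfolding img using B' by simp
  qed auto
  moreover have "\<bar>1 / (pi * (1 + u\<^sup>2))\<bar> * F (?g u) = (1 / pi) * (F (?g u) / (1 + u\<^sup>2))" for u
    using one_plus_square_pos[of u] by (simp add: abs_mult)
  ultimately have *: "integrable lborel (\<lambda>u. (1 / pi) * (F (?g u) / (1 + u\<^sup>2)))"
     "(LINT u|lborel. (1 / pi) * (F (?g u) / (1 + u\<^sup>2))) = (LINT x:{0<..<1}|lborel. F x)"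
    by (simp_all add: set_integrable_def set_lebesgue_integral_def)
  show "integrable cauchy_measure (\<lambda>u. F (?g u))"
    using integrable_mult_right[OF *(1), of pi] by (simp add: integrable_cauchy_measure_iff)
  show "integral\<^sup>L cauchy_measure (\<lambda>u. F (?g u)) = (LINT x:{0<..<1}|lborel. F x)"
    using *(2) by (subst (asm) integral_mult_right_zero) (simp add: integral_cauchy_measure)
qed

text \<open>With the distribution function as angle, the point on the circle is a Cayley transform
  of \<open>u\<close>; the shift by \<open>1 / 2\<close> contributes the sign. This turns circle
  means into Cauchy means.\<close>

lemma exp_arctan_cayley:
  "exp (2 * of_real pi * \<i> * of_real (1 / 2 + arctan u / pi)) = - (1 + \<i> * of_real u) / (1 - \<i> * of_real u)"
proof -
  have ne: "1 - \<i> * of_real u \<noteq> 0" "1 + \<i> * of_real u \<noteq> 0"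
    by (auto simp: complex_eq_iff)
  have "2 * of_real pi * \<i> * of_real (1 / 2 + arctan u / pi) = of_real pi * \<i> + 2 * (\<i> * of_real (arctan u))"
    by (simp add: field_simps)
  then have "exp (2 * of_real pi * \<i> * of_real (1 / 2 + arctan u / pi)) = - (exp (\<i> * of_real (arctan u)))\<^sup>2"
    by (simp add: exp_add exp_double)
  also have "exp (\<i> * of_real (arctan u)) = (1 + \<i> * of_real u) / of_real (sqrt (1 + u\<^sup>2))"
    by (simp add: complex_eq_iff Re_exp Im_exp cos_arctan sin_arctan Re_divide_of_real Im_divide_of_real)
  also have "\<dots>\<^sup>2 = (1 + \<i> * of_real u)\<^sup>2 / of_real (1 + u\<^sup>2)"
    using one_plus_square_pos[of u] by (simp add: power_divide flip: of_real_power)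
  also have "of_real (1 + u\<^sup>2) = (1 + \<i> * of_real u) * (1 - \<i> * of_real u)"
    by (simp add: complex_eq_iff power2_eq_square)
  finally have "exp (2 * of_real pi * \<i> * of_real (1 / 2 + arctan u / pi)) =
      - ((1 + \<i> * of_real u)\<^sup>2 / ((1 + \<i> * of_real u) * (1 - \<i> * of_real u)))" .
  also have "\<dots> = - (1 + \<i> * of_real u) / (1 - \<i> * of_real u)"
    using ne unfolding power2_eq_square minus_divide_left[symmetric] by simp
  finally show ?thesis .
qed

lemma integral_cauchy_ln_moebius:
  fixes \<beta> :: complex
  assumes "cmod \<beta> < 1"
  defines "M \<equiv> (\<lambda>u. ln (cmod (((1 - \<i> * of_real u) + \<beta> * (1 + \<i> * of_real u)) / (1 - \<i> * of_real u))))"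
  shows "integrable cauchy_measure M" "integral\<^sup>L cauchy_measure M = 0"
proof -
  let ?F = "\<lambda>x. ln (cmod (1 - \<beta> * exp (2 * of_real pi * \<i> * of_real x)))"
  have nz: "1 - \<beta> * exp (2 * of_real pi * \<i> * of_real x) \<noteq> 0" for x
  proof
    assume "1 - \<beta> * exp (2 * of_real pi * \<i> * of_real x) = 0"
    then have "cmod (\<beta> * exp (2 * of_real pi * \<i> * of_real x)) = 1" by simp
    then show False using assms(1) by (simp add: norm_mult)
  qed
  have cont: "continuous_on A ?F" for A
    by (intro continuous_intros) (use nz in auto)
  then have [measurable]: "?F \<in> borel_measurable borel"
    by (rule borel_measurable_continuous_onI)
  have si: "set_integrable lborel {0..1} ?F"
    by (rule borel_integrable_atLeastAtMost') (rule cont)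
  then have si': "set_integrable lborel {0<..<1} ?F"
    by (rule set_integrable_subset) auto
  have "(LINT x:{0<..<1}|lborel. ?F x) = integral {0<..<1} ?F"
    using set_borel_integral_eq_integral[OF si'] by simp
  also have "\<dots> = integral {0..1} ?F"
    using integral_open_interval_real[of 0 1 ?F] by simp
  also have "\<dots> = 0" using circle_mean_ln_norm[OF assms(1)] by (rule integral_unique)
  finally have 0: "(LINT x:{0<..<1}|lborel. ?F x) = 0" .
  have "?F (1 / 2 + arctan u / pi) = M u" for u
  proof -
    have "1 - \<i> * of_real u \<noteq> 0" by (auto simp: complex_eq_iff)
    then have "1 - \<beta> * (- (1 + \<i> * of_real u) / (1 - \<i> * of_real u)) =
       ((1 - \<i> * of_real u) + \<beta> * (1 + \<i> * of_real u)) / (1 - \<i> * of_real u)"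
      by (simp add: field_simps)
    then show ?thesis unfolding M_def exp_arctan_cayley by simp
  qed
  then show "integrable cauchy_measure M" "integral\<^sup>L cauchy_measure M = 0"
    using integral_cauchy_arctan[OF _ si'] 0 by simp_all
qed

text \<open>The limit case \<beta> = 1 of the Moebius formula, in which the zero
  \<open>1 / \<beta>\<close> reaches the circle. Since the approximants increase, monotone
  convergence yields integrability together with the value.\<close>

lemma integral_cauchy_ln_one_plus_square:
  shows "integrable cauchy_measure (\<lambda>u. ln (1 + u\<^sup>2))"
    and "integral\<^sup>L cauchy_measure (\<lambda>u. ln (1 + u\<^sup>2)) = 2 * ln 2"
proof -
  define \<epsilon> :: "nat \<Rightarrow> real" where "\<epsilon> n = 1 / (n + 2)" for n
  have \<epsilon>: "0 < \<epsilon> n" "\<epsilon> n < 1" for n by (auto simp: \<epsilon>_def)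
  have \<epsilon>0: "\<epsilon> \<longlonglongrightarrow> 0"
    unfolding \<epsilon>_def by real_asymp
  let ?f = "\<lambda>n u. ln (1 + u\<^sup>2) - ln (1 + (\<epsilon> n * u)\<^sup>2)"
  have fn: "integrable cauchy_measure (?f n) \<and> integral\<^sup>L cauchy_measure (?f n) = 2 * ln (2 / (1 + \<epsilon> n))" for n
  proof -
    define e where "e = \<epsilon> n"
    have e: "0 < e" "e < 1" using \<epsilon>[of n] by (auto simp: e_def)
    \<comment> \<open>This choice makes the Moebius quotient equal to \<open>2 / (1 + e)\<close>
      times \<open>(1 - \<i> * e * u) / (1 - \<i> * u)\<close>, whose log-modulus is a constant
      minus half of \<open>?f n u\<close>.\<close>
    define \<beta> where "\<beta> = (1 - e) / (1 + e)"
    have \<beta>: "cmod (of_real \<beta>) < 1"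
      unfolding norm_of_real using e by (simp add: \<beta>_def field_simps)
    have eq: "?f n u = 2 * ln (2 / (1 + e)) -
      2 * ln (cmod (((1 - \<i> * of_real u) + of_real \<beta> * (1 + \<i> * of_real u)) / (1 - \<i> * of_real u)))" for u
    proof -
      have 1: "(1 - \<i> * of_real u) + of_real \<beta> * (1 + \<i> * of_real u) =
          of_real (2 / (1 + e)) * (1 - \<i> * of_real (e * u))"
        using e by (simp add: complex_eq_iff \<beta>_def field_simps)
      have 2: "cmod (1 - \<i> * of_real v) = sqrt (1 + v\<^sup>2)" for v
        by (simp add: cmod_def)
      have 3: "ln (sqrt (1 + v\<^sup>2)) = ln (1 + v\<^sup>2) / 2" for v :: real
        using one_plus_square_pos[of v] by (simp add: ln_sqrt)
      have "ln (cmod (((1 - \<i> * of_real u) + of_real \<beta> * (1 + \<i> * of_real u)) / (1 - \<i> * of_real u)))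
        = ln (2 / (1 + e) * sqrt (1 + (e * u)\<^sup>2) / sqrt (1 + u\<^sup>2))"
        unfolding 1 norm_divide norm_mult 2 norm_of_real using e by simp
      also have "\<dots> = ln (2 / (1 + e)) + ln (sqrt (1 + (e * u)\<^sup>2)) - ln (sqrt (1 + u\<^sup>2))"
      proof -
        have "ln (a * b / c) = ln a + ln b - ln c" if "a > 0" "b > 0" "c > 0" for a b c :: real
          using that by (simp add: ln_div ln_mult)
        from this[of "2 / (1 + e)"] show ?thesis
          using e one_plus_square_pos[of u] one_plus_square_pos[of "e * u"] by simp
      qed
      finally show ?thesis unfolding 3 e_def by simp
    qed
    show ?thesis
      unfolding eq using integral_cauchy_ln_moebius[OF \<beta>]
      by (auto simp: e_def)
  qed
  have mono: "mono (\<lambda>n. ?f n u)" for u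
  proof (rule monoI)
    fix m n :: nat assume "m \<le> n"
    then have "\<epsilon> n \<le> \<epsilon> m" by (simp add: \<epsilon>_def field_simps)
    then have "(\<epsilon> n * u)\<^sup>2 \<le> (\<epsilon> m * u)\<^sup>2"
      using \<epsilon>[of n] by (simp add: power_mult_distrib mult_right_mono power_mono less_imp_le)
    then show "?f m u \<le> ?f n u"
      using one_plus_square_pos[of "\<epsilon> n * u"] by simp
  qed
  have lim: "(\<lambda>n. ?f n u) \<longlonglongrightarrow> ln (1 + u\<^sup>2)" for u
  proof -
    have "(\<lambda>n. ?f n u) \<longlonglongrightarrow> ln (1 + u\<^sup>2) - ln (1 + (0 * u)\<^sup>2)"
      by (intro tendsto_intros \<epsilon>0) auto
    then show ?thesis by simp
  qed
  have ilim: "(\<lambda>n. integral\<^sup>L cauchy_measure (?f n)) \<longlonglongrightarrow> 2 * ln 2"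
  proof -
    have "(\<lambda>n. 2 * ln (2 / (1 + \<epsilon> n))) \<longlonglongrightarrow> 2 * ln (2 / (1 + 0))"
      by (intro tendsto_intros \<epsilon>0) auto
    then show ?thesis using fn by simp
  qed
  show "integrable cauchy_measure (\<lambda>u. ln (1 + u\<^sup>2))"
    by (rule integrable_monotone_convergence[OF _ _ _ ilim]) (use fn mono lim in auto)
  show "integral\<^sup>L cauchy_measure (\<lambda>u. ln (1 + u\<^sup>2)) = 2 * ln 2"
    by (rule integral_monotone_convergence[OF _ _ _ ilim]) (use fn mono lim in auto)
qed

text \<open>With the zero below the line, the logarithmic potential is harmonic above it and is
  recovered from its values on the line. Normalising \<open>Complex x y\<close> to
  \<open>\<i>\<close> reduces this to the Moebius mean.\<close>

lemma cauchy_mean_ln_dist: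
  fixes w :: complex
  assumes "Im w < 0" "0 < y"
  shows "integrable cauchy_measure (\<lambda>u. ln (cmod (of_real (x + y * u) - w)))"
    and "integral\<^sup>L cauchy_measure (\<lambda>u. ln (cmod (of_real (x + y * u) - w))) = ln (cmod (Complex x y - w))"
proof -
  define v where "v = (w - of_real x) / of_real y"
  have v: "Im v < 0" using assms by (simp add: v_def divide_neg_pos)
  have w: "w = of_real x + of_real y * v" using assms by (simp add: v_def)
  have vi: "v - \<i> \<noteq> 0" using v by (auto simp: complex_eq_iff)
  \<comment> \<open>The Cayley image of \<open>v\<close>; it lies in the unit disc because a point
    below the line is closer to \<open>- \<i>\<close> than to \<open>\<i>\<close>.\<close>
  define \<beta> where "\<beta> = (v + \<i>) / (v - \<i>)"
  have "(cmod (v + \<i>))\<^sup>2 < (cmod (v - \<i>))\<^sup>2"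
    using v unfolding cmod_power2 by (simp add: power2_eq_square algebra_simps)
  then have "cmod (v + \<i>) < cmod (v - \<i>)" by (rule power2_less_imp_less) simp
  then have \<beta>: "cmod \<beta> < 1" using vi by (simp add: \<beta>_def norm_divide)
  let ?M = "\<lambda>u. ln (cmod (((1 - \<i> * of_real u) + \<beta> * (1 + \<i> * of_real u)) / (1 - \<i> * of_real u)))"
  \<comment> \<open>The term \<open>ln (1 + u\<^sup>2) / 2\<close> undoes the denominator of
    \<open>?M\<close>; its mean \<open>ln 2\<close> cancels the constant
    \<open>- ln 2\<close>.\<close>
  have eq: "ln (cmod (of_real (x + y * u) - w)) = ?M u + ln (1 + u\<^sup>2) / 2 + (ln y + ln (cmod (v - \<i>)) - ln 2)" for u
  proof -
    have n1: "1 - \<i> * of_real u \<noteq> 0" by (auto simp: complex_eq_iff)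
    have n2: "v - of_real u \<noteq> 0" using v by (auto simp: complex_eq_iff)
    have c1: "ln (cmod (1 - \<i> * of_real u)) = ln (1 + u\<^sup>2) / 2"
      using one_plus_square_pos[of u] by (simp add: cmod_def ln_sqrt)
    have num: "(1 - \<i> * of_real u) + \<beta> * (1 + \<i> * of_real u) = 2 * (v - of_real u) / (v - \<i>)"
      using vi unfolding \<beta>_def by (simp add: field_simps)
    have "?M u = ln 2 + ln (cmod (v - of_real u)) - ln (cmod (v - \<i>)) - ln (1 + u\<^sup>2) / 2"
      unfolding num norm_divide norm_mult c1[symmetric] using n1 n2 vi
      by (simp add: ln_div ln_mult)
    moreover have "of_real (x + y * u) - w = - of_real y * (v - of_real u)"
      unfolding w by (simp add: algebra_simps)
    then have "ln (cmod (of_real (x + y * u) - w)) = ln y + ln (cmod (v - of_real u))"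
      using assms n2 by (simp add: norm_mult ln_mult)
    ultimately show ?thesis by simp
  qed
  show "integrable cauchy_measure (\<lambda>u. ln (cmod (of_real (x + y * u) - w)))"
    unfolding eq using integral_cauchy_ln_moebius(1)[OF \<beta>] integral_cauchy_ln_one_plus_square(1)
    by (intro Bochner_Integration.integrable_add integrable_divide) auto
  have "integral\<^sup>L cauchy_measure (\<lambda>u. ln (cmod (of_real (x + y * u) - w))) =
     0 + (2 * ln 2) / 2 + (ln y + ln (cmod (v - \<i>)) - ln 2)"
    unfolding eq using integral_cauchy_ln_moebius[OF \<beta>] integral_cauchy_ln_one_plus_square
    by simp
  also have "\<dots> = ln y + ln (cmod (v - \<i>))" by simp
  also have "\<dots> = ln (cmod (of_real y * (v - \<i>)))"
    using vi assms by (simp add: norm_mult ln_mult)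
  also have "cmod (of_real y * (v - \<i>)) = cmod (Complex x y - w)"
    unfolding w by (subst norm_minus_commute[of "Complex x y"]) (simp add: complex_eq_iff algebra_simps Complex_eq)
  finally show "integral\<^sup>L cauchy_measure (\<lambda>u. ln (cmod (of_real (x + y * u) - w))) = ln (cmod (Complex x y - w))" .
qed

section \<open>Logarithmic weights and their Poisson extension\<close>

lemma lborel_integrable_bound:
  fixes f :: "real \<Rightarrow> 'a :: {banach, second_countable_topology}" and g :: "real \<Rightarrow> real"
  assumes "integrable lborel g" "f \<in> borel_measurable borel" "\<And>x. norm (f x) \<le> g x"
  shows "integrable lborel f"
  by (rule Bochner_Integration.integrable_bound[OF assms(1)])
    (use assms in \<open>auto intro!: AE_I2 order_trans[OF assms(3)]\<close>)

locale log_weight =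
  fixes \<phi> :: "real \<Rightarrow> real"
  assumes weight: "logarithmic_weight \<phi>"
begin

lemma cont: "continuous_on A \<phi>"
  using weight continuous_on_subset unfolding logarithmic_weight_def by blast

lemma isCont: "isCont \<phi> t"
  using cont[of UNIV] by (simp add: continuous_on_eq_continuous_at)

lemma meas [measurable]: "\<phi> \<in> borel_measurable borel"
  by (rule borel_measurable_continuous_onI) (rule cont)

lemma nonneg [simp]: "0 \<le> \<phi> t"
  using weight unfolding logarithmic_weight_def by blast

lemma even: "\<phi> (- t) = \<phi> t"
  using weight unfolding logarithmic_weight_def by blast

lemma even_abs [simp]: "\<phi> \<bar>t\<bar> = \<phi> t"
  by (cases "t \<ge> 0") (auto simp: even abs_if)

lemma zero [simp]: "\<phi> 0 = 0"
  using weight unfolding logarithmic_weight_def by blast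

lemma mono_abs: "\<bar>s\<bar> \<le> \<bar>t\<bar> \<Longrightarrow> \<phi> s \<le> \<phi> t"
proof -
  assume *: "\<bar>s\<bar> \<le> \<bar>t\<bar>"
  have "\<phi> \<bar>s\<bar> \<le> \<phi> \<bar>t\<bar>"
  proof (cases "s = 0")
    case False
    moreover have "mono_on {0<..} \<phi>"
      using weight unfolding logarithmic_weight_def by blast
    ultimately show ?thesis using * mono_onD[of "{0<..}" \<phi> "\<bar>s\<bar>" "\<bar>t\<bar>"] by auto
  qed auto
  then show ?thesis by simp
qed

lemma integrable_weight: "integrable lborel (\<lambda>t. \<phi> t / (t\<^sup>2 + 1))"
  using weight unfolding logarithmic_weight_def by blast

lemma filterlim_div_ln: "filterlim (\<lambda>t. \<phi> t / ln t) at_top at_top"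
  using weight unfolding logarithmic_weight_def by blast

lemma integrable_affine: "integrable cauchy_measure (\<lambda>u. \<phi> (a + b * u))"
proof (cases "b = 0")
  case False
  have "integrable lborel (\<lambda>u. \<phi> (a + b * u) / ((a + b * u)\<^sup>2 + 1))"
    using lborel_integrable_real_affine[OF integrable_weight False] .
  then have "integrable lborel (\<lambda>u. (1 + 2 * a\<^sup>2 + 2 * b\<^sup>2) * (\<phi> (a + b * u) / ((a + b * u)\<^sup>2 + 1)))"
    by (rule integrable_mult_right)
  then have "integrable lborel (\<lambda>u. \<phi> (a + b * u) / (1 + u\<^sup>2))"
  proof (rule lborel_integrable_bound)
    fix u
    have "(a + b * u)\<^sup>2 + 1 \<le> 2 * a\<^sup>2 + 2 * b\<^sup>2 * u\<^sup>2 + 1"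
      using zero_le_power2[of "a - b * u"] by (simp add: power2_eq_square algebra_simps)
    also have "\<dots> \<le> (1 + 2 * a\<^sup>2 + 2 * b\<^sup>2) * (1 + u\<^sup>2)"
      by (simp add: algebra_simps)
    finally have "\<phi> (a + b * u) * ((a + b * u)\<^sup>2 + 1) \<le> \<phi> (a + b * u) * ((1 + 2 * a\<^sup>2 + 2 * b\<^sup>2) * (1 + u\<^sup>2))"
      by (intro mult_left_mono) auto
    then show "norm (\<phi> (a + b * u) / (1 + u\<^sup>2)) \<le> (1 + 2 * a\<^sup>2 + 2 * b\<^sup>2) * (\<phi> (a + b * u) / ((a + b * u)\<^sup>2 + 1))"
      using one_plus_square_pos[of u] one_plus_square_pos[of "a + b * u"]
      by (simp add: field_simps)
  qed measurable
  then show ?thesis by (simp add: integrable_cauchy_measure_iff)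
qed auto

text \<open>For \<open>Im z > 0\<close> this is the Poisson integral. No sign condition is imposed:
  the same formula gives \<open>\<phi>\<close> on the line and the symmetric extension below it, so
  \<open>H\<close> is continuous on the whole plane.\<close>

definition H :: "complex \<Rightarrow> real" where
  "H z = (LINT u|cauchy_measure. \<phi> (Re z + Im z * u))"

lemma H_of_real [simp]: "H (of_real t) = \<phi> t"
  by (simp add: H_def)

lemma H_cnj: "H (cnj z) = H z"
  unfolding H_def using integral_cauchy_uminus[of "\<lambda>u. \<phi> (Re z + Im z * u)"] by simp

lemma H_nonneg: "0 \<le> H z"
  unfolding H_def by (intro integral_nonneg_AE) auto

lemma continuous_H: "continuous_on A H"
proof -
  have "isCont H z" for z
  proof (rule continuous_at_sequentiallyI)
    fix X :: "nat \<Rightarrow> complex" assume X: "X \<longlonglongrightarrow> z"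
    then obtain K where K: "\<And>n. cmod (X n) \<le> K"
      by (meson BseqE Bseq_eq_bounded convergentI convergent_imp_Bseq)
    show "(\<lambda>n. H (X n)) \<longlonglongrightarrow> H z"
      unfolding H_def
    \<comment> \<open>The natural majorant \<open>\<phi> (K + K * \<bar>u\<bar>)\<close> is replaced
      by the sum over both signs of \<open>u\<close>, so that \<open>integrable_affine\<close>
      applies.\<close>
    proof (rule integral_dominated_convergence[where w="\<lambda>u. \<phi> (K + K * u) + \<phi> (K - K * u)"])
      show "integrable cauchy_measure (\<lambda>u. \<phi> (K + K * u) + \<phi> (K - K * u))"
        using integrable_affine[of K K] integrable_affine[of K "-K"] by simp
      show "AE u in cauchy_measure. (\<lambda>n. \<phi> (Re (X n) + Im (X n) * u)) \<longlonglongrightarrow> \<phi> (Re z + Im z * u)"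
        by (intro AE_I2 isCont_tendsto_compose[OF isCont] tendsto_intros X)
      show "AE u in cauchy_measure. norm (\<phi> (Re (X n) + Im (X n) * u)) \<le> \<phi> (K + K * u) + \<phi> (K - K * u)" for n
      proof (rule AE_I2)
        fix u :: real
        have K0: "0 \<le> K" using K[of 0] norm_ge_zero order_trans by blast
        have "\<bar>Re (X n) + Im (X n) * u\<bar> \<le> \<bar>Re (X n)\<bar> + \<bar>Im (X n)\<bar> * \<bar>u\<bar>"
          by (metis abs_mult abs_triangle_ineq)
        also have "\<dots> \<le> K + K * \<bar>u\<bar>"
          using K[of n] abs_Re_le_cmod[of "X n"] abs_Im_le_cmod[of "X n"]
          by (intro add_mono mult_right_mono) auto
        finally have 1: "\<bar>Re (X n) + Im (X n) * u\<bar> \<le> \<bar>K + K * \<bar>u\<bar>\<bar>" by linarith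
        have "\<phi> (Re (X n) + Im (X n) * u) \<le> \<phi> (K + K * \<bar>u\<bar>)"
          by (rule mono_abs) (rule 1)
        also have "\<dots> \<le> \<phi> (K + K * u) + \<phi> (K - K * u)"
          by (cases "u \<ge> 0") (auto simp: abs_if)
        finally show "norm (\<phi> (Re (X n) + Im (X n) * u)) \<le> \<phi> (K + K * u) + \<phi> (K - K * u)"
          by simp
      qed
    qed measurable
  qed
  then show ?thesis by (intro continuous_at_imp_continuous_on) auto
qed

section \<open>The outer weight and its boundary modulus\<close>

definition kernel :: "complex \<Rightarrow> real \<Rightarrow> complex" where
  "kernel z t = (1 / (of_real t - z) - of_real (t / (t\<^sup>2 + 1))) * of_real (\<phi> t)"

lemma measurable_kernel [measurable]: "kernel z \<in> borel_measurable borel"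
  unfolding kernel_def[abs_def] by measurable

lemma outer_weight_eq: "outer_weight \<phi> z = exp (1 / (of_real pi * \<i>) * (LINT t|lborel. kernel z t))"
  by (simp add: outer_weight_def kernel_def)

lemma Im_pos_diff: 
  assumes "Im z > 0" shows "of_real t - z \<noteq> 0" "Im z \<le> cmod (of_real t - z)"
  using assms abs_Im_le_cmod[of "of_real t - z"] by (auto simp: complex_eq_iff)

lemma integrable_kernel:
  assumes z: "Im z > 0"
  shows "integrable lborel (kernel z)"
proof (rule lborel_integrable_bound)
  show "integrable lborel (\<lambda>t. ((1 + (cmod z)\<^sup>2) / Im z + cmod z) * (\<phi> t / (t\<^sup>2 + 1)))"
    by (rule integrable_mult_right) (rule integrable_weight)
  fix t
  have nz: "of_real t - z \<noteq> 0" and ge: "Im z \<le> cmod (of_real t - z)"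
    using Im_pos_diff[OF z] by auto
  have t1: "(of_real t)\<^sup>2 + (1::complex) \<noteq> 0"
    using one_plus_square_pos[of t] by (auto simp: complex_eq_iff power2_eq_square)
  \<comment> \<open>The identity \<open>1 + t * z = (1 + z\<^sup>2) + z * (t - z)\<close> separates
    a bounded factor from the integrable \<open>\<phi> t / (t\<^sup>2 + 1)\<close>.\<close>
  have "kernel z t = ((1 + z\<^sup>2) / (of_real t - z) + z) * (of_real (\<phi> t) / of_real (t\<^sup>2 + 1))"
    unfolding kernel_def using nz t1 by (simp add: divide_simps) (simp add: algebra_simps power2_eq_square)
  also have "norm \<dots> = cmod ((1 + z\<^sup>2) / (of_real t - z) + z) * (\<phi> t / (t\<^sup>2 + 1))"
    using one_plus_square_pos[of t] by (simp add: norm_mult norm_divide add.commute flip: of_real_power of_real_add)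
  also have "\<dots> \<le> ((1 + (cmod z)\<^sup>2) / Im z + cmod z) * (\<phi> t / (t\<^sup>2 + 1))"
  proof (intro mult_right_mono order_trans[OF norm_triangle_ineq] add_mono)
    have "cmod (1 + z\<^sup>2) \<le> 1 + (cmod z)\<^sup>2"
      using norm_triangle_ineq[of 1 "z\<^sup>2"] by (simp add: norm_power)
    then show "cmod ((1 + z\<^sup>2) / (of_real t - z)) \<le> (1 + (cmod z)\<^sup>2) / Im z"
      unfolding norm_divide using ge z by (intro frac_le) auto
  qed auto
  finally show "norm (kernel z t) \<le> ((1 + (cmod z)\<^sup>2) / Im z + cmod z) * (\<phi> t / (t\<^sup>2 + 1))" .
qed measurable

text \<open>The correction \<open>t / (t\<^sup>2 + 1)\<close> is real and drops out of the imaginary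
  part, leaving the Poisson kernel; \<open>t = Re z + Im z * u\<close> turns that kernel into the
  Cauchy density.\<close>

lemma cmod_outer_weight:
  assumes z: "Im z > 0"
  shows "cmod (outer_weight \<phi> z) = exp (H z)"
proof -
  let ?x = "Re z" and ?y = "Im z"
  have "Re (1 / (of_real pi * \<i>) * (LINT t|lborel. kernel z t)) = Im (LINT t|lborel. kernel z t) / pi"
    by (simp add: Re_divide Im_divide power2_eq_square)
  also have "Im (LINT t|lborel. kernel z t) = (LINT t|lborel. Im (kernel z t))"
    by (rule integral_Im[symmetric]) (rule integrable_kernel[OF z])
  also have "(\<lambda>t. Im (kernel z t)) = (\<lambda>t. ?y / ((t - ?x)\<^sup>2 + ?y\<^sup>2) * \<phi> t)"
    by (auto simp: kernel_def fun_eq_iff Im_divide)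
  also have "(LINT t|lborel. ?y / ((t - ?x)\<^sup>2 + ?y\<^sup>2) * \<phi> t) =
      ?y *\<^sub>R (LINT u|lborel. ?y / ((?x + ?y * u - ?x)\<^sup>2 + ?y\<^sup>2) * \<phi> (?x + ?y * u))"
    using lborel_integral_real_affine[of ?y "\<lambda>t. ?y / ((t - ?x)\<^sup>2 + ?y\<^sup>2) * \<phi> t" ?x] z by simp
  also have "\<dots> = (LINT u|lborel. ?y * (?y / ((?x + ?y * u - ?x)\<^sup>2 + ?y\<^sup>2) * \<phi> (?x + ?y * u)))"
    unfolding real_scaleR_def by (rule integral_mult_right_zero[symmetric])
  also have "(\<lambda>u. ?y * (?y / ((?x + ?y * u - ?x)\<^sup>2 + ?y\<^sup>2) * \<phi> (?x + ?y * u))) =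
      (\<lambda>u. \<phi> (?x + ?y * u) / (1 + u\<^sup>2))"
  proof
    fix u
    have "(?x + ?y * u - ?x)\<^sup>2 + ?y\<^sup>2 = ?y\<^sup>2 * (1 + u\<^sup>2)" by (simp add: algebra_simps power2_eq_square)
    then show "?y * (?y / ((?x + ?y * u - ?x)\<^sup>2 + ?y\<^sup>2) * \<phi> (?x + ?y * u)) = \<phi> (?x + ?y * u) / (1 + u\<^sup>2)"
      using z by (simp only:) (simp add: power2_eq_square)
  qed
  finally show ?thesis
    unfolding outer_weight_eq norm_exp_eq_Re by (simp add: H_def integral_cauchy_measure)
qed

lemma outer_weight_nonzero [simp]: "outer_weight \<phi> z \<noteq> 0"
  by (simp add: outer_weight_def)

lemma holomorphic_outer_weight: "outer_weight \<phi> holomorphic_on upper_half_plane"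
proof -
  have "\<exists>D. ((\<lambda>z. LINT t|lborel. kernel z t) has_field_derivative D) (at z)" if z: "Im z > 0" for z
  proof -
    let ?D = "\<lambda>t. of_real (\<phi> t) / (of_real t - z)\<^sup>2"
    let ?B = "ball z (Im z / 2)"
    \<comment> \<open>\<open>C\<close> makes \<open>t\<^sup>2 + 1\<close> at most \<open>C\<close>
      times the product of the distances of \<open>t\<close> to \<open>z\<close> and to any point of
      \<open>?B\<close>: the former is at least \<open>Im z\<close>, the latter at least half of the
      former.\<close>
    define C where "C = 2 * (2 + (2 * (cmod z)\<^sup>2 + 1) / (Im z)\<^sup>2)"
    have Bpos: "Im w > 0" if "w \<in> ?B" for w
      using that abs_Im_le_cmod[of "z - w"] by (auto simp: dist_norm)
    have "((\<lambda>w. ((LINT t|lborel. kernel w t) - (LINT t|lborel. kernel z t)) / (w - z)) \<longlongrightarrow> (LINT t|lborel. ?D t)) (at z within ?B)"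
      unfolding tendsto_at_iff_sequentially comp_def
    proof (intro allI impI)
      fix X assume X: "\<forall>i. X i \<in> ?B - {z}" "X \<longlonglongrightarrow> z"
      have eq: "((LINT t|lborel. kernel (X i) t) - (LINT t|lborel. kernel z t)) / (X i - z) =
          (LINT t|lborel. of_real (\<phi> t) / ((of_real t - X i) * (of_real t - z)))" for i
      proof -
        have Xi: "X i \<in> ?B" "X i \<noteq> z" using X by auto
        have "((LINT t|lborel. kernel (X i) t) - (LINT t|lborel. kernel z t)) / (X i - z) =
            (LINT t|lborel. (kernel (X i) t - kernel z t) / (X i - z))"
          using integrable_kernel[OF z] integrable_kernel[OF Bpos[OF Xi(1)]] by simp
        also have "(\<lambda>t. (kernel (X i) t - kernel z t) / (X i - z)) =
            (\<lambda>t. of_real (\<phi> t) / ((of_real t - X i) * (of_real t - z)))"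
        proof
          fix t
          have nz: "of_real t - z \<noteq> 0" "of_real t - X i \<noteq> 0"
            using Im_pos_diff(1)[OF z] Im_pos_diff(1)[OF Bpos[OF Xi(1)]] by auto
          have "kernel (X i) t - kernel z t = (1 / (of_real t - X i) - 1 / (of_real t - z)) * of_real (\<phi> t)"
            by (simp add: kernel_def algebra_simps)
          also have "1 / (of_real t - X i) - 1 / (of_real t - z) = (X i - z) / ((of_real t - X i) * (of_real t - z))"
            using nz by (simp add: field_simps)
          finally show "(kernel (X i) t - kernel z t) / (X i - z) = of_real (\<phi> t) / ((of_real t - X i) * (of_real t - z))"
            using Xi by simp
        qed
        finally show ?thesis .
      qed
      show "(\<lambda>i. ((LINT t|lborel. kernel (X i) t) - (LINT t|lborel. kernel z t)) / (X i - z)) \<longlonglongrightarrow> (LINT t|lborel. ?D t)"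
        unfolding eq
      proof (rule integral_dominated_convergence[where w="\<lambda>t. C * (\<phi> t / (t\<^sup>2 + 1))"])
        show "integrable lborel (\<lambda>t. C * (\<phi> t / (t\<^sup>2 + 1)))"
          by (rule integrable_mult_right) (rule integrable_weight)
        show "AE t in lborel. (\<lambda>i. of_real (\<phi> t) / ((of_real t - X i) * (of_real t - z))) \<longlonglongrightarrow> ?D t"
        proof (rule AE_I2)
          fix t
          have "(\<lambda>i. of_real (\<phi> t) / ((of_real t - X i) * (of_real t - z))) \<longlonglongrightarrow> of_real (\<phi> t) / ((of_real t - z) * (of_real t - z))"
            using Im_pos_diff(1)[OF z] by (intro tendsto_intros X) auto
          then show "(\<lambda>i. of_real (\<phi> t) / ((of_real t - X i) * (of_real t - z))) \<longlonglongrightarrow> ?D t"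
            by (simp add: power2_eq_square)
        qed
        show "AE t in lborel. norm (of_real (\<phi> t) / ((of_real t - X i) * (of_real t - z))) \<le> C * (\<phi> t / (t\<^sup>2 + 1))" for i
        proof (rule AE_I2)
          fix t :: real
          let ?r = "cmod (of_real t - z)"
          have r: "Im z \<le> ?r" using Im_pos_diff(2)[OF z] .
          have "X i \<in> ?B" using X by auto
          then have "cmod (X i - z) < Im z / 2" by (simp add: dist_norm norm_minus_commute)
          moreover have "?r \<le> cmod (of_real t - X i) + cmod (X i - z)"
            using norm_triangle_ineq[of "of_real t - X i" "X i - z"] by simp
          ultimately have rX: "?r / 2 \<le> cmod (of_real t - X i)" using r by linarith
          have "\<bar>t\<bar> \<le> ?r + cmod z"
            using norm_triangle_ineq[of "of_real t - z" z] by simp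
          then have "t\<^sup>2 \<le> (?r + cmod z)\<^sup>2" by (metis abs_ge_zero power2_abs power_mono)
          also have "\<dots> \<le> 2 * ?r\<^sup>2 + 2 * (cmod z)\<^sup>2"
            using zero_le_power2[of "?r - cmod z"] by (simp add: power2_eq_square algebra_simps)
          finally have "t\<^sup>2 + 1 \<le> 2 * ?r\<^sup>2 + (2 * (cmod z)\<^sup>2 + 1) * 1" by simp
          also have "\<dots> \<le> 2 * ?r\<^sup>2 + (2 * (cmod z)\<^sup>2 + 1) * (?r\<^sup>2 / (Im z)\<^sup>2)"
            using r z by (intro add_mono mult_left_mono) (auto simp: power_mono)
          also have "\<dots> = C * (?r\<^sup>2 / 2)"
            using z by (simp add: C_def field_simps)
          finally have 1: "t\<^sup>2 + 1 \<le> C * (?r\<^sup>2 / 2)" .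
          have "?r\<^sup>2 / 2 \<le> cmod (of_real t - X i) * ?r"
            using mult_right_mono[OF rX, of ?r] by (simp add: power2_eq_square)
          moreover have "0 \<le> C" using z by (simp add: C_def)
          ultimately have 2: "t\<^sup>2 + 1 \<le> C * (cmod (of_real t - X i) * ?r)"
            using 1 by (meson mult_left_mono order_trans)
          have pos: "0 < cmod (of_real t - X i) * ?r"
            using rX r z by (intro mult_pos_pos) linarith+
          have "norm (of_real (\<phi> t) / ((of_real t - X i) * (of_real t - z))) = \<phi> t / (cmod (of_real t - X i) * ?r)"
            by (simp add: norm_divide norm_mult)
          also have "\<dots> \<le> C * (\<phi> t / (t\<^sup>2 + 1))"
            using mult_left_mono[OF 2, of "\<phi> t"] pos one_plus_square_pos[of t]
            by (simp add: field_simps)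
          finally show "norm (of_real (\<phi> t) / ((of_real t - X i) * (of_real t - z))) \<le> C * (\<phi> t / (t\<^sup>2 + 1))" .
        qed
      qed measurable
    qed
    moreover have "at z within ?B = at z" using z by (intro at_within_open) auto
    ultimately show ?thesis by (auto simp: has_field_derivative_iff)
  qed
  then have "(\<lambda>z. LINT t|lborel. kernel z t) holomorphic_on upper_half_plane"
    unfolding upper_half_plane_def holomorphic_on_def field_differentiable_def
    by (blast intro: has_field_derivative_at_within)
  then show ?thesis
    unfolding outer_weight_eq[abs_def] by (intro holomorphic_intros) auto
qed

lemma boundary_modulus_eq: "boundary_modulus \<phi> t = exp (\<phi> t)"
  unfolding boundary_modulus_def
proof (rule tendsto_Lim)
  have "isCont H (of_real t)"
    using continuous_H[of UNIV] by (simp add: continuous_on_eq_continuous_at)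
  moreover have "((\<lambda>y. Complex t y) \<longlongrightarrow> Complex t 0) (at_right 0)"
    unfolding Complex_eq by (intro tendsto_eq_intros) auto
  ultimately have "((\<lambda>y. H (Complex t y)) \<longlongrightarrow> H (of_real t)) (at_right 0)"
    by (simp add: complex_of_real_def isCont_tendsto_compose)
  then have "((\<lambda>y. exp (H (Complex t y))) \<longlongrightarrow> exp (\<phi> t)) (at_right 0)"
    by (auto intro!: tendsto_exp)
  then show "((\<lambda>y. cmod (outer_weight \<phi> (Complex t y))) \<longlongrightarrow> exp (\<phi> t)) (at_right 0)"
  proof (rule Lim_transform_eventually)
    show "\<forall>\<^sub>F y in at_right 0. exp (H (Complex t y)) = cmod (outer_weight \<phi> (Complex t y))"
      by (auto simp: eventually_at_right_less cmod_outer_weight intro!: eventually_mono[OF eventually_at_right_less[of 0]])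
  qed
qed auto

end

section \<open>Growth of the Poisson extension\<close>

text \<open>The substitution \<open>u = (v - c) / s\<close> moves the base point from
  \<open>z\<close> to \<open>\<i> * cmod z\<close>; the factor that appears is the quotient of the
  two Poisson kernels.\<close>

lemma integral_cauchy_rotate:
  fixes f :: "real \<Rightarrow> real"
  assumes [measurable]: "f \<in> borel_measurable borel"
    and z: "Im z > 0" and int: "integrable cauchy_measure (\<lambda>u. f (Re z + Im z * u))"
  defines "c \<equiv> Re z / cmod z" and "s \<equiv> Im z / cmod z"
  shows "integrable cauchy_measure (\<lambda>v. s * (1 + v\<^sup>2) / (v\<^sup>2 - 2 * c * v + 1) * f (cmod z * v))" (is ?I)
    and "integral\<^sup>L cauchy_measure (\<lambda>v. s * (1 + v\<^sup>2) / (v\<^sup>2 - 2 * c * v + 1) * f (cmod z * v)) =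
      integral\<^sup>L cauchy_measure (\<lambda>u. f (Re z + Im z * u))" (is "?L = ?R")
proof -
  have r: "cmod z > 0" using z by (metis Im_complex_of_real less_irrefl norm_eq_zero of_real_0 zero_less_norm_iff)
  have s: "s > 0" using z r by (simp add: s_def)
  have cs: "c\<^sup>2 + s\<^sup>2 = 1"
    using r unfolding c_def s_def power_divide add_divide_distrib[symmetric] by (simp add: cmod_power2[symmetric])
  let ?F = "\<lambda>u. f (Re z + Im z * u) / (1 + u\<^sup>2)"
  have F: "integrable lborel ?F" using int by (simp add: integrable_cauchy_measure_iff)
  have eq: "?F (- (c / s) + 1 / s * v) = s * (s * (1 + v\<^sup>2) / (v\<^sup>2 - 2 * c * v + 1) * f (cmod z * v) / (1 + v\<^sup>2))" for v
  proof -
    have "Re z + Im z * (- (c / s) + 1 / s * v) = Re z + Im z * (v - c) / s"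
      using s by (simp add: field_simps)
    also have "\<dots> = cmod z * v" using r z by (simp add: s_def c_def field_simps)
    finally have 1: "Re z + Im z * (- (c / s) + 1 / s * v) = cmod z * v" .
    have "v\<^sup>2 - 2 * c * v + 1 = (v - c)\<^sup>2 + s\<^sup>2"
      using cs by (simp add: power2_eq_square algebra_simps)
    moreover have "0 < (v - c)\<^sup>2 + s\<^sup>2" using s by (intro add_nonneg_pos) auto
    moreover have "1 + (- (c / s) + 1 / s * v)\<^sup>2 = ((v - c)\<^sup>2 + s\<^sup>2) / s\<^sup>2"
      using s by (simp add: power2_eq_square field_simps)
    ultimately show ?thesis
      unfolding 1 using s one_plus_square_pos[of v] by (simp add: power2_eq_square)
  qed
  have sn: "1 / s \<noteq> 0" using s by simp
  have "integrable lborel (\<lambda>v. ?F (- (c / s) + 1 / s * v))"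
    by (rule lborel_integrable_real_affine[OF F sn])
  from integrable_mult_right[OF this[unfolded eq], of "1 / s"]
  show ?I using s by (simp add: integrable_cauchy_measure_iff)
  have "(LINT u|lborel. ?F u) = \<bar>1 / s\<bar> *\<^sub>R (LINT v|lborel. ?F (- (c / s) + 1 / s * v))"
    by (rule lborel_integral_real_affine[OF sn])
  also have "\<dots> = (LINT v|lborel. s * (1 + v\<^sup>2) / (v\<^sup>2 - 2 * c * v + 1) * f (cmod z * v) / (1 + v\<^sup>2))"
    unfolding eq using s by (subst integral_mult_right_zero) simp
  finally show "?L = ?R" by (simp add: integral_cauchy_measure)
qed

context log_weight
begin

abbreviation P :: "real \<Rightarrow> real" where "P y \<equiv> H (\<i> * of_real y)"

lemma P_eq: "P y = (LINT u|cauchy_measure. \<phi> (y * u))"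
  by (simp add: H_def)

lemma convex_exp: "convex_on UNIV (\<lambda>\<tau>. \<phi> (exp \<tau>))"
  using weight unfolding logarithmic_weight_def by blast

text \<open>For convex \<open>g\<close>, both \<open>l\<close> and \<open>- l\<close> are convex
  combinations of \<open>m\<close> and \<open>- m\<close> with exchanged weights, so the even
  function \<open>g l + g (- l)\<close> grows with \<bar>l\<bar>.\<close>

lemma symmetrized_mono:
  assumes "r > 0" "\<bar>l\<bar> \<le> \<bar>m\<bar>"
  shows "\<phi> (r * exp l) + \<phi> (r * exp (- l)) \<le> \<phi> (r * exp m) + \<phi> (r * exp (- m))"
proof (cases "m = 0")
  case False
  define g where "g = (\<lambda>\<tau>. \<phi> (exp (ln r + \<tau>)))"
  have g: "g \<tau> = \<phi> (r * exp \<tau>)" for \<tau> using assms by (simp add: g_def exp_add)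
  have conv: "g ((1 - t) * x + t * y) \<le> (1 - t) * g x + t * g y" if "0 \<le> t" "t \<le> 1" for t x y
  proof -
    have "ln r + ((1 - t) * x + t * y) = (1 - t) *\<^sub>R (ln r + x) + t *\<^sub>R (ln r + y)"
      by (simp add: algebra_simps)
    then show ?thesis
      unfolding g_def using convex_onD[OF convex_exp, of t "ln r + x" "ln r + y"] that by simp
  qed
  define t where "t = (1 - l / m) / 2"
  have "\<bar>l / m\<bar> \<le> 1" using assms False by (simp add: divide_le_eq_1)
  then have "- 1 \<le> l / m \<and> l / m \<le> 1" by linarith
  then have t: "0 \<le> t" "t \<le> 1" unfolding t_def by simp_all
  have l: "l = (1 - t) * m + t * (- m)" "- l = (1 - t) * (- m) + t * m"
    using False by (simp_all add: t_def field_simps)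
  have "g l + g (- l) \<le> ((1 - t) * g m + t * g (- m)) + ((1 - t) * g (- m) + t * g m)"
    by (subst l(2), subst l(1), intro add_mono conv t)
  also have "\<dots> = g m + g (- m)" by (simp add: algebra_simps)
  finally show ?thesis by (simp add: g)
qed (use assms in auto)

text \<open>Folding \<open>u \<mapsto> -u\<close> and \<open>u \<mapsto> 1/u\<close>, the Poisson kernel at \<open>r e\<^sup>i\<^sup>\<theta>\<close> divided by the one at \<open>i r\<close>
  is a decreasing function of \<open>\<bar>ln \<bar>u\<bar>\<bar>\<close> with mean 1, while the folded weight is increasing.\<close>

lemma H_le_P:
  assumes z: "Im z > 0"
  shows "H z \<le> P (cmod z)"
proof -
  define r c s where "r = cmod z" and "c = Re z / cmod z" and "s = Im z / cmod z"
  have r: "r > 0" unfolding r_def using z by (metis Im_complex_of_real less_irrefl norm_eq_zero of_real_0 zero_less_norm_iff)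
  have s: "s > 0" using z r by (simp add: s_def r_def)
  have cs: "c\<^sup>2 + s\<^sup>2 = 1"
    using r unfolding c_def s_def r_def power_divide add_divide_distrib[symmetric] by (simp add: cmod_power2[symmetric])
  then have s1: "s \<le> 1" using s by (metis abs_of_pos abs_square_le_1 le_add_same_cancel2 zero_le_power2)
  define k where "k = (\<lambda>v. s * (1 + v\<^sup>2) / (v\<^sup>2 - 2 * c * v + 1))"
  define K where "K = (\<lambda>v. (k v + k (- v)) / 2)"
  have [measurable]: "k \<in> borel_measurable borel" "K \<in> borel_measurable borel"
    unfolding k_def K_def by measurable
  have den: "0 < v\<^sup>2 - 2 * c * v + 1" for v
  proof -
    have "v\<^sup>2 - 2 * c * v + 1 = (v - c)\<^sup>2 + s\<^sup>2"
      using cs by (simp add: power2_eq_square algebra_simps)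
    then show ?thesis using s by (simp add: add_nonneg_pos)
  qed
  \<comment> \<open>Only \<open>2 * v / (1 + v\<^sup>2)\<close> enters, which up to sign is
    \<open>1 / cosh (ln \<bar>v\<bar>)\<close>; this shows the symmetry under inversion and the
    monotonicity at once.\<close>
  have K_eq: "K v = s / (1 - c\<^sup>2 * (2 * v / (1 + v\<^sup>2))\<^sup>2)" for v
  proof -
    have "K v = s * (1 + v\<^sup>2) * (1 + v\<^sup>2) / ((v\<^sup>2 - 2 * c * v + 1) * (v\<^sup>2 - 2 * c * (- v) + 1))"
      using den[of v] den[of "-v"] by (simp add: K_def k_def divide_simps) (simp add: algebra_simps)
    also have "(v\<^sup>2 - 2 * c * v + 1) * (v\<^sup>2 - 2 * c * (- v) + 1) = (1 + v\<^sup>2)\<^sup>2 - c\<^sup>2 * (2 * v)\<^sup>2"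
      by (simp add: power2_eq_square algebra_simps)
    also have "\<dots> = (1 - c\<^sup>2 * (2 * v / (1 + v\<^sup>2))\<^sup>2) * (1 + v\<^sup>2)\<^sup>2"
      using one_plus_square_pos[of v] by (simp add: power_divide left_diff_distrib)
    finally show ?thesis using one_plus_square_pos[of v] by (simp add: power2_eq_square)
  qed
  have K_inv: "K (1 / v) = K v" for v
  proof (cases "v = 0")
    case False
    then have "2 * (1 / v) / (1 + (1 / v)\<^sup>2) = 2 * v / (1 + v\<^sup>2)"
      using one_plus_square_pos[of v] one_plus_square_pos[of "1 / v"] by (simp add: field_simps power2_eq_square)
    then show ?thesis unfolding K_eq by simp
  qed simp
  have fold: "integrable cauchy_measure (\<lambda>v. K v * f (r * v)) \<and>
       integral\<^sup>L cauchy_measure (\<lambda>v. K v * f (r * v)) = integral\<^sup>L cauchy_measure (\<lambda>u. f (Re z + Im z * u))"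
    if [measurable]: "f \<in> borel_measurable borel" and f: "\<And>t. f (- t) = f t"
      "integrable cauchy_measure (\<lambda>u. f (Re z + Im z * u))" for f :: "real \<Rightarrow> real"
  proof -
    have 1: "integrable cauchy_measure (\<lambda>v. k v * f (r * v))"
        "integral\<^sup>L cauchy_measure (\<lambda>v. k v * f (r * v)) = integral\<^sup>L cauchy_measure (\<lambda>u. f (Re z + Im z * u))"
      unfolding k_def c_def s_def r_def using integral_cauchy_rotate[OF that(1) z f(2)] by auto
    have 2: "integrable cauchy_measure (\<lambda>v. k (- v) * f (r * v))"
        "integral\<^sup>L cauchy_measure (\<lambda>v. k (- v) * f (r * v)) = integral\<^sup>L cauchy_measure (\<lambda>u. f (Re z + Im z * u))"
      using integrable_cauchy_uminus[OF _ 1(1)] integral_cauchy_uminus[of "\<lambda>v. k v * f (r * v)"] 1(2) f(1)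
      by simp_all
    have eq: "(\<lambda>v. K v * f (r * v)) = (\<lambda>v. (k v * f (r * v) + k (- v) * f (r * v)) / 2)"
      by (auto simp: K_def fun_eq_iff field_simps)
    show ?thesis unfolding eq using 1 2 by simp
  qed
  have K1: "integrable cauchy_measure K" "integral\<^sup>L cauchy_measure K = 1"
    using fold[of "\<lambda>_. 1"] by auto
  have Kp: "integrable cauchy_measure (\<lambda>v. K v * \<phi> (r * v))"
     "integral\<^sup>L cauchy_measure (\<lambda>v. K v * \<phi> (r * v)) = H z"
    using fold[of \<phi>] integrable_affine by (auto simp: even H_def)
  have Kp': "integrable cauchy_measure (\<lambda>v. K v * \<phi> (r / v))"
     "integral\<^sup>L cauchy_measure (\<lambda>v. K v * \<phi> (r / v)) = H z"
    using integral_cauchy_inverse[of "\<lambda>v. K v * \<phi> (r * v)"] Kp by (simp_all add: K_inv)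
  have p: "integrable cauchy_measure (\<lambda>v. \<phi> (r * v))"
     "integral\<^sup>L cauchy_measure (\<lambda>v. \<phi> (r * v)) = P r"
    using integrable_affine[of 0 r] by (auto simp: P_eq)
  have p': "integrable cauchy_measure (\<lambda>v. \<phi> (r / v))"
     "integral\<^sup>L cauchy_measure (\<lambda>v. \<phi> (r / v)) = P r"
    using integral_cauchy_inverse[of "\<lambda>v. \<phi> (r * v)"] p by simp_all
  define \<psi> where "\<psi> = (\<lambda>v. \<phi> (r * v) + \<phi> (r / v))"
  \<comment> \<open>The place where \<open>K\<close> passes through 1: for \<open>s < 1\<close> this
    happens at \<open>(cosh l)\<^sup>2 = c\<^sup>2 / (1 - s)\<close>, which is \<open>1 + s\<close>
    because \<open>c\<^sup>2 = (1 - s) * (1 + s)\<close>.\<close>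
  define m where "m = arcosh (sqrt (1 + s))"
  have coshm: "(cosh m)\<^sup>2 = 1 + s"
    using s by (simp add: m_def cosh_arcosh_real)
  define \<psi>0 where "\<psi>0 = \<psi> (exp m)"
  \<comment> \<open>Chebyshev's argument: \<open>K - 1\<close> and \<open>\<psi> - \<psi>0\<close>
    change sign at the same place in opposite directions. As \<open>K\<close> has mean 1, the
    constant \<open>\<psi>0\<close> drops out of the integral, leaving
    \<open>2 * H z - 2 * P r\<close>.\<close>
  have pt: "(K v - 1) * (\<psi> v - \<psi>0) \<le> 0" if v: "v \<noteq> 0" for v
  proof -
    define l where "l = ln \<bar>v\<bar>"
    have el: "exp l = \<bar>v\<bar>" using v by (simp add: l_def)
    have "cosh l = (\<bar>v\<bar> + 1 / \<bar>v\<bar>) / 2" by (simp add: cosh_def exp_minus el field_simps)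
    also have "\<dots> = (1 + v\<^sup>2) / (2 * \<bar>v\<bar>)" using v by (simp add: field_simps power2_eq_square)
    finally have "(2 * v / (1 + v\<^sup>2))\<^sup>2 = 1 / (cosh l)\<^sup>2"
      by (simp add: power_divide power_mult_distrib)
    then have Kl: "K v = s / (1 - c\<^sup>2 / (cosh l)\<^sup>2)" unfolding K_eq by simp
    have ch: "1 \<le> (cosh l)\<^sup>2" using cosh_real_ge_1[of l] by (simp add: one_le_power)
    have c1: "c\<^sup>2 = (1 - s) * (1 + s)" using cs by (simp add: algebra_simps power2_eq_square)
    have "c\<^sup>2 < 1" using cs s by (smt (verit) zero_less_power)
    then have pos: "0 < 1 - c\<^sup>2 / (cosh l)\<^sup>2" using ch by (simp add: field_simps)
    have \<psi>l: "\<psi> v = \<phi> (r * exp l) + \<phi> (r * exp (- l))"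
    proof -
      have "\<phi> (r * v) = \<phi> (r * \<bar>v\<bar>)" "\<phi> (r / v) = \<phi> (r / \<bar>v\<bar>)"
        using even_abs[of "r * v"] even_abs[of "r / v"] r by (simp_all add: abs_mult abs_divide del: even_abs)
      then show ?thesis unfolding \<psi>_def exp_minus el by (simp add: divide_inverse)
    qed
    have \<psi>m: "\<psi>0 = \<phi> (r * exp m) + \<phi> (r * exp (- m))"
      unfolding \<psi>0_def \<psi>_def exp_minus by (simp add: divide_inverse)
    show ?thesis
    proof (cases "\<bar>l\<bar> \<le> \<bar>m\<bar>")
      case True
      have "cosh \<bar>l\<bar> \<le> cosh \<bar>m\<bar>" using True by (subst cosh_real_nonneg_le_iff) auto
      then have "cosh l \<le> cosh m" by simp
      then have "(cosh l)\<^sup>2 \<le> 1 + s" unfolding coshm[symmetric] by (intro power_mono) auto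
      then have "(1 - s) * (cosh l)\<^sup>2 \<le> c\<^sup>2" unfolding c1 using s1 by (intro mult_left_mono) auto
      then have "1 - c\<^sup>2 / (cosh l)\<^sup>2 \<le> s" using ch by (simp add: field_simps)
      then have "1 \<le> K v" unfolding Kl using pos by simp
      moreover have "\<psi> v \<le> \<psi>0" unfolding \<psi>l \<psi>m by (rule symmetrized_mono[OF r True])
      ultimately show ?thesis by (simp add: mult_nonneg_nonpos)
    next
      case False
      then have F: "\<bar>m\<bar> \<le> \<bar>l\<bar>" by simp
      have "cosh \<bar>m\<bar> \<le> cosh \<bar>l\<bar>" using F by (subst cosh_real_nonneg_le_iff) auto
      then have "cosh m \<le> cosh l" by simp
      then have "1 + s \<le> (cosh l)\<^sup>2" unfolding coshm[symmetric] by (intro power_mono) auto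
      then have "c\<^sup>2 \<le> (1 - s) * (cosh l)\<^sup>2" unfolding c1 using s1 by (intro mult_left_mono) auto
      then have "s \<le> 1 - c\<^sup>2 / (cosh l)\<^sup>2" using ch by (simp add: field_simps)
      then have "K v \<le> 1" unfolding Kl using pos by simp
      moreover have "\<psi>0 \<le> \<psi> v" unfolding \<psi>l \<psi>m by (rule symmetrized_mono[OF r F])
      ultimately show ?thesis by (simp add: mult_nonpos_nonneg)
    qed
  qed
  have eq: "(K v - 1) * (\<psi> v - \<psi>0) =
      (K v * \<phi> (r * v) + K v * \<phi> (r / v)) - (\<phi> (r * v) + \<phi> (r / v)) - (\<psi>0 * K v - \<psi>0)" for v
    by (simp add: \<psi>_def algebra_simps)
  have "integral\<^sup>L cauchy_measure (\<lambda>v. (K v - 1) * (\<psi> v - \<psi>0)) = (H z + H z) - (P r + P r) - (\<psi>0 * 1 - \<psi>0)"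
    unfolding eq using K1 Kp Kp' p p' by simp
  moreover have "0 \<le> integral\<^sup>L cauchy_measure (\<lambda>v. - ((K v - 1) * (\<psi> v - \<psi>0)))"
    by (rule integral_nonneg_AE) (use AE_cauchy_not_single[of 0] pt in \<open>auto elim!: eventually_mono\<close>)
  ultimately show ?thesis by (simp add: r_def)
qed

section \<open>The slope \<open>P r / r\<close> and the scale at which it crosses
  \<open>s\<close>\<close>

definition p :: "real \<Rightarrow> real" where
  "p r = (LINT t|lborel. \<phi> t / (t\<^sup>2 + r\<^sup>2)) / pi"

text \<open>The slope is kept as one integral in which \<open>r\<close> occurs only in the
  denominator, which makes its monotonicity and its limit immediate; \<open>t = r * u\<close> gives
  back the Cauchy mean.\<close>

lemma integrable_p:
  assumes "r > 0"
  shows "integrable lborel (\<lambda>t. \<phi> t / (t\<^sup>2 + r\<^sup>2))"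
    and "P r = r * p r"
proof -
  have eq: "\<phi> (0 + r * u) / ((0 + r * u)\<^sup>2 + r\<^sup>2) = (1 / r\<^sup>2) * (\<phi> (r * u) / (1 + u\<^sup>2))" for u
  proof -
    have "(0 + r * u)\<^sup>2 + r\<^sup>2 = r\<^sup>2 * (1 + u\<^sup>2)" by (simp add: algebra_simps)
    then show ?thesis by simp
  qed
  have "integrable lborel (\<lambda>u. \<phi> (0 + r * u) / ((0 + r * u)\<^sup>2 + r\<^sup>2))"
    unfolding eq using integrable_affine[of 0 r]
    by (intro integrable_mult_right) (simp add: integrable_cauchy_measure_iff)
  then show "integrable lborel (\<lambda>t. \<phi> t / (t\<^sup>2 + r\<^sup>2))"
    using lborel_integrable_real_affine_iff[of r "\<lambda>t. \<phi> t / (t\<^sup>2 + r\<^sup>2)" 0] assms by simp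
  have "pi * p r = r * (LINT u|lborel. (1 / r\<^sup>2) * (\<phi> (r * u) / (1 + u\<^sup>2)))"
    unfolding p_def using lborel_integral_real_affine[of r "\<lambda>t. \<phi> t / (t\<^sup>2 + r\<^sup>2)" 0] assms
    unfolding eq by simp
  also have "\<dots> = (1 / r) * (LINT u|lborel. \<phi> (r * u) / (1 + u\<^sup>2))"
    unfolding integral_mult_right_zero using assms by (simp add: power2_eq_square)
  finally show "P r = r * p r"
    using assms by (simp add: P_eq integral_cauchy_measure field_simps)
qed

lemma p_antimono: 
  assumes "0 < r" "r \<le> r'" shows "p r' \<le> p r"
  unfolding p_def
proof (intro divide_right_mono integral_mono integrable_p)
  fix t
  have "0 < t\<^sup>2 + r\<^sup>2" using assms by (intro add_nonneg_pos) auto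
  moreover have "r\<^sup>2 \<le> r'\<^sup>2" using assms by (intro power_mono) auto
  ultimately show "\<phi> t / (t\<^sup>2 + r'\<^sup>2) \<le> \<phi> t / (t\<^sup>2 + r\<^sup>2)"
    by (intro divide_left_mono) auto
qed (use assms in auto)

text \<open>The source of both the lower bound for the Legendre transform and the tail estimate: the
  mass of \<open>\<phi>\<close> on \<open>{2 * r..4 * r}\<close> alone already forces a definite
  drop of the slope over one doubling.\<close>

lemma p_gap:
  assumes r: "0 < r"
  shows "3 / (200 * pi) * (\<phi> (2 * r) / r) \<le> p r - p (2 * r)"
proof -
  have "pi * (p r - p (2 * r)) = (LINT t|lborel. \<phi> t / (t\<^sup>2 + r\<^sup>2) - \<phi> t / (t\<^sup>2 + (2 * r)\<^sup>2))"
    unfolding p_def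
    using Bochner_Integration.integral_diff[OF integrable_p(1)[of r] integrable_p(1)[of "2 * r"]] r
    by (simp add: diff_divide_distrib[symmetric])
  \<comment> \<open>On the window both denominators are at most \<open>20 * r\<^sup>2\<close> and
    they differ by \<open>3 * r\<^sup>2\<close>, which gives the height
    \<open>3 / (400 * r\<^sup>2)\<close> times \<open>\<phi> (2 * r)\<close>; the width is
    \<open>2 * r\<close>.\<close>
  also have "\<dots> \<ge> (LINT t|lborel. 3 * \<phi> (2 * r) / (400 * r\<^sup>2) * indicator {2 * r..4 * r} t)"
  proof (rule integral_mono)
    show "integrable lborel (\<lambda>t. \<phi> t / (t\<^sup>2 + r\<^sup>2) - \<phi> t / (t\<^sup>2 + (2 * r)\<^sup>2))"
      using integrable_p(1)[of r] integrable_p(1)[of "2 * r"] r by simp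
    show "integrable lborel (\<lambda>t. 3 * \<phi> (2 * r) / (400 * r\<^sup>2) * indicator {2 * r..4 * r} t)"
      by (intro integrable_mult_right integrable_real_indicator) (use r in \<open>auto simp: emeasure_lborel_Icc_eq\<close>)
    fix t
    have a: "0 < t\<^sup>2 + r\<^sup>2" and b: "0 < t\<^sup>2 + (2 * r)\<^sup>2" using r by (auto intro!: add_nonneg_pos)
    have eq: "\<phi> t / (t\<^sup>2 + r\<^sup>2) - \<phi> t / (t\<^sup>2 + (2 * r)\<^sup>2) = \<phi> t * (3 * r\<^sup>2 / ((t\<^sup>2 + r\<^sup>2) * (t\<^sup>2 + (2 * r)\<^sup>2)))"
    proof -
      have "x / A - x / B = x * ((B - A) / (A * B))" if "A > 0" "B > 0" for x A B :: real
        using that by (simp add: field_simps)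
      from this[OF a b] show ?thesis by (simp add: power_mult_distrib)
    qed
    show "3 * \<phi> (2 * r) / (400 * r\<^sup>2) * indicator {2 * r..4 * r} t \<le> \<phi> t / (t\<^sup>2 + r\<^sup>2) - \<phi> t / (t\<^sup>2 + (2 * r)\<^sup>2)"
    proof (cases "t \<in> {2 * r..4 * r}")
      case True
      have "t\<^sup>2 \<le> (4 * r)\<^sup>2" using True r by (intro power_mono) auto
      then have "t\<^sup>2 + r\<^sup>2 \<le> 20 * r\<^sup>2" "t\<^sup>2 + (2 * r)\<^sup>2 \<le> 20 * r\<^sup>2"
      proof -
        have "(4 * r)\<^sup>2 = 16 * r\<^sup>2" "(2 * r)\<^sup>2 = 4 * r\<^sup>2" by (simp_all add: power_mult_distrib)
        then show "t\<^sup>2 + r\<^sup>2 \<le> 20 * r\<^sup>2" "t\<^sup>2 + (2 * r)\<^sup>2 \<le> 20 * r\<^sup>2"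
          using \<open>t\<^sup>2 \<le> (4 * r)\<^sup>2\<close> zero_le_power2[of r] by linarith+
      qed
      then have "(t\<^sup>2 + r\<^sup>2) * (t\<^sup>2 + (2 * r)\<^sup>2) \<le> (20 * r\<^sup>2) * (20 * r\<^sup>2)"
        by (intro mult_mono) auto
      then have "3 * r\<^sup>2 / ((20 * r\<^sup>2) * (20 * r\<^sup>2)) \<le> 3 * r\<^sup>2 / ((t\<^sup>2 + r\<^sup>2) * (t\<^sup>2 + (2 * r)\<^sup>2))"
        using a b by (intro divide_left_mono) (auto intro!: mult_pos_pos)
      moreover have "3 * r\<^sup>2 / ((20 * r\<^sup>2) * (20 * r\<^sup>2)) = 3 / (400 * r\<^sup>2)"
        using r by (simp add: power2_eq_square)
      moreover have "\<phi> (2 * r) \<le> \<phi> t" using True r by (intro mono_abs) auto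
      ultimately have "\<phi> (2 * r) * (3 / (400 * r\<^sup>2)) \<le> \<phi> t * (3 * r\<^sup>2 / ((t\<^sup>2 + r\<^sup>2) * (t\<^sup>2 + (2 * r)\<^sup>2)))"
        using r by (intro mult_mono) auto
      then show ?thesis unfolding eq using True by (simp add: mult.commute)
    next
      case False
      then show ?thesis unfolding eq using a b by simp
    qed
  qed
  also have "(LINT t|lborel. 3 * \<phi> (2 * r) / (400 * r\<^sup>2) * indicator {2 * r..4 * r} t) = 3 / 200 * (\<phi> (2 * r) / r)"
    using r by (simp add: power2_eq_square)
  finally have "3 / 200 * (\<phi> (2 * r) / r) / pi \<le> pi * (p r - p (2 * r)) / pi"
    by (rule divide_right_mono) simp
  then show ?thesis by (simp add: mult_ac)
qed

lemma p_tendsto_0: "(\<lambda>n. p (2 ^ n)) \<longlonglongrightarrow> 0"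
proof -
  have "(\<lambda>n. LINT t|lborel. \<phi> t / (t\<^sup>2 + (2 ^ n)\<^sup>2)) \<longlonglongrightarrow> integral\<^sup>L lborel (\<lambda>_::real. 0::real)"
  proof (rule integral_dominated_convergence[where f="\<lambda>_. 0" and s="\<lambda>n t. \<phi> t / (t\<^sup>2 + (2 ^ n)\<^sup>2)" and w="\<lambda>t. \<phi> t / (t\<^sup>2 + 1)"])
    show "AE t in lborel. (\<lambda>n. \<phi> t / (t\<^sup>2 + (2 ^ n)\<^sup>2)) \<longlonglongrightarrow> 0"
      by (intro AE_I2) real_asymp
    show "AE t in lborel. norm (\<phi> t / (t\<^sup>2 + (2 ^ n)\<^sup>2)) \<le> \<phi> t / (t\<^sup>2 + 1)" for n
    proof (rule AE_I2)
      fix t :: real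
      have "(1::real) \<le> (2 ^ n)\<^sup>2" by (simp add: one_le_power)
      then show "norm (\<phi> t / (t\<^sup>2 + (2 ^ n)\<^sup>2)) \<le> \<phi> t / (t\<^sup>2 + 1)"
        using one_plus_square_pos[of t] by (auto intro!: divide_left_mono mult_pos_pos simp: add_nonneg_pos add.commute)
    qed
    show "integrable lborel (\<lambda>t. \<phi> t / (t\<^sup>2 + 1))" by (rule integrable_weight)
  qed auto
  then have "(\<lambda>n. p (2 ^ n)) \<longlonglongrightarrow> 0 / pi"
    unfolding p_def by (intro tendsto_divide) auto
  then show ?thesis by simp
qed

lemma P_mono: "0 \<le> x \<Longrightarrow> x \<le> y \<Longrightarrow> P x \<le> P y"
  unfolding P_eq using integrable_affine[of 0]
  by (intro integral_mono mono_abs) (auto simp: abs_mult intro!: mult_right_mono)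

text \<open>Zero exponential type of the weight: past some \<open>2 ^ n\<close> the slope stays
  below \<epsilon>, and before it \<open>P\<close> is at most its value at
  \<open>2 ^ n\<close>.\<close>

lemma P_linear_bound:
  assumes "\<epsilon> > 0" obtains C where "\<And>y. y \<ge> 0 \<Longrightarrow> P y \<le> \<epsilon> * y + C"
proof -
  have "\<forall>\<^sub>F n in sequentially. p (2 ^ n) < \<epsilon>"
    using p_tendsto_0 assms by (rule order_tendstoD)
  then obtain n where n: "p (2 ^ n) < \<epsilon>" by (auto simp: eventually_sequentially)
  show ?thesis
  proof (rule that[of "P (2 ^ n)"])
    fix y :: real assume y: "y \<ge> 0"
    show "P y \<le> \<epsilon> * y + P (2 ^ n)"
    proof (cases "y \<le> 2 ^ n")
      case True
      then show ?thesis using P_mono[OF y True] assms y by (simp add: add_increasing)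
    next
      case False
      then have y0: "y > 0" "2 ^ n \<le> y" by (auto intro: less_le_trans[of 0 "2 ^ n"])
      then have "P y \<le> y * \<epsilon>"
        using n p_antimono[of "2 ^ n" y] integrable_p(2)[OF y0(1)] by simp
      then show ?thesis using H_nonneg[of "\<i> * of_real (2 ^ n)"] by (simp add: mult.commute)
    qed
  qed
qed

lemma legendre_Q_eq: "legendre_Q \<phi> s = (SUP y\<in>{0<..}. P y - y * s)"
  unfolding legendre_Q_def by (intro SUP_cong) (auto simp: cmod_outer_weight)

lemma bdd_above_legendre: "s > 0 \<Longrightarrow> bdd_above ((\<lambda>y. P y - y * s) ` {0<..})"
proof -
  assume s: "s > 0"
  obtain C where C: "\<And>y. y \<ge> 0 \<Longrightarrow> P y \<le> s * y + C" using P_linear_bound[OF s] by blast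
  show ?thesis by (rule bdd_aboveI2[of _ _ C]) (use C in \<open>auto simp: algebra_simps dest!: less_imp_le\<close>)
qed

lemma legendre_Q_upper: "s > 0 \<Longrightarrow> y > 0 \<Longrightarrow> P y - y * s \<le> legendre_Q \<phi> s"
  unfolding legendre_Q_eq by (rule cSUP_upper) (auto intro: bdd_above_legendre)

text \<open>The least power of 2 with slope below \<open>s\<close> replaces an inverse function of
  \<open>p\<close>. The factor 2 between the two inequalities is harmless, since the final error is
  measured by \<open>ln R\<close>.\<close>

lemma crossing_scale:
  assumes "0 < s" "s \<le> p (2 ^ N)"
  obtains R where "R \<ge> 2 ^ N" "s \<le> p R" "p (2 * R) < s"
proof -
  have "\<forall>\<^sub>F n in sequentially. p (2 ^ n) < s"
    using p_tendsto_0 assms(1) by (rule order_tendstoD)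
  then have ex: "\<exists>n. p (2 ^ n) < s" by (auto simp: eventually_sequentially)
  define n where "n = (LEAST n. p (2 ^ n) < s)"
  have n: "p (2 ^ n) < s" unfolding n_def using ex by (rule LeastI_ex)
  have "N < n"
  proof (rule ccontr)
    assume "\<not> N < n"
    then have "p (2 ^ N) \<le> p (2 ^ n)" by (intro p_antimono) (auto simp: power_increasing)
    then show False using n assms by simp
  qed
  then obtain m where m: "n = Suc m" "N \<le> m" by (cases n) auto
  have "\<not> p (2 ^ m) < s" using m not_less_Least[of m "\<lambda>n. p (2 ^ n) < s"] by (simp add: n_def)
  with n m show ?thesis by (intro that[of "2 ^ m"]) (auto simp: power_increasing)
qed

text \<open>Test the supremum at \<open>R / 2\<close>: there the slope exceeds \<open>s\<close> by
  at least the gap between \<open>R / 2\<close> and \<open>R\<close>.\<close>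

lemma legendre_Q_ge:
  assumes "0 < s" "R > 0" "s \<le> p R"
  shows "3 / (200 * pi) * \<phi> R \<le> legendre_Q \<phi> s"
proof -
  have "3 / (200 * pi) * \<phi> R = R / 2 * (3 / (200 * pi) * (\<phi> (2 * (R / 2)) / (R / 2)))"
    using assms by simp
  also have "\<dots> \<le> R / 2 * (p (R / 2) - p (2 * (R / 2)))"
    using assms by (intro mult_left_mono p_gap) auto
  also have "\<dots> \<le> R / 2 * (p (R / 2) - s)" using assms by (intro mult_left_mono) auto
  also have "\<dots> = P (R / 2) - R / 2 * s" using integrable_p(2)[of "R / 2"] assms by (simp add: algebra_simps)
  also have "\<dots> \<le> legendre_Q \<phi> s" by (rule legendre_Q_upper) (use assms in auto)
  finally show ?thesis .
qed

text \<open>The same gap on the other side of the crossing, from \<open>2 * R\<close> to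
  \<open>4 * R\<close>: beyond it the slope falls short of \<open>s\<close> by a fixed amount, so
  the exponent falls at least linearly.\<close>

lemma P_tail:
  assumes "R > 0" "p (2 * R) \<le> s" "r \<ge> 4 * R"
  shows "P r - s * r \<le> - (3 / (400 * pi) * \<phi> R / R) * r"
proof -
  have "3 / (400 * pi) * \<phi> R / R \<le> 3 / (200 * pi) * (\<phi> (2 * (2 * R)) / (2 * R))"
    using mono_abs[of R "4 * R"] assms by (simp add: field_simps)
  also have "\<dots> \<le> p (2 * R) - p (2 * (2 * R))" by (rule p_gap) (use assms in auto)
  also have "\<dots> \<le> s - p r" using p_antimono[of "4 * R" r] assms by simp
  finally have "(3 / (400 * pi) * \<phi> R / R) * r \<le> (s - p r) * r" using assms by (intro mult_right_mono) auto
  then show ?thesis using integrable_p(2)[of r] assms by (simp add: algebra_simps)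
qed

end

section \<open>Laplace transforms of functions of zero exponential type\<close>

definition zero_exp_type :: "(complex \<Rightarrow> complex) \<Rightarrow> bool" where
  "zero_exp_type f \<longleftrightarrow> f holomorphic_on UNIV \<and> (\<forall>\<epsilon>>0. \<exists>C. \<forall>z. cmod (f z) \<le> C * exp (\<epsilon> * cmod z))"

lemma zero_exp_type_holomorphic: "zero_exp_type f \<Longrightarrow> f holomorphic_on A"
  by (auto simp: zero_exp_type_def intro: holomorphic_on_subset)

lemma zero_exp_type_scale:
  assumes "zero_exp_type f" "cmod u = 1"
  shows "zero_exp_type (\<lambda>z. f (u * z))"
proof -
  have "(\<lambda>z. f (u * z)) holomorphic_on UNIV"
    using holomorphic_on_compose_gen[of "\<lambda>z. u * z" UNIV f UNIV] zero_exp_type_holomorphic[OF assms(1), of UNIV]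
    by (auto simp: o_def intro: holomorphic_intros)
  moreover have "\<exists>C. \<forall>z. cmod (f (u * z)) \<le> C * exp (\<epsilon> * cmod z)" if eps: "\<epsilon> > 0" for \<epsilon>
  proof -
    obtain C where "\<And>z. cmod (f z) \<le> C * exp (\<epsilon> * cmod z)"
      using assms(1) eps unfolding zero_exp_type_def by blast
    from this[of "u * z" for z] show ?thesis using assms(2) by (auto simp: norm_mult)
  qed
  ultimately show ?thesis by (auto simp: zero_exp_type_def)
qed

text \<open>The derivative at 0 is \<open>fact k\<close> times the Taylor coefficient, so this is
  what makes \<open>borel_series\<close> entire.\<close>

lemma zero_exp_type_deriv_bound:
  assumes "zero_exp_type f" "\<delta> > 0"
  obtains C where "C \<ge> 0" "\<And>k. cmod ((deriv ^^ k) f 0) \<le> C * \<delta> ^ k"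
proof -
  \<comment> \<open>The Cauchy estimate is used at \<open>r = k / \<epsilon>\<close>, which
    minimises \<open>exp (\<epsilon> * r) / r ^ k\<close>; with \<open>fact k \<le> k ^ k\<close> it
    gives \<open>(\<epsilon> * exp 1) ^ k\<close>.\<close>
  define \<epsilon> where "\<epsilon> = \<delta> / exp 1"
  have \<epsilon>: "\<epsilon> > 0" using assms by (simp add: \<epsilon>_def)
  obtain C where C: "\<And>z. cmod (f z) \<le> C * exp (\<epsilon> * cmod z)"
    using assms(1) \<epsilon> unfolding zero_exp_type_def by blast
  have C0: "C \<ge> 0" using order_trans[OF norm_ge_zero C[of 0]] by simp
  have "cmod ((deriv ^^ k) f 0) \<le> C * \<delta> ^ k" for k
  proof (cases "k = 0")
    case False
    define r where "r = k / \<epsilon>"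
    have r: "r > 0" using False \<epsilon> by (simp add: r_def)
    have "cmod ((deriv ^^ k) f 0) \<le> fact k * (C * exp (\<epsilon> * r)) / r ^ k"
    proof (rule Cauchy_inequality)
      show "f holomorphic_on ball 0 r" "continuous_on (cball 0 r) f"
        using zero_exp_type_holomorphic[OF assms(1)] holomorphic_on_imp_continuous_on by blast+
    qed (use r C in \<open>auto simp: norm_minus_commute\<close>)
    also have "\<dots> \<le> real (k ^ k) * (C * exp (\<epsilon> * r)) / r ^ k"
      using C0 r fact_le_power[of k, where 'a=real]
      by (intro divide_right_mono mult_right_mono) auto
    also have "\<dots> = C * (real (k ^ k) / r ^ k) * exp (\<epsilon> * r)" by simp
    also have "\<dots> = C * \<delta> ^ k"
    proof -
      have "\<epsilon> * r = k" using \<epsilon> by (simp add: r_def)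
      then have "exp (\<epsilon> * r) = exp 1 ^ k" by (metis exp_of_nat_mult mult.right_neutral)
      moreover have "real (k ^ k) / r ^ k = \<epsilon> ^ k" using False \<epsilon> by (simp add: r_def power_divide)
      moreover have "\<delta> = \<epsilon> * exp 1" by (simp add: \<epsilon>_def)
      ultimately show ?thesis by (simp only: power_mult_distrib mult.assoc)
    qed
    finally show ?thesis .
  qed (use C[of 0] in simp)
  with C0 that show ?thesis by blast
qed

lemma zero_exp_type_summable:
  assumes "zero_exp_type f" "R \<ge> 0"
  shows "summable (\<lambda>k. cmod ((deriv ^^ k) f 0) * R ^ k)"
proof -
  define \<delta> where "\<delta> = 1 / (2 * (R + 1))"
  have \<delta>: "\<delta> > 0" "\<delta> * R < 1" using assms by (auto simp: \<delta>_def field_simps)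
  obtain C where C: "C \<ge> 0" "\<And>k. cmod ((deriv ^^ k) f 0) \<le> C * \<delta> ^ k"
    using zero_exp_type_deriv_bound[OF assms(1) \<delta>(1)] by blast
  show ?thesis
  proof (rule summable_comparison_test)
    show "\<exists>N. \<forall>n\<ge>N. norm (cmod ((deriv ^^ n) f 0) * R ^ n) \<le> C * (\<delta> * R) ^ n"
      using C assms(2) by (auto simp: power_mult_distrib mult.assoc[symmetric] intro!: mult_right_mono)
    show "summable (\<lambda>n. C * (\<delta> * R) ^ n)"
      using \<delta> assms(2) by (intro summable_mult summable_geometric) auto
  qed
qed

lemma taylor_sums:
  assumes "zero_exp_type f"
  shows "(\<lambda>k. (deriv ^^ k) f 0 / fact k * z ^ k) sums f z"
  using holomorphic_power_series[of f 0 "cmod z + 1" z] zero_exp_type_holomorphic[OF assms] by simp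

text \<open>If \<open>f\<close> has Taylor coefficients \<open>a\<^sub>k\<close>, its Laplace transform is the sum of \<open>k! a\<^sub>k / \<zeta>\<^sup>k\<^sup>+\<^sup>1\<close>,
  which is \<open>borel_series f (1 / \<zeta>) / \<zeta>\<close>.\<close>

definition borel_series :: "(complex \<Rightarrow> complex) \<Rightarrow> complex \<Rightarrow> complex" where
  "borel_series f w = (\<Sum>k. (deriv ^^ k) f 0 * w ^ k)"

lemma borel_series_sums:
  assumes "zero_exp_type f"
  shows "(\<lambda>k. (deriv ^^ k) f 0 * w ^ k) sums borel_series f w"
  unfolding borel_series_def
  using zero_exp_type_summable[OF assms, of "cmod w"]
  by (intro summable_sums summable_norm_cancel[where f="\<lambda>k. (deriv ^^ k) f 0 * w ^ k"]) (simp add: norm_mult norm_power)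

lemma holomorphic_borel_series:
  assumes "zero_exp_type f"
  shows "borel_series f holomorphic_on A"
proof -
  have "\<exists>D. (borel_series f has_field_derivative D) (at w)" for w
    unfolding borel_series_def
    by (rule exI, rule termdiffs_strong_converges_everywhere)
      (use borel_series_sums[OF assms] in \<open>auto simp: sums_iff\<close>)
  then show ?thesis
    unfolding holomorphic_on_def field_differentiable_def by (blast intro: has_field_derivative_at_within)
qed

lemma higher_deriv_borel_series:
  assumes "zero_exp_type f"
  shows "(deriv ^^ k) (borel_series f) 0 = fact k * (deriv ^^ k) f 0"
proof -
  have "borel_series f has_fps_expansion Abs_fps (\<lambda>k. (deriv ^^ k) f 0)"
    using borel_series_sums[OF assms] by (intro has_fps_expansionI) simp
  then have "fps_expansion (borel_series f) 0 = Abs_fps (\<lambda>k. (deriv ^^ k) f 0)"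
    by (rule fps_expansion_eqI)
  from arg_cong[OF this, of "\<lambda>F. fps_nth F k"] show ?thesis
    by (simp add: fps_expansion_def field_simps)
qed

lemma integrable_power_exp:
  fixes \<sigma> :: real
  assumes "\<sigma> > 0"
  shows "set_integrable lborel {0..} (\<lambda>x. x ^ k * exp (- (\<sigma> * x)))"
proof -
  let ?g = "\<lambda>x::real. indicator {0..} x *\<^sub>R (x ^ k * exp (- x))"
  have "integrable lborel ?g"
  proof (rule integrableI_bounded)
    have "(\<integral>\<^sup>+ x. ennreal (norm (?g x)) \<partial>lborel) = (\<integral>\<^sup>+ x. ennreal (x ^ k * exp (- x)) * indicator {0..} x \<partial>lborel)"
      by (intro nn_integral_cong) (auto split: split_indicator)
    then show "(\<integral>\<^sup>+ x. ennreal (norm (?g x)) \<partial>lborel) < \<infinity>"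
      by (simp add: nn_intergal_power_times_exp_Ici)
  qed measurable
  from integrable_mult_right[OF lborel_integrable_real_affine[OF this, of \<sigma> 0], of "1 / \<sigma> ^ k"]
  have "integrable lborel (\<lambda>x. 1 / \<sigma> ^ k * ?g (0 + \<sigma> * x))" using assms by simp
  moreover have "1 / \<sigma> ^ k * ?g (0 + \<sigma> * x) = indicator {0..} x *\<^sub>R (x ^ k * exp (- (\<sigma> * x)))" for x
    using assms by (auto simp: indicator_def zero_le_mult_iff power_mult_distrib)
  ultimately show ?thesis by (simp add: set_integrable_def)
qed

lemma integral_power_exp:
  fixes \<zeta> :: complex
  assumes "Re \<zeta> > 0"
  shows "set_integrable lborel {0..} (\<lambda>x. of_real x ^ k * exp (- \<zeta> * of_real x))" (is "set_integrable _ _ (?h k)")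
    and "(LBINT x:{0..}. of_real x ^ k * exp (- \<zeta> * of_real x)) = fact k / \<zeta> ^ Suc k"
proof -
  have \<zeta>: "\<zeta> \<noteq> 0" using assms by auto
  have nrm: "norm (?h k x) = x ^ k * exp (- (Re \<zeta> * x))" if "x \<ge> 0" for k x
    using that by (simp add: norm_mult norm_power)
  have int: "set_integrable lborel {0..} (?h k)" for k
    unfolding set_integrable_def
  proof (rule Bochner_Integration.integrable_bound)
    show "integrable lborel (\<lambda>x. indicator {0..} x *\<^sub>R (x ^ k * exp (- (Re \<zeta> * x))))"
      using integrable_power_exp[OF assms] by (simp add: set_integrable_def)
    show "AE x in lborel. norm (indicator {0..} x *\<^sub>R ?h k x) \<le> norm (indicator {0..} x *\<^sub>R (x ^ k * exp (- (Re \<zeta> * x))))"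
      by (intro AE_I2) (auto simp: norm_mult norm_power split: split_indicator)
  qed measurable
  then show "set_integrable lborel {0..} (?h k)" .
  have int': "set_integrable lborel {0<..} (?h k)" for k
    by (rule set_integrable_subset[OF int]) auto
  have open_eq: "(LBINT x=0..\<infinity>. g x) = (LBINT x:{0..}. g x)" for g :: "real \<Rightarrow> complex"
  proof -
    have "(LBINT x=0..\<infinity>. g x) = (LBINT x:{0<..}. g x)"
      by (simp add: interval_lebesgue_integral_def zero_ereal_def)
    also have "\<dots> = (LBINT x:{0..}. g x)"
      unfolding set_lebesgue_integral_def
      by (intro integral_discrete_difference[where X="{0}"]) (auto split: split_indicator)
    finally show ?thesis .
  qed
  have lim: "((\<lambda>x. - (?h k x) / \<zeta>) \<longlongrightarrow> 0) at_top" for k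
  proof -
    have "((\<lambda>x. x ^ k * exp (- (Re \<zeta> * x))) \<longlongrightarrow> 0) at_top"
      using assms by real_asymp
    then have "((\<lambda>x. norm (?h k x)) \<longlongrightarrow> 0) at_top"
      by (rule Lim_transform_eventually) (use nrm in \<open>auto intro!: eventually_mono[OF eventually_ge_at_top[of 0]]\<close>)
    then have "((\<lambda>x. ?h k x) \<longlongrightarrow> 0) at_top" by (simp add: tendsto_norm_zero_iff)
    from tendsto_divide[OF tendsto_minus[OF this] tendsto_const[of \<zeta>]] show ?thesis using \<zeta> by simp
  qed
  have lim0: "((\<lambda>x. - (?h k x) / \<zeta>) \<longlongrightarrow> - (?h k 0) / \<zeta>) (at_right 0)" for k
    by (intro tendsto_intros \<zeta>)
  have "(LBINT x:{0..}. ?h k x) = fact k / \<zeta> ^ Suc k"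
  proof (induction k)
    case 0
    have "(LBINT x=0..\<infinity>. ?h 0 x) = 0 - (- (?h 0 0) / \<zeta>)"
    proof (rule interval_integral_FTC_integrable[where F="\<lambda>x. - (?h 0 x) / \<zeta>"])
      show "((\<lambda>x. - (?h 0 x) / \<zeta>) has_vector_derivative ?h 0 x) (at x)" for x
        by (rule has_vector_derivative_real_field) (auto intro!: derivative_eq_intros simp: \<zeta>)
      show "set_integrable lborel (einterval 0 \<infinity>) (?h 0)" using int'[of 0] by (simp add: zero_ereal_def)
      show "(((\<lambda>x. - (?h 0 x) / \<zeta>) \<circ> real_of_ereal) \<longlongrightarrow> 0) (at_left \<infinity>)"
        using lim[of 0] by (simp add: ereal_tendsto_simps)
      show "(((\<lambda>x. - (?h 0 x) / \<zeta>) \<circ> real_of_ereal) \<longlongrightarrow> - (?h 0 0) / \<zeta>) (at_right 0)"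
        using lim0[of 0] unfolding zero_ereal_def by (simp add: ereal_tendsto_simps)
    qed (auto intro!: continuous_intros simp: \<zeta>)
    then show ?case by (simp add: open_eq)
  next
    case (Suc k)
    \<comment> \<open>\<open>?f\<close> is the derivative of
      \<open>- (?h (Suc k) x) / \<zeta>\<close>, which vanishes at both ends; that its integral is
      zero is the recursion from \<open>k\<close> to \<open>Suc k\<close>.\<close>
    let ?f = "\<lambda>x. ?h (Suc k) x - of_nat (Suc k) / \<zeta> * ?h k x"
    have si: "set_integrable lborel {0<..} ?f"
      by (intro set_integral_diff set_integrable_mult_right int')
    have "(LBINT x=0..\<infinity>. ?f x) = 0 - (- (?h (Suc k) 0) / \<zeta>)"
    proof (rule interval_integral_FTC_integrable[where F="\<lambda>x. - (?h (Suc k) x) / \<zeta>"])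
      show "((\<lambda>x. - (?h (Suc k) x) / \<zeta>) has_vector_derivative ?f x) (at x)" for x
        by (rule has_vector_derivative_real_field)
          (use \<zeta> in \<open>auto intro!: derivative_eq_intros simp: divide_simps\<close>, simp add: algebra_simps, cases k, auto)
      show "set_integrable lborel (einterval 0 \<infinity>) ?f" using si by (simp add: zero_ereal_def)
      show "(((\<lambda>x. - (?h (Suc k) x) / \<zeta>) \<circ> real_of_ereal) \<longlongrightarrow> 0) (at_left \<infinity>)"
        using lim[of "Suc k"] by (simp add: ereal_tendsto_simps)
      show "(((\<lambda>x. - (?h (Suc k) x) / \<zeta>) \<circ> real_of_ereal) \<longlongrightarrow> - (?h (Suc k) 0) / \<zeta>) (at_right 0)"
        using lim0[of "Suc k"] unfolding zero_ereal_def by (simp add: ereal_tendsto_simps)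
    qed (auto intro!: continuous_intros simp: \<zeta>)
    then have "(LBINT x:{0..}. ?f x) = 0" by (simp add: open_eq)
    moreover have "(LBINT x:{0..}. ?f x) = (LBINT x:{0..}. ?h (Suc k) x) - of_nat (Suc k) / \<zeta> * (LBINT x:{0..}. ?h k x)"
      by (subst set_integral_diff(2)[OF int[of "Suc k"] set_integrable_mult_right[OF int[of k]]])
        (simp only: set_integral_mult_right)
    ultimately have "(LBINT x:{0..}. ?h (Suc k) x) = of_nat (Suc k) / \<zeta> * (fact k / \<zeta> ^ Suc k)"
      using Suc by simp
    then show ?case by simp
  qed
  then show "(LBINT x:{0..}. ?h k x) = fact k / \<zeta> ^ Suc k" .
qed

text \<open>Termwise integration is justified by absolute convergence: the norms integrate to
  \<open>cmod ((deriv ^^ k) f 0) / Re \<zeta> ^ Suc k\<close>, summable for every positive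
  \<open>Re \<zeta>\<close> because of the zero exponential type.\<close>

lemma laplace_eq_borel_series:
  assumes f: "zero_exp_type f" and \<zeta>: "Re \<zeta> > 0"
  shows "laplace f \<zeta> = borel_series f (1 / \<zeta>) / \<zeta>"
proof -
  let ?a = "\<lambda>k. (deriv ^^ k) f 0"
  let ?h = "\<lambda>k x. of_real x ^ k * exp (- \<zeta> * of_real x)"
  let ?F = "\<lambda>k x. indicator {0..} x *\<^sub>R (?a k / fact k * ?h k x)"
  have int: "integrable lborel (?F k)" for k
    using set_integrable_mult_right[OF integral_power_exp(1)[OF \<zeta>, of k], of "?a k / fact k"]
    by (simp add: set_integrable_def)
  have nz: "\<zeta> \<noteq> 0" using \<zeta> by auto
  have norm_int: "(LINT x|lborel. norm (?F k x)) = cmod (?a k) * (1 / Re \<zeta>) ^ k / Re \<zeta>" for k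
  proof -
    have "(LINT x|lborel. norm (?F k x)) = (LINT x|lborel. cmod (?a k) / fact k * (indicator {0..} x *\<^sub>R (x ^ k * exp (- (Re \<zeta> * x)))))"
      by (intro Bochner_Integration.integral_cong) (auto simp: norm_mult norm_divide norm_power split: split_indicator)
    also have "\<dots> = cmod (?a k) / fact k * (LBINT x:{0..}. x ^ k * exp (- (Re \<zeta> * x)))"
      by (simp add: set_lebesgue_integral_def)
    also have "(LBINT x:{0..}. x ^ k * exp (- (Re \<zeta> * x))) = fact k / Re \<zeta> ^ Suc k"
    proof -
      have "complex_of_real (LBINT x:{0..}. x ^ k * exp (- (Re \<zeta> * x))) =
          (LBINT x:{0..}. complex_of_real (x ^ k * exp (- (Re \<zeta> * x))))"
        by (rule set_integral_complex_of_real[symmetric])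
      also have "\<dots> = (LBINT x:{0..}. of_real x ^ k * exp (- of_real (Re \<zeta>) * of_real x))"
        by (simp add: exp_of_real[symmetric])
      also have "\<dots> = fact k / of_real (Re \<zeta>) ^ Suc k"
        by (rule integral_power_exp) (use \<zeta> in simp)
      also have "\<dots> = complex_of_real (fact k / Re \<zeta> ^ Suc k)" by simp
      finally show ?thesis unfolding of_real_eq_iff .
    qed
    finally show ?thesis by (simp add: power_divide mult.commute)
  qed
  have sm: "summable (\<lambda>k. LINT x|lborel. norm (?F k x))"
    unfolding norm_int using \<zeta> by (intro summable_divide zero_exp_type_summable f) auto
  have ae: "AE x in lborel. summable (\<lambda>k. norm (?F k x))"
  proof (rule AE_I2)
    fix x :: real
    show "summable (\<lambda>k. norm (?F k x))"
    proof (rule summable_comparison_test)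
      show "summable (\<lambda>k. exp (- (Re \<zeta> * x)) * (cmod (?a k) * \<bar>x\<bar> ^ k))"
        by (intro summable_mult zero_exp_type_summable f) auto
      have "1 / fact k \<le> (1::real)" for k by simp
      then have "norm (norm (?F k x)) \<le> exp (- (Re \<zeta> * x)) * (cmod (?a k) * \<bar>x\<bar> ^ k)" for k
        using mult_left_mono[of "1 / fact k" 1 "cmod (?a k) * (\<bar>x\<bar> ^ k * exp (- (Re \<zeta> * x)))"]
        by (auto simp: norm_mult norm_divide norm_power mult_ac split: split_indicator)
      then show "\<exists>N. \<forall>k\<ge>N. norm (norm (?F k x)) \<le> exp (- (Re \<zeta> * x)) * (cmod (?a k) * \<bar>x\<bar> ^ k)" by blast
    qed
  qed
  have "(\<Sum>k. ?F k x) = indicator {0..} x *\<^sub>R (f (of_real x) * exp (- \<zeta> * of_real x))" for x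
  proof -
    have "(\<lambda>k. indicator {0..} x *\<^sub>R (?a k / fact k * of_real x ^ k * exp (- \<zeta> * of_real x))) sums
        (indicator {0..} x *\<^sub>R (f (of_real x) * exp (- \<zeta> * of_real x)))"
      by (intro sums_scaleR_right sums_mult2 taylor_sums f)
    then show ?thesis by (simp add: sums_iff mult.assoc)
  qed
  then have "laplace f \<zeta> = (LINT x|lborel. (\<Sum>k. ?F k x))"
    by (simp add: laplace_def set_lebesgue_integral_def)
  also have "\<dots> = (\<Sum>k. LINT x|lborel. ?F k x)"
    by (rule integral_suminf[OF int ae sm])
  also have "(\<lambda>k. LINT x|lborel. ?F k x) = (\<lambda>k. ?a k * (1 / \<zeta>) ^ k / \<zeta>)"
  proof
    fix k
    have "(LINT x|lborel. ?F k x) = ?a k / fact k * (LBINT x:{0..}. ?h k x)"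
      by (simp add: set_lebesgue_integral_def flip: integral_mult_right_zero)
    then show "(LINT x|lborel. ?F k x) = ?a k * (1 / \<zeta>) ^ k / \<zeta>"
      unfolding integral_power_exp(2)[OF \<zeta>] by (simp add: power_divide mult.commute)
  qed
  also have "(\<Sum>k. ?a k * (1 / \<zeta>) ^ k / \<zeta>) = borel_series f (1 / \<zeta>) / \<zeta>"
    using sums_divide[OF borel_series_sums[OF f, of "1 / \<zeta>"], of \<zeta>] by (simp add: sums_iff)
  finally show ?thesis .
qed

text \<open>The Borel series meets the three conditions of the choice operator, so the chosen
  function meets them too, and the identity theorem on the connected punctured plane makes the two
  agree away from 0.\<close>

lemma laplace_ext_eq:
  assumes f: "zero_exp_type f" and "\<zeta> \<noteq> 0"
  shows "laplace_ext f \<zeta> = borel_series f (1 / \<zeta>) / \<zeta>"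
proof -
  let ?G = "\<lambda>\<zeta>. borel_series f (1 / \<zeta>) / \<zeta>"
  let ?Q = "\<lambda>g. g holomorphic_on - {0} \<and>
     (\<forall>\<zeta>. Re \<zeta> > 0 \<longrightarrow> g \<zeta> = laplace f \<zeta>) \<and> (g \<longlongrightarrow> 0) at_infinity"
  have holG: "?G holomorphic_on - {0}"
  proof -
    have "(borel_series f \<circ> (\<lambda>\<zeta>. 1 / \<zeta>)) holomorphic_on - {0}"
      by (rule holomorphic_on_compose) (auto intro!: holomorphic_intros holomorphic_borel_series f)
    then show ?thesis by (auto simp: o_def intro!: holomorphic_intros)
  qed
  have "?Q ?G"
  proof (intro conjI allI impI holG)
    fix \<zeta> assume "Re \<zeta> > 0"
    then show "?G \<zeta> = laplace f \<zeta>" using laplace_eq_borel_series[OF f] by simp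
  next
    have "isCont (borel_series f) 0"
      using holomorphic_on_imp_continuous_on[OF holomorphic_borel_series[OF f, of UNIV]]
      by (simp add: continuous_on_eq_continuous_at)
    then have "((\<lambda>\<zeta>. borel_series f (inverse \<zeta>) * inverse \<zeta>) \<longlongrightarrow> borel_series f 0 * 0) at_infinity"
      by (intro tendsto_mult tendsto_inverse_0 isCont_tendsto_compose[of 0 "borel_series f"])
    then show "(?G \<longlongrightarrow> 0) at_infinity" by (simp add: divide_inverse)
  qed
  then have L: "?Q (laplace_ext f)"
    unfolding laplace_ext_def by (rule someI[where P="?Q"])
  show ?thesis
  proof (rule analytic_continuation_open[of "{\<zeta>. Re \<zeta> > 0}" "- {0}" "laplace_ext f" ?G])
    show "open {\<zeta>. 0 < Re \<zeta>}" by (rule open_halfspace_Re_gt)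
    show "{\<zeta>. 0 < Re \<zeta>} \<noteq> {}" by (auto intro: exI[of _ 1])
    show "connected (- {0::complex})" by (rule connected_punctured_universe) simp
    show "laplace_ext f z = ?G z" if "z \<in> {\<zeta>. 0 < Re \<zeta>}" for z
      using L laplace_eq_borel_series[OF f] that by simp
  qed (use L holG assms in auto)
qed

text \<open>The function is rotated rather than the contour: with \<open>u = s / \<zeta>\<close> the
  transform of \<open>f (u * z)\<close> at the positive point \<open>s\<close> has the same modulus
  as the continuation at \<zeta>, and at \<open>s\<close> the defining integral is
  available.\<close>

lemma laplace_ext_bound:
  assumes f: "zero_exp_type f" and bound: "\<And>z. cmod (f z) \<le> B (cmod z)"
    and "cmod \<zeta> = s" "s > 0" and int: "set_integrable lborel {0..} (\<lambda>x. B x * exp (- (s * x)))"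
  shows "cmod (laplace_ext f \<zeta>) \<le> (LBINT x:{0..}. B x * exp (- (s * x)))"
proof -
  define u where "u = of_real s / \<zeta>"
  have \<zeta>: "\<zeta> \<noteq> 0" using assms by auto
  have u: "cmod u = 1" using assms by (simp add: u_def norm_divide)
  let ?g = "\<lambda>z. f (u * z)"
  have g: "zero_exp_type ?g" by (rule zero_exp_type_scale[OF f u])
  have "(deriv ^^ k) ?g 0 = u ^ k * (deriv ^^ k) f 0" for k
    using higher_deriv_compose_linear[of f UNIV UNIV 0 u k] zero_exp_type_holomorphic[OF f] by simp
  then have "borel_series ?g (1 / of_real s) = borel_series f (1 / \<zeta>)"
    using assms(4) \<zeta> by (simp add: borel_series_def u_def power_divide power_mult_distrib)
  then have "cmod (laplace_ext f \<zeta>) = cmod (laplace ?g (of_real s))"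
    using laplace_ext_eq[OF f \<zeta>] laplace_eq_borel_series[OF g, of "of_real s"] assms
    by (simp add: norm_divide)
  also have "\<dots> \<le> (LINT x|lborel. norm (indicator {0..} x *\<^sub>R (?g (of_real x) * exp (- of_real s * of_real x))))"
    unfolding laplace_def set_lebesgue_integral_def by (rule integral_norm_bound)
  also have "\<dots> \<le> (LINT x|lborel. indicator {0..} x *\<^sub>R (B x * exp (- (s * x))))"
  proof (rule integral_mono')
    show "integrable lborel (\<lambda>x. indicator {0..} x *\<^sub>R (B x * exp (- (s * x))))"
      using int by (simp add: set_integrable_def)
    show *: "norm (indicator {0..} x *\<^sub>R (?g (of_real x) * exp (- of_real s * of_real x)))
      \<le> indicator {0..} x *\<^sub>R (B x * exp (- (s * x)))" for x
      using bound[of "u * of_real x"] u by (auto simp: norm_mult split: split_indicator)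
    show "0 \<le> indicator {0..} x *\<^sub>R (B x * exp (- (s * x)))" for x
      by (rule order_trans[OF norm_ge_zero *])
  qed
  finally show ?thesis by (simp add: set_lebesgue_integral_def)
qed

text \<open>The inversion is done on coefficients instead of by a contour integral: the bound for
  \<open>borel_series\<close> on the circle of radius \<open>1 / s\<close> bounds all derivatives of
  \<open>f\<close> at 0 by Cauchy, and the Taylor series then sums to an exponential.\<close>

lemma laplace_ext_inversion_bound:
  assumes f: "zero_exp_type f" and s: "s > 0" and M: "\<And>\<zeta>. cmod \<zeta> = s \<Longrightarrow> cmod (laplace_ext f \<zeta>) \<le> M"
  shows "cmod (f z) \<le> M * s * exp (s * cmod z)"
proof -
  have E: "cmod (borel_series f w) \<le> M * s" if "cmod w = 1 / s" for w
  proof -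
    have w: "w \<noteq> 0" using that s by auto
    have "cmod (1 / w) = s" using that s by (simp add: norm_divide)
    then have "cmod (laplace_ext f (1 / w)) \<le> M" by (rule M)
    then have "cmod (borel_series f w * w) \<le> M" using laplace_ext_eq[OF f, of "1 / w"] w by simp
    then show ?thesis using that s by (simp add: norm_mult field_simps)
  qed
  have a: "cmod ((deriv ^^ k) f 0) \<le> M * s * s ^ k" for k
  proof -
    have "cmod ((deriv ^^ k) (borel_series f) 0) \<le> fact k * (M * s) / (1 / s) ^ k"
      by (rule Cauchy_inequality)
        (use s E in \<open>auto intro!: holomorphic_borel_series f holomorphic_on_imp_continuous_on simp: norm_minus_commute\<close>)
    then have "fact k * cmod ((deriv ^^ k) f 0) \<le> fact k * (M * s * s ^ k)"
      using s by (simp add: higher_deriv_borel_series[OF f] norm_mult power_divide)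
    then show ?thesis by simp
  qed
  have "(\<lambda>k. M * s * ((s * cmod z) ^ k /\<^sub>R fact k)) sums (M * s * exp (s * cmod z))"
    by (intro sums_mult exp_converges)
  moreover have "norm ((deriv ^^ k) f 0 / fact k * z ^ k) \<le> M * s * ((s * cmod z) ^ k /\<^sub>R fact k)" for k
  proof -
    have "norm ((deriv ^^ k) f 0 / fact k * z ^ k) = cmod ((deriv ^^ k) f 0) * (cmod z ^ k / fact k)"
      by (simp add: norm_mult norm_divide norm_power)
    also have "\<dots> \<le> M * s * s ^ k * (cmod z ^ k / fact k)"
      by (intro mult_right_mono a) auto
    finally show ?thesis by (simp add: power_mult_distrib divide_inverse mult_ac)
  qed
  ultimately show ?thesis by (intro norm_sums_le[OF taylor_sums[OF f, of z]])
qed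

section \<open>Growth of functions in the weighted space\<close>

text \<open>Made for quotients by the outer weight, which are holomorphic only inside the
  half-plane: just the modulus has to extend continuously to the boundary, as
  \<open>m\<close>.\<close>

lemma maximum_modulus_continuous:
  assumes K: "compact K" and U: "open U" "connected U" "closure U \<subseteq> K"
    and F: "F holomorphic_on U" and m: "continuous_on K m" "\<And>z. z \<in> U \<Longrightarrow> m z = cmod (F z)"
    and B: "\<And>z. z \<in> K - U \<Longrightarrow> m z \<le> B" and z: "z \<in> U"
  shows "m z \<le> B"
proof -
  have UK: "U \<subseteq> K" using U(3) closure_subset by blast
  have "\<exists>x\<in>K. \<forall>y\<in>K. m y \<le> m x"
    by (rule continuous_attains_sup) (use K m z UK in auto)
  then obtain w where w: "w \<in> K" "\<And>y. y \<in> K \<Longrightarrow> m y \<le> m w" by blast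
  show ?thesis
  proof (cases "w \<in> U")
    case False
    then have "m w \<le> B" using B w(1) by blast
    moreover have "m z \<le> m w" using w(2) z UK by blast
    ultimately show ?thesis by linarith
  next
    case True
    \<comment> \<open>An interior maximum makes \<open>F\<close> constant; the bounded set
      \<open>U\<close> has a boundary point, to which the value carries over by continuity.\<close>
    have "F constant_on U"
    proof (rule maximum_modulus_principle[OF F U(1,2) U(1) order_refl True])
      show "cmod (F x) \<le> cmod (F w)" if "x \<in> U" for x
        using w(2)[of x] m(2)[OF that] m(2)[OF True] UK that by auto
    qed
    then have c: "m x = m z" if "x \<in> U" for x
      using that z m(2) by (auto simp: constant_on_def)
    have "bounded U" using K UK bounded_subset compact_imp_bounded by blast
    then have "U \<noteq> UNIV" by auto
    then have "frontier U \<noteq> {}" using z frontier_eq_empty[of U] by auto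
    then obtain v where v: "v \<in> closure U" "v \<notin> U"
      using U(1) by (auto simp: frontier_def interior_open)
    have "m v = m z"
      by (rule continuous_constant_on_closure[of U m]) (use m(1) U(3) c v continuous_on_subset in blast)+
    then show ?thesis using B[of v] v U(3) by auto
  qed
qed

context log_weight
begin

text \<open>A Phragmen-Lindelof argument for a bounded quotient whose modulus is at most 1 on the
  line; \<open>UHP\<close> is applied to \<open>f\<close> and to its conjugate reflection.\<close>

lemma B_space_growth:
  assumes f: "f \<in> B_space \<phi>" "B_norm \<phi> f \<le> 1"
  shows "cmod (f z) \<le> exp (H z)"
proof -
  have hol: "f holomorphic_on UNIV" using f by (simp add: B_space_def)
  have contf: "continuous_on A f" for A
    using holomorphic_on_imp_continuous_on[OF hol] continuous_on_subset by blast
  have UHP: "cmod (h z) \<le> exp (H z)"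
    if hh: "\<And>A. continuous_on A h" "(\<lambda>z. h z / outer_weight \<phi> z) \<in> H_infinity"
      and bd: "\<And>t. cmod (h (of_real t)) \<le> exp (\<phi> t)" and z: "Im z > 0" for h z
  proof -
    define m where "m = (\<lambda>z. cmod (h z) * exp (- H z))"
    have contm: "continuous_on A m" for A
      unfolding m_def by (intro continuous_intros hh(1) continuous_H)
    have m_real: "m z \<le> 1" if "Im z = 0" for z
    proof -
      have "z = of_real (Re z)" using that by (simp add: complex_eq_iff)
      then show ?thesis using bd[of "Re z"] unfolding m_def by (metis H_of_real exp_minus_inverse exp_ge_zero mult.commute mult_left_mono)
    qed
    have m_eq: "m z = cmod (h z / outer_weight \<phi> z)" if "Im z > 0" for z
      using cmod_outer_weight[OF that] by (simp add: m_def norm_divide exp_minus field_simps)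
    obtain M where M: "\<And>z. Im z > 0 \<Longrightarrow> m z \<le> M" "M > 0"
    proof -
      have "bounded ((\<lambda>z. h z / outer_weight \<phi> z) ` upper_half_plane)" using hh(2) by (simp add: H_infinity_def)
      then obtain M where "M > 0" "\<And>z. z \<in> upper_half_plane \<Longrightarrow> cmod (h z / outer_weight \<phi> z) \<le> M"
        by (auto simp: bounded_pos)
      then show ?thesis using that[of M] m_eq by (auto simp: upper_half_plane_def)
    qed
    have m0: "m z \<ge> 0" for z by (simp add: m_def)
    \<comment> \<open>Division by \<open>z + \<i>\<close>, of modulus at least 1 on the line, beats
      the bound \<open>M ^ n\<close> on large arcs. The resulting bound does not depend on
      \<open>n\<close>, so letting \<open>n\<close> grow forces \<open>m z \<le> 1\<close>.\<close>
    have pw: "m z ^ n \<le> cmod (z + \<i>)" for n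
    proof -
      define R where "R = max (cmod z + 1) (M ^ n + 1)"
      have R: "cmod z < R" "M ^ n \<le> R - 1" "R > 1" using M(2) by (auto simp: R_def less_max_iff_disj)
      let ?U = "ball 0 R \<inter> {z. Im z > 0}" and ?K = "cball 0 R \<inter> {z. Im z \<ge> 0}"
      let ?F = "\<lambda>z. (h z / outer_weight \<phi> z) ^ n / (z + \<i>)"
      let ?m = "\<lambda>z. m z ^ n / cmod (z + \<i>)"
      have nz: "z + \<i> \<noteq> 0" if "Im z \<ge> 0" for z using that by (auto simp: complex_eq_iff)
      have "?m z \<le> 1"
      proof (rule maximum_modulus_continuous[where U="?U" and K="?K" and F="?F" and m="?m"])
        show "compact ?K" by (intro compact_Int_closed compact_cball closed_halfspace_Im_ge)
        show "open ?U" by (intro open_Int open_ball open_halfspace_Im_gt)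
        show "connected ?U" by (intro convex_connected convex_Int convex_ball convex_halfspace_Im_gt)
        show "closure ?U \<subseteq> ?K"
          by (rule closure_minimal) (auto intro!: closed_Int closed_halfspace_Im_ge)
        show "?F holomorphic_on ?U"
        proof -
          have "(\<lambda>z. h z / outer_weight \<phi> z) holomorphic_on ?U"
            by (rule holomorphic_on_subset[of _ upper_half_plane])
              (use hh(2) in \<open>auto simp: H_infinity_def upper_half_plane_def\<close>)
          moreover have "(\<lambda>z. g z ^ n / (z + \<i>)) holomorphic_on ?U" if "g holomorphic_on ?U" for g
            by (intro holomorphic_intros that) (use nz in auto)
          ultimately show ?thesis by blast
        qed
        show "continuous_on ?K ?m"
          by (intro continuous_intros contm) (use nz in auto)
        show "?m z = cmod (?F z)" if "z \<in> ?U" for z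
          using that m_eq by (simp add: norm_divide norm_power)
        show "z \<in> ?U" using R z by simp
        show "?m z \<le> 1" if "z \<in> ?K - ?U" for z
        proof (cases "Im z = 0")
          case True
          have "m z ^ n \<le> 1" by (intro power_le_one m0 m_real True)
          moreover have "1 \<le> cmod (z + \<i>)" using abs_Im_le_cmod[of "z + \<i>"] True by simp
          ultimately have "m z ^ n \<le> cmod (z + \<i>)" by linarith
          then show ?thesis using nz[of z] True by simp
        next
          case False
          then have zR: "Im z > 0" "cmod z = R" using that by auto
          have "m z ^ n \<le> M ^ n" by (intro power_mono M m0 zR)
          also have "\<dots> \<le> cmod (z + \<i>)" using R norm_diff_triangle_ineq[of z 0 "-\<i>" 0] zR norm_triangle_ineq4[of "z + \<i>" \<i>] by simp
          finally show ?thesis using nz[of z] zR by simp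
        qed
      qed
      then show ?thesis using nz[of z] z by (simp add: divide_le_eq)
    qed
    have "m z \<le> 1"
    proof (rule ccontr)
      assume "\<not> m z \<le> 1"
      then obtain n where "cmod (z + \<i>) < m z ^ n" using real_arch_pow[of "m z"] by auto
      then show False using pw[of n] by simp
    qed
    then show ?thesis by (simp add: m_def exp_minus field_simps)
  qed
  \<comment> \<open>The real supremum in \<open>B_norm\<close> dominates its terms only once they
    are known to be bounded; a bound is obtained from \<open>H_infinity\<close> by approaching the
    line from above.\<close>
  have ub: "cmod (f (of_real t)) \<le> exp (\<phi> t)" for t
  proof -
    have "bounded ((\<lambda>z. f z / outer_weight \<phi> z) ` upper_half_plane)" using f by (simp add: B_space_def H_infinity_def)
    then obtain M where M: "\<And>z. z \<in> upper_half_plane \<Longrightarrow> cmod (f z / outer_weight \<phi> z) \<le> M"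
      by (auto simp: bounded_pos)
    have M': "cmod (f (of_real t)) / boundary_modulus \<phi> t \<le> M" for t
    proof -
      let ?z = "\<lambda>n. Complex t (inverse (real (Suc n)))"
      have lim: "?z \<longlonglongrightarrow> of_real t"
      proof -
        have "?z \<longlonglongrightarrow> of_real t + \<i> * of_real 0"
          unfolding Complex_eq by (intro tendsto_intros LIMSEQ_inverse_real_of_nat)
        then show ?thesis by simp
      qed
      have lim1: "(\<lambda>n. cmod (f (?z n)) * exp (- H (?z n))) \<longlonglongrightarrow> cmod (f (of_real t)) * exp (- H (of_real t))"
      proof -
        have cH: "isCont H w" and cf: "isCont f w" for w
          using contf[of UNIV] continuous_H[of UNIV] by (simp_all add: continuous_on_eq_continuous_at)
        have "(\<lambda>n. H (?z n)) \<longlonglongrightarrow> H (of_real t)" "(\<lambda>n. f (?z n)) \<longlonglongrightarrow> f (of_real t)"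
          by (rule isCont_tendsto_compose[OF cH lim], rule isCont_tendsto_compose[OF cf lim])
        then show ?thesis by (intro tendsto_intros)
      qed
      have le: "cmod (f (?z n)) * exp (- H (?z n)) \<le> M" for n
      proof -
        have "Im (?z n) > 0" by simp
        from M[of "?z n"] cmod_outer_weight[OF this] show ?thesis
          by (simp add: upper_half_plane_def norm_divide exp_minus field_simps)
      qed
      have "cmod (f (of_real t)) * exp (- H (of_real t)) \<le> M"
        by (rule LIMSEQ_le_const2[OF lim1]) (use le in blast)
      then show ?thesis by (simp add: boundary_modulus_eq exp_minus divide_inverse)
    qed
    have "cmod (f (of_real t)) / boundary_modulus \<phi> t \<le> B_norm \<phi> f"
      unfolding B_norm_def by (rule cSUP_upper) (auto intro!: bdd_aboveI2 M')
    also have "\<dots> \<le> 1" by fact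
    finally show ?thesis by (simp add: boundary_modulus_eq divide_le_eq)
  qed
  consider "Im z > 0" | "Im z < 0" | "Im z = 0" by linarith
  then show ?thesis
  proof cases
    case 1
    then show ?thesis using UHP[of f z] contf f ub by (simp add: B_space_def)
  next
    case 2
    have "continuous_on A (\<lambda>z. cnj (f (cnj z)))" for A
      by (intro continuous_intros continuous_on_compose2[OF contf[of UNIV]]) auto
    then have "cmod (cnj (f (cnj (cnj z)))) \<le> exp (H (cnj z))"
      using UHP[of "\<lambda>z. cnj (f (cnj z))" "cnj z"] 2 f ub by (simp add: B_space_def)
    then show ?thesis by (simp add: H_cnj)
  next
    case 3
    then have "z = of_real (Re z)" by (simp add: complex_eq_iff)
    then show ?thesis using ub[of "Re z"] H_of_real by metis
  qed
qed

lemma H_le_P_norm: "H z \<le> P (cmod z)"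
proof -
  consider "Im z > 0" | "Im z < 0" | "Im z = 0" by linarith
  then show ?thesis
  proof cases
    case 1
    then show ?thesis by (rule H_le_P)
  next
    case 2
    then show ?thesis using H_le_P[of "cnj z"] by (simp add: H_cnj)
  next
    case 3
    \<comment> \<open>\<open>H_le_P\<close> needs a point above the line, so real points are reached
      by continuity.\<close>
    let ?z = "\<lambda>n. z + \<i> * of_real (inverse (real (Suc n)))"
    have lim: "?z \<longlonglongrightarrow> z"
    proof -
      have "?z \<longlonglongrightarrow> z + \<i> * of_real 0"
        by (intro tendsto_intros LIMSEQ_inverse_real_of_nat)
      then show ?thesis by simp
    qed
    have c: "isCont H w" for w using continuous_H[of UNIV] by (simp add: continuous_on_eq_continuous_at)
    have 1: "(\<lambda>n. H (?z n)) \<longlonglongrightarrow> H z" by (rule isCont_tendsto_compose[OF c lim])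
    have 2: "(\<lambda>n. P (cmod (?z n))) \<longlonglongrightarrow> P (cmod z)"
      by (rule isCont_tendsto_compose[OF c]) (intro tendsto_intros lim)
    show ?thesis
      by (rule LIMSEQ_le[OF 1 2]) (use 3 in \<open>auto intro!: H_le_P\<close>)
  qed
qed

lemma B_space_bound:
  assumes "f \<in> B_space \<phi>" "B_norm \<phi> f \<le> 1"
  shows "cmod (f z) \<le> exp (P (cmod z))"
  using B_space_growth[OF assms, of z] H_le_P_norm[of z] by (meson exp_le_cancel_iff order_trans)

lemma B_space_zero_exp_type:
  assumes "f \<in> B_space \<phi>" "B_norm \<phi> f \<le> 1"
  shows "zero_exp_type f"
  unfolding zero_exp_type_def
proof (intro conjI allI impI)
  show "f holomorphic_on UNIV" using assms by (simp add: B_space_def)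
  fix \<epsilon> :: real assume "\<epsilon> > 0"
  then obtain C where C: "\<And>y. y \<ge> 0 \<Longrightarrow> P y \<le> \<epsilon> * y + C" using P_linear_bound by blast
  have "cmod (f z) \<le> exp C * exp (\<epsilon> * cmod z)" for z
  proof -
    have "cmod (f z) \<le> exp (P (cmod z))" by (rule B_space_bound[OF assms])
    also have "\<dots> \<le> exp (C + \<epsilon> * cmod z)" using C[of "cmod z"] by simp
    finally show ?thesis by (simp add: exp_add)
  qed
  then show "\<exists>C. \<forall>z. cmod (f z) \<le> C * exp (\<epsilon> * cmod z)" by blast
qed

end

section \<open>Extremal polynomials\<close>

lemma root_product_mean:
  assumes "\<forall>w\<in>set ws. Im w < 0" "0 < y"
  shows "integrable cauchy_measure (\<lambda>u. ln (cmod (\<Prod>w\<leftarrow>ws. of_real (x + y * u) - w))) \<and>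
    integral\<^sup>L cauchy_measure (\<lambda>u. ln (cmod (\<Prod>w\<leftarrow>ws. of_real (x + y * u) - w))) =
      ln (cmod (\<Prod>w\<leftarrow>ws. Complex x y - w))"
  using assms(1)
proof (induction ws)
  case (Cons w ws)
  have nz: "z - w \<noteq> 0" "(\<Prod>w\<leftarrow>ws. z - w) \<noteq> 0" if "Im z \<ge> 0" for z
    using Cons.prems that by (auto simp: prod_list_zero_iff)
  have eq: "ln (cmod (\<Prod>w\<leftarrow>w # ws. z - w)) = ln (cmod (z - w)) + ln (cmod (\<Prod>w\<leftarrow>ws. z - w))"
    if "Im z \<ge> 0" for z
    using nz[OF that] by (simp add: norm_mult ln_mult)
  have eq1: "ln (cmod (\<Prod>w\<leftarrow>w # ws. of_real t - w)) = ln (cmod (of_real t - w)) + ln (cmod (\<Prod>w\<leftarrow>ws. of_real t - w))" for t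
    by (rule eq) simp
  have w: "Im w < 0" using Cons.prems by simp
  show ?case
    unfolding eq1 using cauchy_mean_ln_dist[OF w assms(2), of x] Cons assms(2) eq[of "Complex x y"]
    by simp
qed simp

text \<open>A point above the line is at least as far as its mirror image from every point below.
  This supplies the condition on the conjugate reflection in \<open>B_space\<close>.\<close>

lemma root_product_reflect:
  assumes "\<forall>w\<in>set ws. Im w \<le> 0" "Im z \<ge> 0"
  shows "cmod (\<Prod>w\<leftarrow>ws. cnj z - w) \<le> cmod (\<Prod>w\<leftarrow>ws. z - w)"
  using assms(1)
proof (induction ws)
  case (Cons w ws)
  have "(cmod (cnj z - w))\<^sup>2 \<le> (cmod (z - w))\<^sup>2"
    using Cons.prems assms(2) mult_nonneg_nonneg[of "Im z" "- Im w"]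
    unfolding cmod_power2 by (simp add: power2_eq_square algebra_simps)
  then have "cmod (cnj z - w) \<le> cmod (z - w)" by (rule power2_le_imp_le) simp
  then show ?case using Cons by (auto simp: norm_mult intro!: mult_mono)
qed simp

section \<open>Polynomial minorants of \<open>exp \<phi>\<close> and the extremal functions\<close>

context log_weight
begin

text \<open>Since \<open>ln 0 = 0\<close>, the point \<open>t = 0\<close> contributes the value 0 and makes \<open>conj_log\<close> non-negative.\<close>

definition conj_log :: "nat \<Rightarrow> real" where
  "conj_log m = (SUP t\<in>{0..}. real m * ln t - \<phi> t)"

text \<open>Up to the value at 0, \<open>conj_log\<close> is the Legendre conjugate of
  \<open>\<phi> (exp \<tau>)\<close> at integers; it is finite because \<open>\<phi>\<close>
  outgrows every multiple of the logarithm.\<close>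

lemma bdd_above_conj_log: "bdd_above ((\<lambda>t. real m * ln t - \<phi> t) ` {0..})"
proof -
  have "\<forall>\<^sub>F t in at_top. real m \<le> \<phi> t / ln t"
    using filterlim_div_ln by (simp add: filterlim_at_top)
  then obtain T where T: "\<And>t. t \<ge> T \<Longrightarrow> real m \<le> \<phi> t / ln t"
    by (auto simp: eventually_at_top_linorder)
  define T' where "T' = max T 2"
  show ?thesis
  proof (rule bdd_aboveI2)
    fix t :: real assume t: "t \<in> {0..}"
    show "real m * ln t - \<phi> t \<le> real m * ln T'"
    proof (cases "t \<ge> T'")
      case True
      then have "0 < ln t" "real m \<le> \<phi> t / ln t" using T by (auto simp: T'_def)
      then have "real m * ln t - \<phi> t \<le> 0" by (simp add: field_simps)
      also have "\<dots> \<le> real m * ln T'" by (auto simp: T'_def)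
      finally show ?thesis .
    next
      case False
      have "ln t \<le> ln T'"
      proof (cases "t = 0")
        case False
        then show ?thesis using \<open>\<not> t \<ge> T'\<close> t by simp
      qed (simp add: T'_def)
      then have "real m * ln t \<le> real m * ln T'" by (intro mult_left_mono) auto
      then show ?thesis using nonneg[of t] by linarith
    qed
  qed
qed

lemma conj_log_upper: "t \<ge> 0 \<Longrightarrow> real m * ln t - \<phi> t \<le> conj_log m"
  unfolding conj_log_def by (intro cSUP_upper bdd_above_conj_log) auto

lemma conj_log_least: "(\<And>t. t \<ge> 0 \<Longrightarrow> real m * ln t - \<phi> t \<le> K) \<Longrightarrow> conj_log m \<le> K"
  unfolding conj_log_def by (intro cSUP_least) auto

lemma conj_log_nonneg: "0 \<le> conj_log m"
  using conj_log_upper[of 0 m] by simp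

lemma conj_log_0: "conj_log 0 = 0"
  using conj_log_nonneg[of 0] conj_log_least[of 0 0] by simp

text \<open>The denominator telescopes, so that the partial sums stay below \<open>exp \<phi>\<close>, at a polynomial cost.\<close>

definition coef :: "nat \<Rightarrow> real" where
  "coef m = exp (- conj_log (2 * m)) / ((real m + 1) * (real m + 2))"

definition approx_poly :: "nat \<Rightarrow> real \<Rightarrow> real" where
  "approx_poly N x = (\<Sum>m\<le>N. coef m * x ^ (2 * m))"

lemma coef_pos: "coef m > 0"
  by (simp add: coef_def)

lemma approx_poly_le: "approx_poly N x \<le> exp (\<phi> x)"
proof -
  have tele: "(\<Sum>m\<le>N. 1 / ((real m + 1) * (real m + 2))) = 1 - 1 / (real N + 2)"
  proof (induction N)
    case (Suc N)
    have "1 / ((real (Suc N) + 1) * (real (Suc N) + 2)) = 1 / (real N + 2) - 1 / (real (Suc N) + 2)"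
      by (simp add: divide_simps)
    then show ?case unfolding sum.atMost_Suc Suc.IH by simp
  qed simp
  have "coef m * x ^ (2 * m) \<le> exp (\<phi> x) * (1 / ((real m + 1) * (real m + 2)))" for m
  proof -
    have "exp (- conj_log (2 * m)) * x ^ (2 * m) \<le> exp (\<phi> x)"
    proof (cases "x = 0")
      \<comment> \<open>Only \<open>m = 0\<close> contributes, with \<open>0 ^ 0 = 1\<close>; this
        matches \<open>\<phi> 0 = 0\<close> because \<open>conj_log 0 = 0\<close>.\<close>
      case True
      then show ?thesis using conj_log_0 by (cases "m = 0") (auto simp: power_0_left)
    next
      case False
      have "x ^ (2 * m) = \<bar>x\<bar> ^ (2 * m)" by (simp add: power_even_abs)
      also have "\<dots> = exp (real (2 * m) * ln \<bar>x\<bar>)"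
        using False by (subst exp_of_nat_mult) simp
      finally have "exp (- conj_log (2 * m)) * x ^ (2 * m) = exp (real (2 * m) * ln \<bar>x\<bar> - conj_log (2 * m))"
        by (simp add: exp_diff exp_minus field_simps)
      also have "\<dots> \<le> exp (\<phi> x)" using conj_log_upper[of "\<bar>x\<bar>" "2 * m"] by simp
      finally show ?thesis .
    qed
    then show ?thesis unfolding coef_def by (simp add: divide_right_mono)
  qed
  then have "approx_poly N x \<le> (\<Sum>m\<le>N. exp (\<phi> x) * (1 / ((real m + 1) * (real m + 2))))"
    unfolding approx_poly_def by (rule sum_mono)
  also have "\<dots> = exp (\<phi> x) * (1 - 1 / (real N + 2))"
    unfolding tele[symmetric] by (rule sum_distrib_left[symmetric])
  also have "\<dots> \<le> exp (\<phi> x)" by (simp add: mult_left_le)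
  finally show ?thesis .
qed

lemma approx_poly_ge_term: "m \<le> N \<Longrightarrow> coef m * x ^ (2 * m) \<le> approx_poly N x"
  unfolding approx_poly_def
  by (rule member_le_sum) (auto intro!: mult_nonneg_nonneg less_imp_le[OF coef_pos] simp: zero_le_even_power)

lemma approx_poly_ge_half: "1 / 2 \<le> approx_poly N x"
  using approx_poly_ge_term[of 0 N x] by (simp add: coef_def conj_log_0)

text \<open>Concavity is available on the open half-line, so the chord starts at
  \<open>1 / 2\<close> instead of 0; this accounts for the factor 2.\<close>

lemma weight_linear_bound:
  assumes "t \<ge> 1" shows "\<phi> t \<le> 2 * t * \<phi> 1"
proof (cases "t = 1")
  case False
  have conc: "concave_on {0<..} \<phi>" using weight unfolding logarithmic_weight_def by blast
  define a where "a = (1 / 2) / (t - 1 / 2)"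
  have a: "0 \<le> a" "a \<le> 1" "a \<ge> 1 / (2 * t)" using assms by (auto simp: a_def field_simps)
  have "t - 1 / 2 \<noteq> 0" using assms by simp
  then have "a * (t - 1 / 2) = 1 / 2" unfolding a_def by (metis nonzero_eq_divide_eq)
  then have conv: "(1 - a) * (1 / 2) + a * t = 1"
    unfolding right_diff_distrib left_diff_distrib by linarith
  have "(1 - a) * \<phi> (1 / 2) + a * \<phi> t \<le> \<phi> ((1 - a) *\<^sub>R (1 / 2) + a *\<^sub>R t)"
    by (rule concave_onD[OF conc a(1,2)]) (use assms in auto)
  then have "(1 - a) * \<phi> (1 / 2) + a * \<phi> t \<le> \<phi> 1"
    unfolding real_scaleR_def conv .
  moreover have "1 / (2 * t) * \<phi> t \<le> a * \<phi> t" by (intro mult_right_mono a) simp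
  moreover have "0 \<le> (1 - a) * \<phi> (1 / 2)" using a by simp
  ultimately have "1 / (2 * t) * \<phi> t \<le> \<phi> 1" by linarith
  then show ?thesis using assms by (simp add: field_simps)
qed simp

text \<open>A supporting line of the convex function \<open>\<phi> (exp \<tau>)\<close> at
  \<open>ln t0\<close>; its slope will select the dominant term of the sum.\<close>

lemma log_tangent:
  assumes "t0 > 0"
  obtains \<nu> where "\<And>t. t > 0 \<Longrightarrow> \<phi> t0 + \<nu> * (ln t - ln t0) \<le> \<phi> t"
proof -
  have "\<phi> differentiable (at t0)"
    using weight assms unfolding logarithmic_weight_def C2_on_pos_def differentiable_on_def
    by (metis at_within_open greaterThan_iff open_greaterThan)
  then obtain D where D: "(\<phi> has_real_derivative D) (at t0)"
    using real_differentiable_def by blast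
  have "((\<lambda>\<tau>. \<phi> (exp \<tau>)) has_real_derivative D * t0) (at (ln t0))"
    using DERIV_chain2[of \<phi> D exp "ln t0" t0 UNIV] D assms DERIV_exp[of "ln t0"] by simp
  note tangent = convex_on_imp_above_tangent[OF convex_exp connected_UNIV _ _ this]
  have "D * t0 * (ln t - ln t0) \<le> \<phi> t - \<phi> t0" if "t > 0" for t
    using tangent[of "ln t"] that assms by simp
  then show ?thesis by (intro that[of "D * t0"]) (simp add: algebra_simps)
qed

lemma ln_2_le_loss: "ln 2 \<le> ln (3 * \<phi> 1 + 2)"
proof -
  have "2 \<le> 3 * \<phi> 1 + 2" using nonneg[of 1] by linarith
  then show ?thesis by (subst ln_le_cancel_iff) linarith+
qed

text \<open>\<open>\<phi> 1\<close> pays for the points below 1 in the conjugate, the logarithm for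
  the denominator of \<open>coef\<close>.\<close>

definition loss_const :: real where
  "loss_const = \<phi> 1 + 2 * ln (3 * \<phi> 1 + 2)"

text \<open>A single term suffices. The exponent \<nu> of the tangent at \<open>t0\<close> would be
  the ideal one; rounding it down to the even integer \<open>2 * m\<close> costs
  \<open>2 * ln t0\<close>, the denominator of \<open>coef\<close> as much again apart from
  constants, and \<open>4 * ln t0 \<le> 2 * ln (1 + t\<^sup>2)\<close>.\<close>

lemma approx_poly_lower_outer:
  assumes "\<bar>t\<bar> \<ge> 1" "real N \<ge> 3 * \<phi> 1 * \<bar>t\<bar>"
  shows "\<phi> t - 2 * ln (1 + t\<^sup>2) - loss_const \<le> ln (approx_poly N t)"
proof -
  define t0 where "t0 = \<bar>t\<bar>"
  have t0: "t0 \<ge> 1" using assms by (simp add: t0_def)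
  obtain \<nu> where \<nu>: "\<And>t. t > 0 \<Longrightarrow> \<phi> t0 + \<nu> * (ln t - ln t0) \<le> \<phi> t"
    using log_tangent[of t0] t0 by auto
  \<comment> \<open>Comparing the tangent with \<open>\<phi>\<close> one logarithmic unit to the
    left and to the right bounds the slope: \<open>0 \<le> \<nu>\<close> by monotonicity,
    \<open>\<nu> \<le> 6 * t0 * \<phi> 1\<close> by the linear bound at
    \<open>3 * t0\<close>.\<close>
  have "\<phi> t0 + \<nu> * (- 1) \<le> \<phi> (t0 / exp 1)"
    using \<nu>[of "t0 / exp 1"] t0 by (simp add: ln_div)
  moreover have "\<phi> (t0 / exp 1) \<le> \<phi> t0"
    using t0 exp_ge_add_one_self[of 1] by (intro mono_abs) (simp add: field_simps mult_left_mono)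
  ultimately have \<nu>0: "\<nu> \<ge> 0" by simp
  have e3: "exp 1 \<le> (3::real)" using exp_le by simp
  have "\<phi> t0 + \<nu> \<le> \<phi> (t0 * exp 1)"
    using \<nu>[of "t0 * exp 1"] t0 by (simp add: ln_mult)
  then have "\<nu> \<le> \<phi> (t0 * exp 1)" using nonneg[of t0] by linarith
  also have "\<dots> \<le> \<phi> (t0 * 3)"
    using t0 e3 by (intro mono_abs) (simp add: mult_left_mono)
  also have "\<dots> \<le> 6 * t0 * \<phi> 1" using weight_linear_bound[of "t0 * 3"] t0 by simp
  finally have \<nu>1: "\<nu> \<le> 6 * t0 * \<phi> 1" .
  define m where "m = nat \<lfloor>\<nu> / 2\<rfloor>"
  have m: "2 * real m \<le> \<nu>" "\<nu> < 2 * real m + 2"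
    using \<nu>0 by (simp_all add: m_def, linarith+)
  have mN: "m \<le> N"
  proof -
    have "2 * real m \<le> 2 * (3 * \<phi> 1 * \<bar>t\<bar>)"
      using order_trans[OF m(1) \<nu>1] by (simp add: t0_def mult_ac)
    then show ?thesis using assms(2) by linarith
  qed
  have lt0: "0 \<le> ln t0" using t0 by simp
  have tan1: "\<phi> t0 \<le> \<phi> 1 + \<nu> * ln t0" using \<nu>[of 1] by simp
  \<comment> \<open>The first three terms bound the conjugate for \<open>x \<ge> 1\<close>; adding
    \<open>\<phi> 1\<close> keeps \<open>K\<close> non-negative, which covers
    \<open>x < 1\<close>.\<close>
  define K where "K = 2 * real m * ln t0 - \<phi> t0 + 2 * ln t0 + \<phi> 1"
  have K0: "K \<ge> 0"
    using tan1 mult_right_mono[OF less_imp_le[OF m(2)] lt0] by (simp add: K_def algebra_simps)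
  have conj: "conj_log (2 * m) \<le> K"
  proof (rule conj_log_least)
    fix x :: real assume x: "x \<ge> 0"
    consider "x = 0" | "0 < x" "x < 1" | "x \<ge> 1" using x by linarith
    then show "real (2 * m) * ln x - \<phi> x \<le> K"
    proof cases
      case 1 then show ?thesis using K0 by simp
    next
      case 2
      then have "real (2 * m) * ln x \<le> 0" by (intro mult_nonneg_nonpos) auto
      then show ?thesis using K0 nonneg[of x] by linarith
    next
      case 3
      have "(\<nu> - 2 * real m) * (ln t0 - ln x) \<le> 2 * ln t0"
      proof (cases "ln x \<le> ln t0")
        case True
        have "(\<nu> - 2 * real m) * (ln t0 - ln x) \<le> 2 * (ln t0 - ln x)"
          using m(2) True by (intro mult_right_mono) auto
        also have "\<dots> \<le> 2 * ln t0" using 3 by simp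
        finally show ?thesis .
      next
        case False
        then have "(\<nu> - 2 * real m) * (ln t0 - ln x) \<le> 0"
          using m(1) by (intro mult_nonneg_nonpos) auto
        then show ?thesis using lt0 by linarith
      qed
      moreover have "\<phi> t0 + \<nu> * (ln x - ln t0) \<le> \<phi> x" using \<nu> 3 by simp
      ultimately show ?thesis using nonneg[of 1] by (simp add: K_def algebra_simps del: nonneg)
    qed
  qed
  have "real m + 2 \<le> (3 * \<phi> 1 + 2) * t0"
    using m(1) \<nu>1 t0 by (simp add: algebra_simps)
  then have den: "(real m + 1) * (real m + 2) \<le> ((3 * \<phi> 1 + 2) * t0) * ((3 * \<phi> 1 + 2) * t0)"
    by (intro mult_mono) auto
  have "ln ((real m + 1) * (real m + 2)) \<le> ln (((3 * \<phi> 1 + 2) * t0) * ((3 * \<phi> 1 + 2) * t0))"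
    using den by (subst ln_le_cancel_iff) (use t0 nonneg[of 1] in \<open>auto intro!: mult_pos_pos add_nonneg_pos\<close>)
  also have "\<dots> = 2 * ln (3 * \<phi> 1 + 2) + 2 * ln t0"
  proof -
    have "ln (a * t0 * (a * t0)) = 2 * ln a + 2 * ln t0" if "a > 0" for a
      using that t0 by (simp add: ln_mult)
    moreover have "3 * \<phi> 1 + 2 > 0" using nonneg[of 1] by linarith
    ultimately show ?thesis by blast
  qed
  finally have lnden: "ln ((real m + 1) * (real m + 2)) \<le> 2 * ln (3 * \<phi> 1 + 2) + 2 * ln t0" .
  have "ln (coef m * t ^ (2 * m)) = - conj_log (2 * m) - ln ((real m + 1) * (real m + 2)) + 2 * real m * ln t0"
  proof -
    have "t ^ (2 * m) = t0 ^ (2 * m)" by (simp add: t0_def power_even_abs)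
    then show ?thesis using t0 unfolding coef_def
      by (simp add: ln_mult ln_div ln_realpow)
  qed
  moreover have "coef m * t ^ (2 * m) > 0"
    using assms(1) coef_pos[of m] by (intro mult_pos_pos zero_less_power_eq[THEN iffD2]) auto
  then have "ln (coef m * t ^ (2 * m)) \<le> ln (approx_poly N t)"
    using approx_poly_ge_term[OF mN, of t] by simp
  ultimately have "- K - (2 * ln (3 * \<phi> 1 + 2) + 2 * ln t0) + 2 * real m * ln t0 \<le> ln (approx_poly N t)"
    using conj lnden by linarith
  then have 1: "\<phi> t0 - 4 * ln t0 - loss_const \<le> ln (approx_poly N t)"
    by (simp add: K_def loss_const_def)
  have "2 * ln t0 = ln (t0\<^sup>2)" using ln_realpow[of t0 2] t0 by simp
  also have "t0\<^sup>2 = t\<^sup>2" by (simp add: t0_def)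
  also have "ln (t\<^sup>2) \<le> ln (1 + t\<^sup>2)" using t0 by (subst ln_le_cancel_iff) (auto simp: t0_def add_pos_nonneg)
  finally show ?thesis using 1 by (simp add: t0_def)
qed

lemma approx_poly_lower:
  assumes "\<bar>t\<bar> \<le> T" "real N \<ge> 3 * \<phi> 1 * T"
  shows "\<phi> t - 2 * ln (1 + t\<^sup>2) - loss_const \<le> ln (approx_poly N t)"
proof (cases "\<bar>t\<bar> \<ge> 1")
  case True
  have "3 * \<phi> 1 * \<bar>t\<bar> \<le> 3 * \<phi> 1 * T" using assms(1) by (intro mult_left_mono) auto
  then show ?thesis using approx_poly_lower_outer[OF True, of N] assms(2) by linarith
next
  case False
  \<comment> \<open>Near the origin the constant term \<open>1 / 2\<close> of the sum is
    enough.\<close>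
  have "\<phi> t \<le> \<phi> 1" using False by (intro mono_abs) auto
  moreover have "ln 2 \<le> ln (3 * \<phi> 1 + 2)" by (rule ln_2_le_loss)
  moreover have "0 \<le> ln (1 + t\<^sup>2)" by simp
  moreover have "ln (1 / 2) \<le> ln (approx_poly N t)"
    using approx_poly_ge_half[of N t] by (subst ln_le_cancel_iff) auto
  moreover have "ln (1 / 2 :: real) = - ln 2" "(0::real) < ln 2" by (simp_all add: ln_div)
  ultimately show ?thesis unfolding loss_const_def by linarith
qed

text \<open>The lower bound \<open>1 / 2\<close> for \<open>approx_poly\<close> excludes real roots,
  so after conjugation all roots lie strictly below the line, as \<open>cauchy_mean_ln_dist\<close>
  requires.\<close>

lemma exists_root_product:
  obtains c ws where "c \<noteq> 0" "\<forall>w\<in>set ws. Im w < 0"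
    "\<forall>x. approx_poly N x = cmod (c * (\<Prod>w\<leftarrow>ws. of_real x - w))"
proof -
  define p :: "complex poly" where "p = (\<Sum>m\<le>N. monom (of_real (coef m)) (2 * m))"
  have p: "poly p (of_real x) = of_real (approx_poly N x)" for x
    by (simp add: p_def approx_poly_def poly_sum poly_monom)
  have nz: "poly p (of_real x) \<noteq> 0" for x
    unfolding p using approx_poly_ge_half[of N x] by (simp del: of_real_eq_0_iff add: of_real_eq_0_iff)
  then have p0: "p \<noteq> 0" by auto
  obtain rs where rs: "mset rs = proots p" using ex_mset by blast
  have "p = smult (lead_coeff p) (\<Prod>x\<in>#proots p. [:-x, 1:])"
    by (rule complex_poly_decompose_multiset [symmetric])
  also have "(\<Prod>x\<in>#proots p. [:-x, 1:]) = (\<Prod>x\<leftarrow>rs. [:-x, 1:])"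
    by (subst prod_mset_prod_list [symmetric]) (simp add: rs)
  finally have "poly p z = lead_coeff p * poly (\<Prod>x\<leftarrow>rs. [:-x, 1:]) z" for z
    by (metis poly_smult)
  moreover have "poly (\<Prod>x\<leftarrow>xs. [:-x, 1:]) z = (\<Prod>w\<leftarrow>xs. z - w)" for xs :: "complex list" and z
    by (induction xs) (auto simp: algebra_simps)
  ultimately have fac: "poly p z = lead_coeff p * (\<Prod>w\<leftarrow>rs. z - w)" for z by simp
  define r where "r = (\<lambda>w. if Im w < 0 then w else cnj w)"
  have "Im w \<noteq> 0" if "w \<in> set rs" for w
  proof
    assume "Im w = 0"
    then have "w = of_real (Re w)" by (simp add: complex_eq_iff)
    moreover have "poly p w = 0" using that fac[of w] by (auto simp: prod_list_zero_iff)
    ultimately show False using nz by metis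
  qed
  then have neg: "\<forall>w\<in>set (map r rs). Im w < 0" by (force simp: r_def)
  have "cmod (\<Prod>w\<leftarrow>map r xs. of_real x - w) = cmod (\<Prod>w\<leftarrow>xs. of_real x - w)" for xs x
  proof (induction xs)
    case (Cons w xs)
    have "cmod (of_real x - cnj w) = cmod (of_real x - w)"
      by (metis complex_cnj_complex_of_real complex_cnj_diff complex_mod_cnj)
    then show ?case using Cons by (simp add: norm_mult r_def)
  qed simp
  then have "cmod (lead_coeff p * (\<Prod>w\<leftarrow>map r rs. of_real x - w)) = cmod (poly p (of_real x))" for x
    unfolding fac by (simp add: norm_mult)
  also have "cmod (poly p (of_real x)) = approx_poly N x" for x
    unfolding p using approx_poly_ge_half[of N x] by simp
  finally show ?thesis using that[of "lead_coeff p" "map r rs"] neg p0 by simp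
qed

lemma exists_extremal:
  assumes y: "y > 0"
  obtains f where "f \<in> B_space \<phi>" "B_norm \<phi> f \<le> 1"
    "P y - 4 * ln (1 + y) - loss_const - 1 \<le> ln (cmod (f (\<i> * of_real y)))" "f (\<i> * of_real y) \<noteq> 0"
proof -
  \<comment> \<open>The minorant works on a bounded interval, so \<open>\<phi>\<close> is first
    truncated to \<open>{- n..n}\<close> with a loss below 1 in the Poisson mean at
    \<open>\<i> * y\<close>; \<open>n\<close> then fixes the degree \<open>N\<close>.\<close>
  have "(\<lambda>n. LINT u|cauchy_measure. indicator {-real n..real n} (y * u) * \<phi> (y * u)) \<longlonglongrightarrow> P y"
    unfolding P_eq
  proof (rule integral_dominated_convergence[where w="\<lambda>u. \<phi> (y * u)"])
    show "integrable cauchy_measure (\<lambda>u. \<phi> (y * u))" using integrable_affine[of 0 y] by simp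
    show "AE u in cauchy_measure. (\<lambda>n. indicator {-real n..real n} (y * u) * \<phi> (y * u)) \<longlonglongrightarrow> \<phi> (y * u)"
    proof (rule AE_I2)
      fix u
      have "\<forall>\<^sub>F n in sequentially. indicator {-real n..real n} (y * u) * \<phi> (y * u) = \<phi> (y * u)"
        using eventually_ge_at_top[of "nat \<lceil>\<bar>y * u\<bar>\<rceil>"]
        by eventually_elim (auto simp: indicator_def abs_le_iff nat_ceiling_le_eq)
      then show "(\<lambda>n. indicator {-real n..real n} (y * u) * \<phi> (y * u)) \<longlonglongrightarrow> \<phi> (y * u)"
        by (rule tendsto_eventually)
    qed
  qed (auto simp: indicator_def)
  then have "\<forall>\<^sub>F n in sequentially. P y - 1 < (LINT u|cauchy_measure. indicator {-real n..real n} (y * u) * \<phi> (y * u))"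
    by (rule order_tendstoD) simp
  then obtain n where n: "P y - 1 < (LINT u|cauchy_measure. indicator {-real n..real n} (y * u) * \<phi> (y * u))"
    by (auto simp: eventually_sequentially)
  define N where "N = nat \<lceil>3 * \<phi> 1 * real n\<rceil>"
  have N: "real N \<ge> 3 * \<phi> 1 * real n" by (simp add: N_def of_nat_ceiling)
  obtain c ws where c: "c \<noteq> 0" and ws: "\<forall>w\<in>set ws. Im w < 0"
    and S': "\<forall>x. approx_poly N x = cmod (c * (\<Prod>w\<leftarrow>ws. of_real x - w))"
    by (rule exists_root_product[of N])
  have S: "approx_poly N x = cmod (c * (\<Prod>w\<leftarrow>ws. of_real x - w))" for x using S' by blast
  define f where "f = (\<lambda>z. c * (\<Prod>w\<leftarrow>ws. z - w))"
  have fnz: "f z \<noteq> 0" if "Im z \<ge> 0" for z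
    using c ws that by (auto simp: f_def prod_list_zero_iff)
  have holp: "(\<lambda>z. \<Prod>w\<leftarrow>xs. z - w) holomorphic_on A" for xs :: "complex list" and A
    by (induction xs) (auto intro!: holomorphic_intros)
  then have hol: "f holomorphic_on A" for A
    unfolding f_def by (intro holomorphic_intros)
  have "cnj (\<Prod>w\<leftarrow>xs. cnj z - w) = (\<Prod>w\<leftarrow>map cnj xs. z - w)" for xs z
    by (induction xs) auto
  then have "(\<lambda>z. cnj (f (cnj z))) = (\<lambda>z. cnj c * (\<Prod>w\<leftarrow>map cnj ws. z - w))"
    by (simp add: f_def)
  then have hol_star: "(\<lambda>z. cnj (f (cnj z))) holomorphic_on A" for A
    using holp[of "map cnj ws" A] by (simp only:) (intro holomorphic_intros)
  have mean: "integrable cauchy_measure (\<lambda>u. ln (approx_poly N (x + b * u))) \<and>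
     integral\<^sup>L cauchy_measure (\<lambda>u. ln (approx_poly N (x + b * u))) = ln (cmod (f (Complex x b)))"
    if b: "b > 0" for x b
  proof -
    have pnz: "(\<Prod>w\<leftarrow>ws. z - w) \<noteq> 0" if "Im z \<ge> 0" for z
      using ws that by (auto simp: prod_list_zero_iff)
    have "ln (approx_poly N t) = ln (cmod c) + ln (cmod (\<Prod>w\<leftarrow>ws. of_real t - w))" for t
      unfolding S using c pnz[of "of_real t"] by (simp add: norm_mult ln_mult)
    moreover have "ln (cmod (f (Complex x b))) = ln (cmod c) + ln (cmod (\<Prod>w\<leftarrow>ws. Complex x b - w))"
      unfolding f_def using c pnz[of "Complex x b"] b by (simp add: norm_mult ln_mult)
    ultimately show ?thesis using root_product_mean[OF ws b, of x] by simp
  qed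
  \<comment> \<open>The Poisson formula is an equality for \<open>ln (cmod (f z))\<close>, so the
    pointwise bound on the line passes to the half-plane.\<close>
  have growth: "cmod (f z) \<le> exp (H z)" if z: "Im z > 0" for z
  proof -
    have "ln (cmod (f z)) = integral\<^sup>L cauchy_measure (\<lambda>u. ln (approx_poly N (Re z + Im z * u)))"
      using mean[OF z, of "Re z"] by simp
    also have "\<dots> \<le> H z"
      unfolding H_def
    proof (intro integral_mono integrable_affine)
      show "ln (approx_poly N (Re z + Im z * u)) \<le> \<phi> (Re z + Im z * u)" for u
      proof -
        let ?t = "Re z + Im z * u"
        have "ln (approx_poly N ?t) \<le> ln (exp (\<phi> ?t))"
          using approx_poly_le[of N ?t] approx_poly_ge_half[of N ?t] by (subst ln_le_cancel_iff) auto
        then show ?thesis by simp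
      qed
    qed (use mean[OF z] in simp)
    finally show ?thesis using fnz[of z] z by (metis exp_le_cancel_iff exp_ln less_imp_le zero_less_norm_iff)
  qed
  have star: "cmod (f (cnj z)) \<le> cmod (f z)" if "Im z > 0" for z
    unfolding f_def norm_mult using ws that
    by (intro mult_left_mono root_product_reflect) auto
  have "f \<in> B_space \<phi>"
    unfolding B_space_def H_infinity_def
  proof (safe intro!: hol)
    show "(\<lambda>z. f z / outer_weight \<phi> z) holomorphic_on upper_half_plane"
      by (intro holomorphic_intros hol holomorphic_outer_weight) auto
    show "(\<lambda>z. cnj (f (cnj z)) / outer_weight \<phi> z) holomorphic_on upper_half_plane"
      by (intro holomorphic_on_divide hol_star holomorphic_outer_weight) auto
    show "bounded ((\<lambda>z. f z / outer_weight \<phi> z) ` upper_half_plane)"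
      unfolding bounded_iff using growth
      by (intro exI[of _ 1]) (auto simp: upper_half_plane_def norm_divide cmod_outer_weight)
    show "bounded ((\<lambda>z. cnj (f (cnj z)) / outer_weight \<phi> z) ` upper_half_plane)"
      unfolding bounded_iff using growth star
      by (intro exI[of _ 1]) (auto simp: upper_half_plane_def norm_divide cmod_outer_weight intro: order_trans)
  qed
  moreover have "B_norm \<phi> f \<le> 1"
    unfolding B_norm_def
  proof (rule cSUP_least)
    show "cmod (f (of_real t)) / boundary_modulus \<phi> t \<le> 1" for t
      using S[of t] approx_poly_le[of N t] by (simp add: boundary_modulus_eq f_def)
  qed simp
  moreover have "P y - 4 * ln (1 + y) - loss_const - 1 \<le> ln (cmod (f (\<i> * of_real y)))"
  proof -
    have i0: "Complex 0 y = \<i> * of_real y" by (simp add: complex_eq_iff)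
    \<comment> \<open>\<open>ln (1 + t\<^sup>2) / 2\<close> is \<open>ln (cmod (t + \<i>))\<close>,
      a potential with zero \<open>- \<i>\<close>; its mean at \<open>\<i> * y\<close> is therefore
      \<open>ln (1 + y)\<close>.\<close>
    have lni: "ln (cmod (of_real (0 + y * u) - (- \<i>))) = ln (1 + (y * u)\<^sup>2) / 2" for u
      using one_plus_square_pos[of "y * u"] by (simp add: cmod_def ln_sqrt add.commute)
    have "cmod (Complex 0 y - (- \<i>)) = cmod (of_real (1 + y) * \<i>)"
      by (simp add: i0 algebra_simps)
    also have "\<dots> = 1 + y" using y by (simp only: norm_mult norm_of_real) simp
    finally have cm: "cmod (Complex 0 y - (- \<i>)) = 1 + y" .
    have L: "integrable cauchy_measure (\<lambda>u. ln (1 + (y * u)\<^sup>2) / 2)"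
       "integral\<^sup>L cauchy_measure (\<lambda>u. ln (1 + (y * u)\<^sup>2) / 2) = ln (1 + y)"
    proof -
      have neg: "Im (- \<i>) < 0" by simp
      show "integrable cauchy_measure (\<lambda>u. ln (1 + (y * u)\<^sup>2) / 2)"
        using cauchy_mean_ln_dist(1)[OF neg y, of 0] by (simp only: lni)
      show "integral\<^sup>L cauchy_measure (\<lambda>u. ln (1 + (y * u)\<^sup>2) / 2) = ln (1 + y)"
        using cauchy_mean_ln_dist(2)[OF neg y, of 0] by (simp only: lni cm)
    qed
    have I: "integrable cauchy_measure (\<lambda>u. indicator {-real n..real n} (y * u) * \<phi> (y * u))"
      by (rule Bochner_Integration.integrable_bound[of _ "\<lambda>u. \<phi> (y * u)"])
        (use integrable_affine[of 0 y] in \<open>auto simp: indicator_def\<close>)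
    have split: "integrable cauchy_measure (\<lambda>u. A u - 4 * B u - d)"
        "integral\<^sup>L cauchy_measure (\<lambda>u. A u - 4 * B u - d) =
          integral\<^sup>L cauchy_measure A - 4 * integral\<^sup>L cauchy_measure B - d"
      if "integrable cauchy_measure A" "integrable cauchy_measure B" for A B :: "real \<Rightarrow> real" and d
      using that by simp_all
    have "P y - 4 * ln (1 + y) - loss_const - 1 \<le>
      integral\<^sup>L cauchy_measure (\<lambda>u. indicator {-real n..real n} (y * u) * \<phi> (y * u) - 4 * (ln (1 + (y * u)\<^sup>2) / 2) - loss_const)"
      using L(2) n unfolding split(2)[OF I L(1)] by linarith
    also have "\<dots> \<le> integral\<^sup>L cauchy_measure (\<lambda>u. ln (approx_poly N (0 + y * u)))"
    proof (rule integral_mono)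
      show "integrable cauchy_measure (\<lambda>u. indicator {-real n..real n} (y * u) * \<phi> (y * u) - 4 * (ln (1 + (y * u)\<^sup>2) / 2) - loss_const)"
        by (rule split(1)[OF I L(1)])
      show "integrable cauchy_measure (\<lambda>u. ln (approx_poly N (0 + y * u)))" using mean[OF y, of 0] unfolding i0 by simp
      fix u
      show "indicator {-real n..real n} (y * u) * \<phi> (y * u) - 4 * (ln (1 + (y * u)\<^sup>2) / 2) - loss_const
         \<le> ln (approx_poly N (0 + y * u))"
      proof (cases "\<bar>y * u\<bar> \<le> real n")
        case True
        then show ?thesis using approx_poly_lower[OF True N] by (simp add: indicator_def abs_le_iff)
      next
        case False
        \<comment> \<open>Outside the window the truncated weight is 0, so
          \<open>approx_poly \<ge> 1 / 2\<close> is enough, and \<open>loss_const\<close> covers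
          \<open>ln 2\<close>.\<close>
        have "ln (1 / 2) \<le> ln (approx_poly N (y * u))"
          using approx_poly_ge_half[of N "y * u"] by (subst ln_le_cancel_iff) auto
        moreover have "0 \<le> ln (1 + (y * u)\<^sup>2)" by simp
        moreover have "ln (1 / 2 :: real) = - ln 2" "(0::real) < ln 2" by (simp_all add: ln_div)
        moreover have "indicator {-real n..real n} (y * u) * \<phi> (y * u) = 0"
          using False by (auto simp: indicator_def)
        ultimately show ?thesis using nonneg[of 1] ln_2_le_loss
          unfolding loss_const_def add_0_left by linarith
      qed
    qed
    also have "\<dots> = ln (cmod (f (\<i> * of_real y)))" using mean[OF y, of 0] unfolding i0 by simp
    finally show ?thesis .
  qed
  moreover have "f (\<i> * of_real y) \<noteq> 0" by (rule fnz) (use y in simp)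
  ultimately show ?thesis by (rule that)
qed

end

section \<open>Comparison with the Legendre transform\<close>

context log_weight
begin

text \<open>Up to \<open>4 * R\<close> the exponent is at most \<open>legendre_Q \<phi> s\<close>,
  and beyond it decays at the rate of \<open>P_tail\<close>; the two summands are the integrals of
  these majorants.\<close>

lemma exp_P_integral_bound:
  assumes s: "0 < s" and R: "R > 0" "p (2 * R) \<le> s" and \<phi>R: "\<phi> R > 0"
  shows "set_integrable lborel {0..} (\<lambda>x. exp (P x) * exp (- (s * x)))"
    and "(LBINT x:{0..}. exp (P x) * exp (- (s * x))) \<le>
      4 * R * exp (legendre_Q \<phi> s) + 400 * pi * R / (3 * \<phi> R)"
proof -
  define \<kappa> where "\<kappa> = 3 / (400 * pi) * \<phi> R / R"
  have \<kappa>: "\<kappa> > 0" using R \<phi>R by (simp add: \<kappa>_def)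
  let ?Q = "legendre_Q \<phi> s"
  let ?f = "\<lambda>x. indicator {0..} x *\<^sub>R (exp (P x) * exp (- (s * x)))"
  let ?g = "\<lambda>x. exp ?Q * indicator {0..4 * R} x + indicator {0..} x *\<^sub>R exp (- (\<kappa> * x))"
  have le: "?f x \<le> ?g x" for x
  proof -
    \<comment> \<open>The Legendre supremum runs over positive \<open>y\<close>, so
      \<open>x = 0\<close> is separate; there the second majorant is 1, like the integrand.\<close>
    consider "x < 0" | "x = 0" | "0 < x" "x \<le> 4 * R" | "x > 4 * R" by linarith
    then show ?thesis
    proof cases
      case 2
      have "H 0 = 0" using H_of_real[of 0] by simp
      then show ?thesis using 2 R by simp
    next
      case 3
      have "exp (P x) * exp (- (s * x)) = exp (P x - x * s)" by (simp add: exp_diff exp_minus field_simps)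
      also have "\<dots> \<le> exp ?Q" using legendre_Q_upper[OF s 3(1)] by simp
      finally show ?thesis using 3 by (simp add: add_increasing2)
    next
      case 4
      have "exp (P x) * exp (- (s * x)) = exp (P x - s * x)" by (simp add: exp_diff exp_minus field_simps)
      also have "\<dots> \<le> exp (- (\<kappa> * x))" using P_tail[OF R, of x] 4 by (simp add: \<kappa>_def)
      finally show ?thesis using 4 R by simp
    qed simp
  qed
  have exp_int: "set_integrable lborel {0..} (\<lambda>x. exp (- (\<kappa> * x)))"
    using integrable_power_exp[OF \<kappa>, of 0] by simp
  have "(LBINT x:{0..}. exp (- (\<kappa> * x))) = integral {0..} (\<lambda>x. exp (- \<kappa> * x))"
    using set_borel_integral_eq_integral(2)[OF exp_int] by simp
  also have "\<dots> = 1 / \<kappa>"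
    using has_integral_exp_minus_to_infinity[OF \<kappa>, of 0] by (simp add: integral_unique)
  finally have exp_val: "(LBINT x:{0..}. exp (- (\<kappa> * x))) = 400 * pi * R / (3 * \<phi> R)"
    by (simp add: \<kappa>_def)
  have ind_int: "integrable lborel (\<lambda>x. exp ?Q * indicator {0..4 * R} x)"
    by (intro integrable_mult_right integrable_real_indicator) (use R in \<open>auto simp: emeasure_lborel_Icc_eq\<close>)
  have g_int: "integrable lborel ?g"
    using ind_int exp_int by (simp add: set_integrable_def)
  have [measurable]: "(\<lambda>x. P x) \<in> borel_measurable borel"
    by (intro borel_measurable_continuous_onI continuous_on_compose2[OF continuous_H[of UNIV]] continuous_intros) auto
  have f_int: "integrable lborel ?f"
    by (rule lborel_integrable_bound[OF g_int]) (use le in \<open>auto simp: abs_mult indicator_def\<close>)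
  then show "set_integrable lborel {0..} (\<lambda>x. exp (P x) * exp (- (s * x)))" by (simp add: set_integrable_def)
  have "(LINT x|lborel. ?f x) \<le> (LINT x|lborel. ?g x)"
    by (rule integral_mono[OF f_int g_int le])
  also have "\<dots> = (LINT x|lborel. exp ?Q * indicator {0..4 * R} x) + (LBINT x:{0..}. exp (- (\<kappa> * x)))"
    using ind_int exp_int by (simp add: set_integrable_def set_lebesgue_integral_def)
  also have "(LINT x|lborel. exp ?Q * indicator {0..4 * R} x) = 4 * R * exp ?Q"
    using R by simp
  finally show "(LBINT x:{0..}. exp (P x) * exp (- (s * x))) \<le>
      4 * R * exp ?Q + 400 * pi * R / (3 * \<phi> R)"
    unfolding exp_val unfolding set_lebesgue_integral_def .
qed

lemma laplace_ext_le:
  assumes "0 < s" "R > 0" "p (2 * R) \<le> s" "\<phi> R > 0"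
    and f: "f \<in> B_space \<phi>" "B_norm \<phi> f \<le> 1" and "cmod \<zeta> = s"
  shows "cmod (laplace_ext f \<zeta>) \<le> 4 * R * exp (legendre_Q \<phi> s) + 400 * pi * R / (3 * \<phi> R)"
proof -
  have "cmod (laplace_ext f \<zeta>) \<le> (LBINT x:{0..}. exp (P x) * exp (- (s * x)))"
    by (rule laplace_ext_bound[where B="\<lambda>x. exp (P x)"])
      (use assms in \<open>auto intro!: B_space_zero_exp_type B_space_bound exp_P_integral_bound(1)[OF assms(1-4)]\<close>)
  also have "\<dots> \<le> 4 * R * exp (legendre_Q \<phi> s) + 400 * pi * R / (3 * \<phi> R)"
    by (rule exp_P_integral_bound) fact+
  finally show ?thesis .
qed

lemma lambda_W_upper:
  assumes "0 < s" "R > 0" "p (2 * R) \<le> s" "\<phi> R > 0"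
  shows "lambda_W \<phi> s \<le> 4 * R * exp (legendre_Q \<phi> s) + 400 * pi * R / (3 * \<phi> R)"
  unfolding lambda_W_def
proof (rule cSUP_least)
  \<comment> \<open>A real supremum over the empty set would obey no bound, so a member is exhibited
    first.\<close>
  show "{f \<in> B_space \<phi>. B_norm \<phi> f \<le> 1} \<noteq> {}" using exists_extremal[of 1] by force
  fix f assume "f \<in> {f \<in> B_space \<phi>. B_norm \<phi> f \<le> 1}"
  then show "(SUP \<zeta>\<in>sphere 0 s. cmod (laplace_ext f \<zeta>)) \<le> 4 * R * exp (legendre_Q \<phi> s) + 400 * pi * R / (3 * \<phi> R)"
    using assms by (intro cSUP_least laplace_ext_le) auto
qed

text \<open>A real supremum dominates its members only if the family is bounded, so the upper
  estimate enters the lower one as well; hence the hypotheses on \<open>R\<close>.\<close>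

lemma laplace_ext_le_lambda_W:
  assumes R: "0 < s" "R > 0" "p (2 * R) \<le> s" "\<phi> R > 0"
    and f: "f \<in> B_space \<phi>" "B_norm \<phi> f \<le> 1" and \<zeta>: "cmod \<zeta> = s"
  shows "cmod (laplace_ext f \<zeta>) \<le> lambda_W \<phi> s"
proof -
  let ?U = "4 * R * exp (legendre_Q \<phi> s) + 400 * pi * R / (3 * \<phi> R)"
  have "cmod (laplace_ext f \<zeta>) \<le> (SUP \<zeta>\<in>sphere 0 s. cmod (laplace_ext f \<zeta>))"
  proof (rule cSUP_upper)
    show "bdd_above ((\<lambda>\<zeta>. cmod (laplace_ext f \<zeta>)) ` sphere 0 s)"
      by (rule bdd_aboveI2, rule laplace_ext_le[OF R f]) simp
  qed (use \<zeta> in simp)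
  also have "\<dots> \<le> lambda_W \<phi> s"
    unfolding lambda_W_def
  proof (rule cSUP_upper)
    show "bdd_above ((\<lambda>f. SUP \<zeta>\<in>sphere 0 s. cmod (laplace_ext f \<zeta>)) ` {f \<in> B_space \<phi>. B_norm \<phi> f \<le> 1})"
    proof (rule bdd_aboveI2)
      fix f assume "f \<in> {f \<in> B_space \<phi>. B_norm \<phi> f \<le> 1}"
      then show "(SUP \<zeta>\<in>sphere 0 s. cmod (laplace_ext f \<zeta>)) \<le> ?U"
        using R by (intro cSUP_least laplace_ext_le) auto
    qed
  qed (use f in auto)
  finally show ?thesis .
qed

text \<open>The inversion bound at \<open>\<i> * y\<close> for the extremal polynomial, in
  logarithms. Its non-vanishing there makes \<open>lambda_W\<close> positive, without which
  \<open>ln\<close> would carry no information.\<close>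

lemma lambda_W_lower:
  assumes R: "0 < s" "R > 0" "p (2 * R) \<le> s" "\<phi> R > 0" and y: "y > 0"
  shows "lambda_W \<phi> s > 0"
    and "P y - s * y - 4 * ln (1 + y) - loss_const - 1 - ln s \<le> ln (lambda_W \<phi> s)"
proof -
  obtain f where f: "f \<in> B_space \<phi>" "B_norm \<phi> f \<le> 1"
    "P y - 4 * ln (1 + y) - loss_const - 1 \<le> ln (cmod (f (\<i> * of_real y)))" "f (\<i> * of_real y) \<noteq> 0"
    using exists_extremal[OF y] by blast
  have le: "cmod (f (\<i> * of_real y)) \<le> lambda_W \<phi> s * s * exp (s * cmod (\<i> * of_real y))"
    by (rule laplace_ext_inversion_bound[OF B_space_zero_exp_type[OF f(1,2)] R(1)])
      (rule laplace_ext_le_lambda_W[OF R f(1,2)])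
  have pos: "0 < cmod (f (\<i> * of_real y))" using f(4) by simp
  have pp: "0 < lambda_W \<phi> s * s * exp (s * cmod (\<i> * of_real y))" by (rule less_le_trans[OF pos le])
  from pp show l: "lambda_W \<phi> s > 0" using R(1) by (simp add: zero_less_mult_iff)
  have "ln (cmod (f (\<i> * of_real y))) \<le> ln (lambda_W \<phi> s * s * exp (s * cmod (\<i> * of_real y)))"
    by (subst ln_le_cancel_iff) (rule pos pp le)+
  also have "\<dots> = ln (lambda_W \<phi> s) + ln s + s * y"
    using l R(1) y by (simp add: ln_mult norm_mult)
  finally show "P y - s * y - 4 * ln (1 + y) - loss_const - 1 - ln s \<le> ln (lambda_W \<phi> s)"
    using f(3) by linarith
qed

section \<open>The two asymptotic estimates\<close>

lemma eventually_weight_large: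
  "\<forall>\<^sub>F t in at_top. K * ln t \<le> \<phi> t"
proof -
  have "\<forall>\<^sub>F t in at_top. K \<le> \<phi> t / ln t"
    using filterlim_div_ln by (simp add: filterlim_at_top)
  then show ?thesis
    using eventually_gt_at_top[of 1] by eventually_elim (simp add: field_simps)
qed

lemma p_pos: "r > 0 \<Longrightarrow> \<phi> (2 * r) > 0 \<Longrightarrow> p r > 0"
proof -
  assume r: "r > 0" "\<phi> (2 * r) > 0"
  have "0 \<le> p (2 * r)" unfolding p_def by (intro divide_nonneg_pos integral_nonneg_AE) auto
  moreover have "0 < 3 / (200 * pi) * (\<phi> (2 * r) / r)" using r by simp
  ultimately show "p r > 0" using p_gap[OF r(1)] by linarith
qed

text \<open>The 9 comes from the lower bound: \<open>4 * ln (1 + y)\<close> costs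
  \<open>8 * ln R\<close>, and one more \<open>ln R\<close> pays for \<open>loss_const\<close> and
  two units, one for the truncation and one for a near-maximiser. The upper bound needs
  \<open>2 * ln R\<close>.\<close>

lemma two_sided_estimate:
  assumes s: "0 < s" "s \<le> 1" and R: "s \<le> p R" "p (2 * R) < s" "R \<ge> 1000"
    and large: "\<phi> R \<ge> 1" "3 / (200 * pi) * \<phi> R \<ge> 1" "ln R \<ge> loss_const + 2"
  shows "\<bar>ln (lambda_W \<phi> s) - legendre_Q \<phi> s\<bar> \<le> 9 * ln R"
proof -
  let ?Q = "legendre_Q \<phi> s"
  have R0: "R > 0" using R by simp
  have R': "0 < s" "R > 0" "p (2 * R) \<le> s" "\<phi> R > 0" using s R large by auto
  have Q1: "?Q \<ge> 1" using legendre_Q_ge[OF s(1) R0 R(1)] large(2) by linarith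
  have lnR: "0 \<le> ln R" using R by simp
  have "lambda_W \<phi> s \<le> 4 * R * exp ?Q + 400 * pi * R / (3 * \<phi> R)"
    by (rule lambda_W_upper[OF R'])
  also have "400 * pi * R / (3 * \<phi> R) \<le> 400 * pi * R / 3 * exp ?Q"
  proof -
    have "400 * pi * R / (3 * \<phi> R) \<le> 400 * pi * R / 3 * 1"
      using R0 large(1) by (simp add: field_simps mult_left_mono)
    also have "\<dots> \<le> 400 * pi * R / 3 * exp ?Q" using R0 Q1 by (intro mult_left_mono) auto
    finally show ?thesis .
  qed
  also have "4 * R * exp ?Q + 400 * pi * R / 3 * exp ?Q = (4 + 400 * pi / 3) * R * exp ?Q"
    by (simp add: algebra_simps)
  also have "\<dots> \<le> R * R * exp ?Q"
  proof -
    have "4 + 400 * pi / 3 \<le> R" using pi_less_4 R(3) by linarith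
    then show ?thesis using R0 by (intro mult_right_mono) auto
  qed
  finally have up: "lambda_W \<phi> s \<le> R * R * exp ?Q" by simp
  have lpos: "lambda_W \<phi> s > 0" by (rule lambda_W_lower(1)[OF R', of 1]) simp
  have "ln (lambda_W \<phi> s) \<le> ln (R * R * exp ?Q)"
    using up lpos by (subst ln_le_cancel_iff) auto
  also have "\<dots> = 2 * ln R + ?Q" using R0 by (simp add: ln_mult)
  finally have upper: "ln (lambda_W \<phi> s) - ?Q \<le> 9 * ln R" using lnR by linarith
  have "?Q - 1 < (SUP y\<in>{0<..}. P y - y * s)" by (simp add: legendre_Q_eq)
  then obtain y where y: "y > 0" "?Q - 1 < P y - y * s"
    by (subst (asm) less_cSUP_iff) (auto intro: bdd_above_legendre[OF s(1)])
  \<comment> \<open>A near-maximiser has a positive value since \<open>?Q \<ge> 1\<close>, whereas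
    past \<open>2 * R\<close> the slope is below \<open>s\<close>.\<close>
  have "y < 2 * R"
  proof (rule ccontr)
    assume "\<not> y < 2 * R"
    then have "p y < s" using p_antimono[of "2 * R" y] R R0 by simp
    then have "P y < y * s" using integrable_p(2)[OF y(1)] y by simp
    then show False using y(2) Q1 by simp
  qed
  then have "1 + y \<le> R * R" using R(3) mult_mono[of 1000 R 1 R] mult_right_mono[of 1000 R R] by linarith
  then have "ln (1 + y) \<le> ln (R * R)" using y by (subst ln_le_cancel_iff) (use R0 in auto)
  then have "ln (1 + y) \<le> 2 * ln R" using R0 by (simp add: ln_mult)
  moreover have "ln s \<le> 0" using s by simp
  moreover have "s * y = y * s" by simp
  ultimately have "?Q - ln (lambda_W \<phi> s) \<le> 9 * ln R"
    using lambda_W_lower(2)[OF R' y(1)] y(2) large(3) by linarith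
  with upper show ?thesis by linarith
qed

text \<open>For \<open>s\<close> below the positive number \<open>p (2 ^ N)\<close> the crossing
  scale is at least \<open>2 ^ N\<close>, so \<open>R\<close> can be forced past any threshold
  \<open>R1\<close>.\<close>

lemma eventually_estimate:
  "\<forall>\<^sub>F s in at_right 0. \<exists>R\<ge>R1. 1 \<le> legendre_Q \<phi> s \<and> 3 / (200 * pi) * \<phi> R \<le> legendre_Q \<phi> s \<and>
     \<bar>ln (lambda_W \<phi> s) - legendre_Q \<phi> s\<bar> \<le> 9 * ln R"
proof -
  define K where "K = max 1 (200 * pi / 3)"
  have "\<forall>\<^sub>F t in at_top. K * ln t \<le> \<phi> t" by (rule eventually_weight_large)
  moreover have "\<forall>\<^sub>F t in at_top. (1::real) \<le> ln t" by real_asymp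
  moreover have "\<forall>\<^sub>F t in at_top. loss_const + 2 \<le> ln t"
    using ln_at_top by (simp add: filterlim_at_top)
  ultimately have "\<forall>\<^sub>F t in at_top. \<phi> t \<ge> 1 \<and> 3 / (200 * pi) * \<phi> t \<ge> 1 \<and> ln t \<ge> loss_const + 2"
  proof eventually_elim
    case (elim t)
    have "K \<ge> 1" by (simp add: K_def)
    then have "K * 1 \<le> K * ln t" using elim by (intro mult_left_mono) auto
    then have "K \<le> \<phi> t" using elim by simp
    then have "1 \<le> \<phi> t" "200 * pi / 3 \<le> \<phi> t" by (simp_all add: K_def)
    then show ?case using elim by (simp add: field_simps)
  qed
  then obtain T where T: "\<And>t. t \<ge> T \<Longrightarrow> \<phi> t \<ge> 1 \<and> 3 / (200 * pi) * \<phi> t \<ge> 1 \<and> ln t \<ge> loss_const + 2"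
    by (auto simp: eventually_at_top_linorder)
  obtain N where N: "max (max T R1) 1000 < 2 ^ N" 
    using real_arch_pow[of 2 "max (max T R1) 1000"] by (auto simp del: max_less_iff_conj)
  have "\<phi> (2 * 2 ^ N) \<ge> 1" using T[of "2 * 2 ^ N"] N by simp
  then have pN: "p (2 ^ N) > 0" by (intro p_pos) auto
  have "\<forall>\<^sub>F s in at_right 0. s < min 1 (p (2 ^ N))"
    by (rule eventually_at_right_field[THEN iffD2]) (use pN in \<open>auto intro!: exI[of _ "min 1 (p (2 ^ N))"]\<close>)
  moreover have "\<forall>\<^sub>F s in at_right 0. (0::real) < s" by (rule eventually_at_right_less)
  ultimately show ?thesis
  proof eventually_elim
    case (elim s)
    then have s: "0 < s" "s \<le> 1" "s \<le> p (2 ^ N)" by auto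
    obtain R where R: "R \<ge> 2 ^ N" "s \<le> p R" "p (2 * R) < s"
      using crossing_scale[OF s(1,3)] by blast
    have RT: "R \<ge> T" "R \<ge> R1" "R \<ge> 1000" using N R(1) by auto
    have Q: "3 / (200 * pi) * \<phi> R \<le> legendre_Q \<phi> s"
      by (rule legendre_Q_ge) (use s R RT in auto)
    moreover have "1 \<le> legendre_Q \<phi> s" using Q T[OF RT(1)] by linarith
    moreover have "\<bar>ln (lambda_W \<phi> s) - legendre_Q \<phi> s\<bar> \<le> 9 * ln R"
      by (rule two_sided_estimate) (use s R RT T[OF RT(1)] in auto)
    ultimately show ?case using RT by blast
  qed
qed

lemma ln_lambda_W_asymp_equiv: "(\<lambda>s. ln (lambda_W \<phi> s)) \<sim>[at_right 0] legendre_Q \<phi>"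
proof (rule asymp_equivI', rule tendstoI)
  fix \<epsilon> :: real assume \<epsilon>: "\<epsilon> > 0"
  define c where "c = 3 / (200 * pi)"
  have c: "c > 0" by (simp add: c_def)
  \<comment> \<open>With 10 instead of 9, the error \<open>9 * ln R\<close> stays strictly below
    \<epsilon> times the Legendre transform.\<close>
  obtain T where T: "\<And>t. t \<ge> T \<Longrightarrow> 10 / (c * \<epsilon>) * ln t \<le> \<phi> t"
    using eventually_weight_large[of "10 / (c * \<epsilon>)"] by (auto simp: eventually_at_top_linorder)
  show "\<forall>\<^sub>F s in at_right 0. dist (ln (lambda_W \<phi> s) / legendre_Q \<phi> s) 1 < \<epsilon>"
    using eventually_estimate[of "max T 2"]
  proof eventually_elim
    case (elim s)
    let ?Q = "legendre_Q \<phi> s"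
    obtain R where R: "R \<ge> T" "R \<ge> 2" "1 \<le> ?Q" "c * \<phi> R \<le> ?Q"
      "\<bar>ln (lambda_W \<phi> s) - ?Q\<bar> \<le> 9 * ln R"
      using elim unfolding c_def by auto
    have lnR: "ln R > 0" using R by simp
    have "10 * ln R \<le> \<epsilon> * (c * \<phi> R)" using T[OF R(1)] c \<epsilon> by (simp add: field_simps)
    also have "\<dots> \<le> \<epsilon> * ?Q" using R \<epsilon> by (intro mult_left_mono) auto
    finally have "9 * ln R < \<epsilon> * ?Q" using lnR by linarith
    then have "\<bar>ln (lambda_W \<phi> s) - ?Q\<bar> < \<epsilon> * ?Q" using R by linarith
    then have "\<bar>ln (lambda_W \<phi> s) - ?Q\<bar> / ?Q < \<epsilon>" using R(3) by (simp add: pos_divide_less_eq)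
    moreover have "dist (ln (lambda_W \<phi> s) / ?Q) 1 = \<bar>ln (lambda_W \<phi> s) - ?Q\<bar> / ?Q"
    proof -
      have "ln (lambda_W \<phi> s) / ?Q - 1 = (ln (lambda_W \<phi> s) - ?Q) / ?Q" using R by (simp add: field_simps)
      then show ?thesis using R by (simp add: dist_real_def)
    qed
    ultimately show ?case by simp
  qed
qed

lemma ln_lambda_W_bigo:
  assumes "Liminf at_top (\<lambda>t. ereal (ln (\<phi> t) / ln t)) > 0"
  shows "(\<lambda>s. ln (lambda_W \<phi> s) - legendre_Q \<phi> s) \<in> O[at_right 0](\<lambda>s. ln (legendre_Q \<phi> s))"
proof -
  obtain \<delta> where \<delta>: "0 < ereal \<delta>" "ereal \<delta> < Liminf at_top (\<lambda>t. ereal (ln (\<phi> t) / ln t))"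
    using ereal_dense2[OF assms] by auto
  have "\<forall>\<^sub>F t in at_top. ereal \<delta> < ereal (ln (\<phi> t) / ln t)"
    using \<delta>(2) by (rule less_LiminfD)
  moreover have "\<forall>\<^sub>F t in at_top. (1::real) < t" by (rule eventually_gt_at_top)
  \<comment> \<open>Half of the exponent \<delta> is given up to absorb the constant
    \<open>ln (3 / (200 * pi))\<close>; this is why the final factor is
    \<open>18 / \<delta>\<close>.\<close>
  moreover have "\<forall>\<^sub>F t in at_top. - 2 * ln (3 / (200 * pi)) / \<delta> \<le> ln t"
    using ln_at_top by (simp add: filterlim_at_top)
  moreover have "\<forall>\<^sub>F t in at_top. 1 * ln t \<le> \<phi> t" by (rule eventually_weight_large)
  ultimately have "\<forall>\<^sub>F t in at_top. t > 1 \<and> \<phi> t > 0 \<and> \<delta> / 2 * ln t \<le> ln (3 / (200 * pi) * \<phi> t)"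
  proof eventually_elim
    case (elim t)
    have d: "\<delta> > 0" using \<delta>(1) by simp
    have lnt: "0 < ln t" using elim by simp
    then have \<phi>t: "\<phi> t > 0" using elim by linarith
    have "\<delta> * ln t \<le> ln (\<phi> t)" using elim(1) lnt by (simp add: field_simps)
    moreover have "- ln (3 / (200 * pi)) \<le> \<delta> / 2 * ln t" using elim(3) d by (simp add: field_simps)
    moreover have "ln (3 / (200 * pi) * \<phi> t) = ln (3 / (200 * pi)) + ln (\<phi> t)"
    proof -
      have "ln (a * b) = ln a + ln b" if "a > 0" "b > 0" for a b :: real using that by (simp add: ln_mult)
      then show ?thesis by this (use \<phi>t in simp_all)
    qed
    moreover have "\<delta> / 2 * ln t = \<delta> * ln t - \<delta> / 2 * ln t" by simp
    ultimately show ?case using elim(2) \<phi>t by linarith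
  qed
  then obtain T where T: "\<And>t. t \<ge> T \<Longrightarrow> t > 1 \<and> \<phi> t > 0 \<and> \<delta> / 2 * ln t \<le> ln (3 / (200 * pi) * \<phi> t)"
    by (auto simp: eventually_at_top_linorder)
  show ?thesis
  proof (rule bigoI[where c="18 / \<delta>"])
    show "\<forall>\<^sub>F s in at_right 0. norm (ln (lambda_W \<phi> s) - legendre_Q \<phi> s) \<le> 18 / \<delta> * norm (ln (legendre_Q \<phi> s))"
      using eventually_estimate[of T]
    proof eventually_elim
      case (elim s)
      let ?Q = "legendre_Q \<phi> s"
      obtain R where R: "R \<ge> T" "1 \<le> ?Q" "3 / (200 * pi) * \<phi> R \<le> ?Q"
        "\<bar>ln (lambda_W \<phi> s) - ?Q\<bar> \<le> 9 * ln R"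
        using elim by auto
      have d: "\<delta> > 0" using \<delta>(1) by simp
      have "0 < 3 / (200 * pi) * \<phi> R" using T[OF R(1)] by simp
      then have "ln (3 / (200 * pi) * \<phi> R) \<le> ln ?Q" using R by (subst ln_le_cancel_iff) auto
      then have "\<delta> / 2 * ln R \<le> ln ?Q" using T[OF R(1)] by linarith
      then have "9 * ln R \<le> 18 / \<delta> * ln ?Q" using d by (simp add: field_simps)
      moreover have "0 \<le> ln ?Q" using R by simp
      ultimately show ?case using R(4) by simp
    qed
  qed
qed

end

theorem theorem1p2:
  fixes \<phi> :: "real \<Rightarrow> real"
  assumes "logarithmic_weight \<phi>"
  shows "(\<lambda>s. ln (lambda_W \<phi> s)) \<sim>[at_right 0] legendre_Q \<phi> \<and>
    (Liminf at_top (\<lambda>t. ereal (ln (\<phi> t) / ln t)) > 0 \<longrightarrow>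
      (\<lambda>s. ln (lambda_W \<phi> s) - legendre_Q \<phi> s) \<in> O[at_right 0](\<lambda>s. ln (legendre_Q \<phi> s)))"
proof -
  interpret log_weight \<phi> by unfold_locales (rule assms)
  show ?thesis using ln_lambda_W_asymp_equiv ln_lambda_W_bigo by blast
qed

end
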